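(* Let $(M,\overline X_1,\dots,\overline X_m)$ be a parallelizable manifold. There exists a unique graded connection $\nabla^c$ on $\Omega(M)$ such that $$\nabla^c_X(L_{\overline X_j})=\nabla^c_X(i_{\overline X_j})=0\qquad\text{for all }1\le j\le m\text{ and all }X\in\mathrm{Der}\,\Omega(M).$$
   Context: A parallelizable manifold $(M,\overline X_1,\dots,\overline X_m)$ is an $m$-dimensional smooth manifold $M$ with global vector fields $\overline X_1,\dots,\overline X_m$ that are linearly independent at every point. $\Omega(M)$ is the $\mathbb Z_2$-graded commutative algebra of differential forms on $M$ and $\mathrm{Der}\,\Omega(M)$ the graded left $\Omega(M)$-module of graded derivations of $\Omega(M)$. For a vector field $\overline X$, $L_{\overline X}$ (even) is the Lie derivative and $i_{\overline X}$ (odd) the interior product; $\{L_{\overline X_1},\dots,L_{\overline X_m},i_{\overline X_1},\dots,i_{\overline X_m}\}$ is a basis of $\mathrm{Der}\,\Omega(M)$ over $\Omega(M)$. A graded (linear) connection on $\Omega(M)$ is a $\mathbb Z_2$-degree preserving biadditive map $\nabla:\mathrm{Der}\,\Omega(M)\times\mathrm{Der}\,\Omega(M)\to\mathrm{Der}\,\Omega(M)$ with $\nabla_{\alpha X}Y=\alpha\nabla_XY$ and $\nabla_X(\alpha Y)=X(\alpha)Y+(-1)^{|X||\alpha|}\alpha\nabla_XY$ for homogeneous $X,Y\in\mathrm{Der}\,\Omega(M)$, $\alpha\in\Omega(M)$. *)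

theory Defs
  imports "HOL-Analysis.Analysis" "HOL-Library.Function_Algebras"
begin

(* Functions are added and multiplied pointwise (Function_Algebras); this is the addition used
   below for tangent vectors, differential forms and derivations. *)


section \<open>Smooth manifolds\<close>

fun higher_differentiable_on ::
  "'b::real_normed_vector set \<Rightarrow> ('b \<Rightarrow> 'c::real_normed_vector) \<Rightarrow> nat \<Rightarrow> bool" where
  "higher_differentiable_on S f 0 \<longleftrightarrow> continuous_on S f"
| "higher_differentiable_on S f (Suc n) \<longleftrightarrow>
     (\<forall>x\<in>S. f differentiable (at x)) \<and>
     (\<forall>v. higher_differentiable_on S (\<lambda>x. frechet_derivative f (at x) v) n)"

text \<open>Only used on open sets.\<close>

definition smooth_on :: "'b::real_normed_vector set \<Rightarrow> ('b \<Rightarrow> 'c::real_normed_vector) \<Rightarrow> bool" where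
  "smooth_on S f \<longleftrightarrow> (\<forall>n. higher_differentiable_on S f n)"

text \<open>The manifold is the whole type \<open>'a\<close>, its dimension is \<open>CARD('m)\<close>, and a chart is a
  coordinate domain together with the coordinate map on it.\<close>

type_synonym ('a, 'm) chart = "'a set \<times> ('a \<Rightarrow> real ^ 'm)"

definition is_chart :: "('a::topological_space, 'm::finite) chart \<Rightarrow> bool" where
  "is_chart c \<longleftrightarrow> (case c of (U, \<phi>) \<Rightarrow>
     open U \<and> open (\<phi> ` U) \<and> (\<exists>\<psi>. homeomorphism U (\<phi> ` U) \<phi> \<psi>))"

definition smoothly_compatible ::
  "('a::topological_space, 'm::finite) chart \<Rightarrow> ('a, 'm) chart \<Rightarrow> bool" where
  "smoothly_compatible c d \<longleftrightarrow> (case (c, d) of ((U, \<phi>), (V, \<phi>')) \<Rightarrow>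
     smooth_on (\<phi> ` (U \<inter> V)) (\<phi>' \<circ> inv_into U \<phi>))"

definition smooth_manifold ::
  "('a::{t2_space,second_countable_topology}, 'm::finite) chart set \<Rightarrow> bool" where
  "smooth_manifold A \<longleftrightarrow>
     (\<forall>c\<in>A. is_chart c) \<and> (\<Union>(U, \<phi>)\<in>A. U) = UNIV \<and>
     (\<forall>c\<in>A. \<forall>d\<in>A. smoothly_compatible c d)"

definition smooth_functions ::
  "('a::topological_space, 'm::finite) chart set \<Rightarrow> ('a \<Rightarrow> real) set" where
  "smooth_functions A = {f. \<forall>(U, \<phi>)\<in>A. smooth_on (\<phi> ` U) (f \<circ> inv_into U \<phi>)}"


section \<open>Vector fields\<close>

text \<open>Tangent vectors at \<open>p\<close> are the derivations at \<open>p\<close> of the algebra of smooth functions; the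
  value \<open>0\<close> off that algebra is only there to make them extensional.\<close>

type_synonym 'a tangent = "('a \<Rightarrow> real) \<Rightarrow> real"

definition tangent_space ::
  "('a::topological_space, 'm::finite) chart set \<Rightarrow> 'a \<Rightarrow> 'a tangent set" where
  "tangent_space A p = {v.
     (\<forall>f\<in>smooth_functions A. \<forall>g\<in>smooth_functions A. v (f + g) = v f + v g) \<and>
     (\<forall>c. \<forall>f\<in>smooth_functions A. v (\<lambda>q. c * f q) = c * v f) \<and>
     (\<forall>f\<in>smooth_functions A. \<forall>g\<in>smooth_functions A. v (f * g) = f p * v g + v f * g p) \<and>
     (\<forall>f. f \<notin> smooth_functions A \<longrightarrow> v f = 0)}"

type_synonym 'a vector_field = "'a \<Rightarrow> 'a tangent"

definition vector_fields ::
  "('a::topological_space, 'm::finite) chart set \<Rightarrow> 'a vector_field set" where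
  "vector_fields A = {X. (\<forall>p. X p \<in> tangent_space A p) \<and>
     (\<forall>f\<in>smooth_functions A. (\<lambda>p. X p f) \<in> smooth_functions A)}"

definition lie_bracket :: "'a vector_field \<Rightarrow> 'a vector_field \<Rightarrow> 'a vector_field" where
  "lie_bracket X Y = (\<lambda>p f. X p (\<lambda>q. Y q f) - Y p (\<lambda>q. X q f))"

definition parallelizable_manifold ::
  "('a::{t2_space,second_countable_topology}, 'm::finite) chart set \<Rightarrow>
   ('m \<Rightarrow> 'a vector_field) \<Rightarrow> bool" where
  "parallelizable_manifold A X \<longleftrightarrow>
     smooth_manifold A \<and> (\<forall>j. X j \<in> vector_fields A) \<and>
     (\<forall>p c. (\<forall>f. (\<Sum>j\<in>UNIV. c j * X j p f) = (0::real)) \<longrightarrow> (\<forall>j. c j = 0))"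


section \<open>Differential forms\<close>

text \<open>A form assigns to \<open>p\<close> an element of the direct sum over \<open>k\<close> of the spaces of alternating
  \<open>k\<close>-linear maps on the tangent space at \<open>p\<close>. Such an element is encoded as one function on
  lists of tangent vectors, whose restriction to lists of length \<open>k\<close> is its component of
  degree \<open>k\<close>; components of degree above the dimension vanish because they are alternating.
  Again the value \<open>0\<close> is prescribed on lists that are not made of tangent vectors at \<open>p\<close>.\<close>

type_synonym 'a form = "'a \<Rightarrow> 'a tangent list \<Rightarrow> real"

definition diff_forms :: "('a::topological_space, 'm::finite) chart set \<Rightarrow> 'a form set" where
  "diff_forms A = {\<omega>.
     (\<forall>p vs. \<not> set vs \<subseteq> tangent_space A p \<longrightarrow> \<omega> p vs = 0) \<and>
     (\<forall>p us ws v w. set us \<union> set ws \<union> {v, w} \<subseteq> tangent_space A p \<longrightarrow>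
        \<omega> p (us @ (v + w) # ws) = \<omega> p (us @ v # ws) + \<omega> p (us @ w # ws)) \<and>
     (\<forall>p us ws v c. set us \<union> set ws \<union> {v} \<subseteq> tangent_space A p \<longrightarrow>
        \<omega> p (us @ (\<lambda>f. c * v f) # ws) = c * \<omega> p (us @ v # ws)) \<and>
     (\<forall>p vs. \<not> distinct vs \<longrightarrow> \<omega> p vs = 0) \<and>
     (\<forall>Vs. set Vs \<subseteq> vector_fields A \<longrightarrow>
        (\<lambda>p. \<omega> p (map (\<lambda>V. V p) Vs)) \<in> smooth_functions A)}"

text \<open>Throughout, the degree \<open>k :: nat\<close> of a homogeneous object stands for its class modulo 2.\<close>

definition homogeneous_forms ::
  "('a::topological_space, 'm::finite) chart set \<Rightarrow> nat \<Rightarrow> 'a form set" where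
  "homogeneous_forms A k = {\<omega> \<in> diff_forms A. \<forall>p vs. odd (length vs + k) \<longrightarrow> \<omega> p vs = 0}"

definition scale_form :: "real \<Rightarrow> 'a form \<Rightarrow> 'a form" where
  "scale_form c \<omega> = (\<lambda>p vs. c * \<omega> p vs)"

text \<open>The shuffle formula: \<open>S\<close> is the set of positions of the vectors that are fed to \<open>\<alpha>\<close>, and
  the exponent counts the inversions of the corresponding shuffle.\<close>

definition wedge :: "'a form \<Rightarrow> 'a form \<Rightarrow> 'a form" where
  "wedge \<alpha> \<beta> = (\<lambda>p vs. \<Sum>S\<in>Pow {..<length vs}.
     (-1) ^ card {(i, j). i \<in> S \<and> j \<in> {..<length vs} - S \<and> j < i} *
     \<alpha> p (nths vs S) * \<beta> p (nths vs (- S)))"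


section \<open>Graded derivations\<close>

text \<open>Operators on forms are extended by \<open>0\<close> off \<open>diff_forms A\<close>.\<close>

type_synonym 'a operator = "'a form \<Rightarrow> 'a form"

definition homogeneous_derivations ::
  "('a::topological_space, 'm::finite) chart set \<Rightarrow> nat \<Rightarrow> 'a operator set" where
  "homogeneous_derivations A k = {D.
     (\<forall>\<omega>. \<omega> \<notin> diff_forms A \<longrightarrow> D \<omega> = 0) \<and>
     (\<forall>\<alpha>\<in>diff_forms A. \<forall>\<beta>\<in>diff_forms A. D (\<alpha> + \<beta>) = D \<alpha> + D \<beta>) \<and>
     (\<forall>c. \<forall>\<alpha>\<in>diff_forms A. D (scale_form c \<alpha>) = scale_form c (D \<alpha>)) \<and>
     (\<forall>l. \<forall>\<alpha>\<in>homogeneous_forms A l. D \<alpha> \<in> homogeneous_forms A (k + l)) \<and>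
     (\<forall>l. \<forall>\<alpha>\<in>homogeneous_forms A l. \<forall>\<beta>\<in>diff_forms A.
        D (wedge \<alpha> \<beta>) = wedge (D \<alpha>) \<beta> + scale_form ((-1) ^ (k * l)) (wedge \<alpha> (D \<beta>)))}"

definition derivations ::
  "('a::topological_space, 'm::finite) chart set \<Rightarrow> 'a operator set" where
  "derivations A =
     {D + E | D E. D \<in> homogeneous_derivations A 0 \<and> E \<in> homogeneous_derivations A 1}"

definition form_mult :: "'a form \<Rightarrow> 'a operator \<Rightarrow> 'a operator" where
  "form_mult \<alpha> D = (\<lambda>\<beta>. wedge \<alpha> (D \<beta>))"

definition interior_product ::
  "('a::topological_space, 'm::finite) chart set \<Rightarrow> 'a vector_field \<Rightarrow> 'a operator" where
  "interior_product A X \<omega> = (if \<omega> \<in> diff_forms A then (\<lambda>p vs. \<omega> p (X p # vs)) else 0)"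

text \<open>\<open>(L\<^sub>X \<omega>)(V\<^sub>1, \<dots>, V\<^sub>k) = X (\<omega>(V\<^sub>1, \<dots>, V\<^sub>k)) - (\<Sum>i. \<omega>(V\<^sub>1, \<dots>, [X, V\<^sub>i], \<dots>, V\<^sub>k))\<close> for all vector
  fields \<open>V\<^sub>1, \<dots>, V\<^sub>k\<close>. This determines \<open>L\<^sub>X \<omega>\<close>, since every tangent vector extends to a vector
  field.\<close>

definition lie_derivative ::
  "('a::topological_space, 'm::finite) chart set \<Rightarrow> 'a vector_field \<Rightarrow> 'a operator" where
  "lie_derivative A X \<omega> = (if \<omega> \<in> diff_forms A then
     (THE \<eta>. \<eta> \<in> diff_forms A \<and>
        (\<forall>Vs p. set Vs \<subseteq> vector_fields A \<longrightarrow>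
           \<eta> p (map (\<lambda>V. V p) Vs) =
             X p (\<lambda>q. \<omega> q (map (\<lambda>V. V q) Vs)) -
             (\<Sum>i<length Vs. \<omega> p (map (\<lambda>V. V p) (Vs[i := lie_bracket X (Vs ! i)])))))
     else 0)"


section \<open>Graded connections\<close>

text \<open>The first clause makes equality of connections the same as equality on \<open>derivations A\<close>.\<close>

definition graded_connection ::
  "('a::topological_space, 'm::finite) chart set \<Rightarrow>
   ('a operator \<Rightarrow> 'a operator \<Rightarrow> 'a operator) \<Rightarrow> bool" where
  "graded_connection A N \<longleftrightarrow>
     (\<forall>X Y. \<not> (X \<in> derivations A \<and> Y \<in> derivations A) \<longrightarrow> N X Y = 0) \<and>
     (\<forall>X\<in>derivations A. \<forall>Y\<in>derivations A. N X Y \<in> derivations A) \<and>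
     (\<forall>X\<in>derivations A. \<forall>X'\<in>derivations A. \<forall>Y\<in>derivations A.
        N (X + X') Y = N X Y + N X' Y) \<and>
     (\<forall>X\<in>derivations A. \<forall>Y\<in>derivations A. \<forall>Y'\<in>derivations A.
        N X (Y + Y') = N X Y + N X Y') \<and>
     (\<forall>k l. \<forall>X\<in>homogeneous_derivations A k. \<forall>Y\<in>homogeneous_derivations A l.
        N X Y \<in> homogeneous_derivations A (k + l)) \<and>
     (\<forall>k l n. \<forall>X\<in>homogeneous_derivations A k. \<forall>Y\<in>homogeneous_derivations A l.
        \<forall>\<alpha>\<in>homogeneous_forms A n.
          N (form_mult \<alpha> X) Y = form_mult \<alpha> (N X Y) \<and>
          N X (form_mult \<alpha> Y) =
            form_mult (X \<alpha>) Y + form_mult (scale_form ((-1) ^ (k * n)) \<alpha>) (N X Y))"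

end

theory Submission
  imports Defs
begin

text \<open>The Lie derivatives and interior products along the frame form a basis of the graded
  derivations over the algebra of forms: modulo the Lie derivatives a derivation \<open>D\<close> vanishes on
  functions, since \<open>f \<mapsto> D f\<close> is pointwise a tangent vector and hence a combination of the frame, and a
  derivation that vanishes on functions is determined by its values on the dual coframe. The
  connection must therefore differentiate the coefficients in this basis,
  \<open>\<nabla>\<^sub>D (\<Sum>\<^sub>j \<alpha>\<^sub>j L\<^sub>j + \<beta>\<^sub>j i\<^sub>j) = \<Sum>\<^sub>j D(\<alpha>\<^sub>j) L\<^sub>j + D(\<beta>\<^sub>j) i\<^sub>j\<close>, and this formula does define a graded connection.
  Geometry enters only through the fact that the frame spans every tangent space with smooth
  coefficients. A tangent vector is a derivation of the global smooth functions, so this needs bump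
  functions, Hadamard's lemma and Cramer's rule, but no partition of unity.\<close>

section \<open>Calculus of smooth maps\<close>

text \<open>A derivation acts on global forms and cannot simply be restricted to a chart. The frame
  and its dual coframe therefore serve as global coordinates: Euler's identity builds every form
  from functions and the coframe by global operations. The frame also extends a tangent vector to a
  global field with constant coefficients, which turns the implicit definition of the Lie derivative
  into a formula. Signs are the second obstacle. A form is a function on lists of all lengths and in
  general not homogeneous. Signs that depend on a degree are absorbed into the operator
  \<open>invol\<close>, which multiplies the value on a list by -1 to the power of its length.
  Inserting a vector into a product then obeys one uniform rule, and products are treated by
  induction on lists rather than by manipulating shuffles. The graded Leibniz rules speak of
  homogeneous arguments, so identities between derivations are proved for these and carried over by
  splitting into even and odd parts.\<close>

lemma higher_differentiable_on_cong:
  assumes "open S" "\<And>x. x \<in> S \<Longrightarrow> f x = g x"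
  shows "higher_differentiable_on S f n \<longleftrightarrow> higher_differentiable_on S g n"
  using assms(2)
proof (induction n arbitrary: f g)
  case 0
  then show ?case using continuous_on_cong by auto
next
  case (Suc n)
  have *: "higher_differentiable_on S g (Suc n)"
    if eq: "\<And>x. x \<in> S \<Longrightarrow> f x = g x" and hf: "higher_differentiable_on S f (Suc n)"
    for f g :: "'a \<Rightarrow> 'b"
  proof -
    have 1: "frechet_derivative f (at x) = frechet_derivative g (at x)" if "x \<in> S" for x
      using frechet_derivative_transform_within_open[OF _ \<open>open S\<close> that eq] hf that by simp
    have 2: "g differentiable (at x)" if "x \<in> S" for x
    proof -
      have "(f has_derivative frechet_derivative f (at x)) (at x)"
        using hf that by (simp add: frechet_derivative_works)
      then show ?thesis
        using has_derivative_transform_within_open[OF _ assms(1) that, of f _ UNIV g] eq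
        by (auto simp: differentiable_def)
    qed
    have "higher_differentiable_on S (\<lambda>x. frechet_derivative g (at x) v) n" for v
      using Suc.IH[of "\<lambda>x. frechet_derivative f (at x) v" "\<lambda>x. frechet_derivative g (at x) v"] 1 hf
      by auto
    with 2 show ?thesis by simp
  qed
  show ?case
  proof
    show "higher_differentiable_on S g (Suc n)" if "higher_differentiable_on S f (Suc n)"
      using *[of f g] Suc.prems that by blast
    show "higher_differentiable_on S f (Suc n)" if "higher_differentiable_on S g (Suc n)"
      using *[of g f] Suc.prems that by metis
  qed
qed

text \<open>\<open>frechet_derivative\<close> is a choice operator. With this rule later proofs
  supply an explicit derivative formula, valid on \<open>S\<close>, and continue the induction with
  that formula.\<close>

lemma higher_differentiable_on_SucI:
  assumes "open S" "\<And>x. x \<in> S \<Longrightarrow> (f has_derivative f' x) (at x)"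
    and "\<And>v. higher_differentiable_on S (\<lambda>x. f' x v) n"
  shows "higher_differentiable_on S f (Suc n)"
proof -
  have "frechet_derivative f (at x) = f' x" if "x \<in> S" for x
    using frechet_derivative_at[OF assms(2)[OF that]] by simp
  then have "higher_differentiable_on S (\<lambda>x. frechet_derivative f (at x) v) n" for v
    using assms(3)[of v] higher_differentiable_on_cong[OF assms(1), of "\<lambda>x. f' x v" "\<lambda>x. frechet_derivative f (at x) v" n]
    by simp
  then show ?thesis using assms(2) by (auto simp: differentiable_def)
qed

lemma higher_differentiable_on_has_derivative:
  assumes "higher_differentiable_on S f (Suc n)" "x \<in> S"
  shows "(f has_derivative frechet_derivative f (at x)) (at x)"
  using assms by (simp add: frechet_derivative_works)

lemma higher_differentiable_on_SucD:
  "higher_differentiable_on S f (Suc n) \<Longrightarrow> higher_differentiable_on S f n"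
proof (induction n arbitrary: f)
  case 0
  then show ?case
    by (auto intro!: differentiable_imp_continuous_on simp: differentiable_on_def differentiable_at_withinI)
qed auto

lemma higher_differentiable_on_subset:
  "higher_differentiable_on S f n \<Longrightarrow> T \<subseteq> S \<Longrightarrow> higher_differentiable_on T f n"
  by (induction n arbitrary: f) (auto intro: continuous_on_subset)

lemma higher_differentiable_on_local:
  assumes "\<And>x. x \<in> S \<Longrightarrow> \<exists>U. open U \<and> x \<in> U \<and> higher_differentiable_on U f n"
  shows "higher_differentiable_on S f n"
  using assms
proof (induction n arbitrary: f)
  case 0
  have "continuous (at x) f" if x: "x \<in> S" for x
    using 0[OF x] continuous_on_eq_continuous_at by auto
  then show ?case using continuous_at_imp_continuous_on by auto
next
  case (Suc n)
  have "f differentiable (at x)" if "x \<in> S" for x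
    using Suc.prems[OF that] by auto
  moreover have "higher_differentiable_on S (\<lambda>x. frechet_derivative f (at x) v) n" for v
    by (rule Suc.IH) (use Suc.prems in fastforce)
  ultimately show ?case by simp
qed

lemma higher_differentiable_on_const: "open S \<Longrightarrow> higher_differentiable_on S (\<lambda>_. c) n"
  by (induction n arbitrary: c) (simp_all add: frechet_derivative_const)

lemma higher_differentiable_on_bounded_linear:
  "bounded_linear L \<Longrightarrow> open S \<Longrightarrow> higher_differentiable_on S f n \<Longrightarrow>
     higher_differentiable_on S (\<lambda>x. L (f x)) n"
proof (induction n arbitrary: f)
  case 0
  then show ?case by (auto intro: bounded_linear.continuous_on)
next
  case (Suc n)
  show ?case
  proof (rule higher_differentiable_on_SucI[OF \<open>open S\<close>])
    show "((\<lambda>x. L (f x)) has_derivative (\<lambda>v. L (frechet_derivative f (at x) v))) (at x)" if "x \<in> S" for x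
      using bounded_linear.has_derivative[OF Suc.prems(1)]
        higher_differentiable_on_has_derivative[OF Suc.prems(3) that] by blast
    show "higher_differentiable_on S (\<lambda>x. L (frechet_derivative f (at x) v)) n" for v
      using Suc by auto
  qed
qed

lemma higher_differentiable_on_id: "open S \<Longrightarrow> higher_differentiable_on S (\<lambda>x. x) n"
  by (cases n) (simp_all add: frechet_derivative_ident higher_differentiable_on_const)

lemma higher_differentiable_on_add:
  "open S \<Longrightarrow> higher_differentiable_on S f n \<Longrightarrow> higher_differentiable_on S g n \<Longrightarrow>
     higher_differentiable_on S (\<lambda>x. f x + g x) n"
proof (induction n arbitrary: f g)
  case 0
  then show ?case by (auto intro: continuous_on_add)
next
  case (Suc n)
  show ?case
  proof (rule higher_differentiable_on_SucI[OF \<open>open S\<close>])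
    show "((\<lambda>x. f x + g x) has_derivative
        (\<lambda>v. frechet_derivative f (at x) v + frechet_derivative g (at x) v)) (at x)" if "x \<in> S" for x
      using Suc.prems that by (intro has_derivative_add higher_differentiable_on_has_derivative) auto
  qed (use Suc in auto)
qed

lemma higher_differentiable_on_sum:
  "open S \<Longrightarrow> (\<And>i. i \<in> I \<Longrightarrow> higher_differentiable_on S (f i) n) \<Longrightarrow>
     higher_differentiable_on S (\<lambda>x. \<Sum>i\<in>I. f i x) n"
  by (induction I rule: infinite_finite_induct)
    (auto intro: higher_differentiable_on_const higher_differentiable_on_add)

lemma higher_differentiable_on_bilinear:
  "bounded_bilinear B \<Longrightarrow> open S \<Longrightarrow> higher_differentiable_on S f n \<Longrightarrow> higher_differentiable_on S g n \<Longrightarrow>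
     higher_differentiable_on S (\<lambda>x. B (f x) (g x)) n"
proof (induction n arbitrary: f g)
  case 0
  then show ?case by (auto intro: bounded_bilinear.continuous_on)
next
  case (Suc n)
  show ?case
  proof (rule higher_differentiable_on_SucI[OF \<open>open S\<close>])
    show "((\<lambda>x. B (f x) (g x)) has_derivative
        (\<lambda>v. B (f x) (frechet_derivative g (at x) v) + B (frechet_derivative f (at x) v) (g x))) (at x)"
      if "x \<in> S" for x
      using Suc.prems that
      by (intro bounded_bilinear.FDERIV higher_differentiable_on_has_derivative) auto
    show "higher_differentiable_on S
        (\<lambda>x. B (f x) (frechet_derivative g (at x) v) + B (frechet_derivative f (at x) v) (g x)) n" for v
      using Suc.prems higher_differentiable_on_SucD[OF Suc.prems(3)] higher_differentiable_on_SucD[OF Suc.prems(4)]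
      by (intro higher_differentiable_on_add Suc.IH) auto
  qed
qed

text \<open>The chain rule term \<open>?g' (f x) (?f' x v)\<close> depends on x through both the
  base point and the direction. Expanding the direction in \<open>Basis\<close> separates the two:
  what remains is a sum of products of coordinates of \<open>?f' x v\<close> with composites
  \<open>?g' (f x) i\<close> for fixed i, and the induction hypothesis applies to the
  latter.\<close>

lemma higher_differentiable_on_compose:
  fixes f :: "'a::real_normed_vector \<Rightarrow> 'b::euclidean_space" and g :: "'b \<Rightarrow> 'c::real_normed_vector"
  assumes "open S" "open T" "f ` S \<subseteq> T"
  shows "higher_differentiable_on S f n \<Longrightarrow> higher_differentiable_on T g n \<Longrightarrow>
     higher_differentiable_on S (\<lambda>x. g (f x)) n"
proof (induction n arbitrary: g)
  case 0
  then show ?case using assms(3) by (auto intro: continuous_on_compose2)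
next
  case (Suc n)
  let ?f' = "\<lambda>x. frechet_derivative f (at x)" and ?g' = "\<lambda>x. frechet_derivative g (at x)"
  show ?case
  proof (rule higher_differentiable_on_SucI[OF \<open>open S\<close>])
    show "((\<lambda>x. g (f x)) has_derivative (\<lambda>v. \<Sum>i\<in>Basis. (?f' x v \<bullet> i) *\<^sub>R ?g' (f x) i)) (at x)"
      if "x \<in> S" for x
    proof -
      have g': "(g has_derivative ?g' (f x)) (at (f x))"
        using assms(3) that by (intro higher_differentiable_on_has_derivative[OF Suc.prems(2)]) auto
      have "((\<lambda>x. g (f x)) has_derivative (\<lambda>v. ?g' (f x) (?f' x v))) (at x)"
        using has_derivative_compose[OF higher_differentiable_on_has_derivative[OF Suc.prems(1) that] g'] .
      moreover have "\<And>w. ?g' (f x) w = (\<Sum>i\<in>Basis. (w \<bullet> i) *\<^sub>R ?g' (f x) i)"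
      proof -
        fix w
        interpret bounded_linear "?g' (f x)" using g' by (rule has_derivative_bounded_linear)
        have "?g' (f x) (\<Sum>i\<in>Basis. (w \<bullet> i) *\<^sub>R i) = (\<Sum>i\<in>Basis. (w \<bullet> i) *\<^sub>R ?g' (f x) i)"
          by (simp add: sum scaleR)
        then show "?g' (f x) w = (\<Sum>i\<in>Basis. (w \<bullet> i) *\<^sub>R ?g' (f x) i)"
          by (simp only: euclidean_representation)
      qed
      then have "(\<lambda>v. ?g' (f x) (?f' x v)) = (\<lambda>v. \<Sum>i\<in>Basis. (?f' x v \<bullet> i) *\<^sub>R ?g' (f x) i)"
        by blast
      ultimately show ?thesis by (simp only:)
    qed
    show "higher_differentiable_on S (\<lambda>x. \<Sum>i\<in>Basis. (?f' x v \<bullet> i) *\<^sub>R ?g' (f x) i) n" for v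
    proof (rule higher_differentiable_on_sum[OF \<open>open S\<close>],
        rule higher_differentiable_on_bilinear[OF bounded_bilinear_scaleR \<open>open S\<close>])
      fix i :: 'b
      show "higher_differentiable_on S (\<lambda>x. ?f' x v \<bullet> i) n"
        using Suc.prems(1)
        by (intro higher_differentiable_on_bounded_linear[OF bounded_linear_inner_left \<open>open S\<close>]) simp
      show "higher_differentiable_on S (\<lambda>x. ?g' (f x) i) n"
        using Suc.prems(2) by (intro Suc.IH higher_differentiable_on_SucD[OF Suc.prems(1)]) simp
    qed
  qed
qed

text \<open>The derivative of 1/f is a polynomial in f' and 1/f itself, so order n + 1 for the
  inverse follows from order n for the inverse and for f'.\<close>

lemma higher_differentiable_on_inverse:
  fixes f :: "'a::real_normed_vector \<Rightarrow> real"
  assumes "open S" "\<And>x. x \<in> S \<Longrightarrow> f x \<noteq> 0"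
  shows "higher_differentiable_on S f n \<Longrightarrow> higher_differentiable_on S (\<lambda>x. inverse (f x)) n"
proof (induction n)
  case 0
  then show ?case using assms(2) by (auto intro: continuous_on_inverse)
next
  case (Suc n)
  let ?f' = "\<lambda>x. frechet_derivative f (at x)"
  note mult = higher_differentiable_on_bilinear[OF bounded_bilinear_mult assms(1)]
  show ?case
  proof (rule higher_differentiable_on_SucI[OF \<open>open S\<close>])
    show "((\<lambda>x. inverse (f x)) has_derivative (\<lambda>v. (-1) * (inverse (f x) * ?f' x v * inverse (f x)))) (at x)"
      if "x \<in> S" for x
      using Deriv.has_derivative_inverse[OF assms(2)[OF that] higher_differentiable_on_has_derivative[OF Suc.prems that]]
      by simp
    show "higher_differentiable_on S (\<lambda>x. (-1) * (inverse (f x) * ?f' x v * inverse (f x))) n" for v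
    proof -
      have "higher_differentiable_on S (\<lambda>x. inverse (f x)) n"
        using Suc.IH higher_differentiable_on_SucD[OF Suc.prems] by blast
      moreover have "higher_differentiable_on S (\<lambda>x. ?f' x v) n"
        using Suc.prems by simp
      ultimately show ?thesis
        by (intro mult higher_differentiable_on_const[OF assms(1)])
    qed
  qed
qed

section \<open>Closure properties of smooth maps\<close>

lemma smooth_on_cong: "open S \<Longrightarrow> (\<And>x. x \<in> S \<Longrightarrow> f x = g x) \<Longrightarrow> smooth_on S f \<longleftrightarrow> smooth_on S g"
  unfolding smooth_on_def using higher_differentiable_on_cong[of S f g] by auto

lemma smooth_on_subset: "smooth_on S f \<Longrightarrow> T \<subseteq> S \<Longrightarrow> smooth_on T f"
  unfolding smooth_on_def using higher_differentiable_on_subset by blast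

lemma smooth_on_local:
  "(\<And>x. x \<in> S \<Longrightarrow> \<exists>U. open U \<and> x \<in> U \<and> smooth_on U f) \<Longrightarrow> smooth_on S f"
  unfolding smooth_on_def by (meson higher_differentiable_on_local)

lemma smooth_on_continuous: "smooth_on S f \<Longrightarrow> continuous_on S f"
  unfolding smooth_on_def by (metis higher_differentiable_on.simps(1))

lemma smooth_on_frechet_derivative: "smooth_on S f \<Longrightarrow> smooth_on S (\<lambda>x. frechet_derivative f (at x) v)"
  unfolding smooth_on_def by (metis higher_differentiable_on.simps(2))

lemma smooth_on_has_derivative:
  "smooth_on S f \<Longrightarrow> x \<in> S \<Longrightarrow> (f has_derivative frechet_derivative f (at x)) (at x)"
  unfolding smooth_on_def using higher_differentiable_on_has_derivative by blast

lemma smooth_on_const: "open S \<Longrightarrow> smooth_on S (\<lambda>_. c)"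
  unfolding smooth_on_def using higher_differentiable_on_const by blast

lemma smooth_on_id: "open S \<Longrightarrow> smooth_on S (\<lambda>x. x)"
  unfolding smooth_on_def using higher_differentiable_on_id by blast

lemma smooth_on_bounded_linear: "bounded_linear L \<Longrightarrow> open S \<Longrightarrow> smooth_on S f \<Longrightarrow> smooth_on S (\<lambda>x. L (f x))"
  unfolding smooth_on_def using higher_differentiable_on_bounded_linear by blast

lemma smooth_on_add: "open S \<Longrightarrow> smooth_on S f \<Longrightarrow> smooth_on S g \<Longrightarrow> smooth_on S (\<lambda>x. f x + g x)"
  unfolding smooth_on_def using higher_differentiable_on_add by blast

lemma smooth_on_bilinear:
  "bounded_bilinear B \<Longrightarrow> open S \<Longrightarrow> smooth_on S f \<Longrightarrow> smooth_on S g \<Longrightarrow> smooth_on S (\<lambda>x. B (f x) (g x))"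
  unfolding smooth_on_def using higher_differentiable_on_bilinear by blast

lemmas smooth_on_mult = smooth_on_bilinear[OF bounded_bilinear_mult]

lemma smooth_on_diff:
  assumes "open S" "smooth_on S f" "smooth_on S g" shows "smooth_on S (\<lambda>x. f x - g x)"
  using smooth_on_add[OF assms(1,2) smooth_on_bounded_linear[OF bounded_linear_minus[OF bounded_linear_ident] assms(1,3)]]
  by simp

lemma smooth_on_compose:
  fixes f :: "'a::real_normed_vector \<Rightarrow> 'b::euclidean_space" and g :: "'b \<Rightarrow> 'c::real_normed_vector"
  shows "open S \<Longrightarrow> open T \<Longrightarrow> f ` S \<subseteq> T \<Longrightarrow> smooth_on S f \<Longrightarrow> smooth_on T g \<Longrightarrow> smooth_on S (\<lambda>x. g (f x))"
  unfolding smooth_on_def using higher_differentiable_on_compose by blast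

lemma smooth_on_inverse:
  fixes f :: "'a::real_normed_vector \<Rightarrow> real"
  shows "open S \<Longrightarrow> (\<And>x. x \<in> S \<Longrightarrow> f x \<noteq> 0) \<Longrightarrow> smooth_on S f \<Longrightarrow> smooth_on S (\<lambda>x. inverse (f x))"
  unfolding smooth_on_def using higher_differentiable_on_inverse by blast


section \<open>Bump functions and Hadamard's lemma\<close>

text \<open>The flat function exp(-1/x), divided by x to the power k. Differentiation produces
  linear combinations of the same functions with exponents k + 1 and k + 2, so the family is what an
  induction on the order of differentiability needs.\<close>

definition exp_bump :: "nat \<Rightarrow> real \<Rightarrow> real" where
  "exp_bump k x = (if x > 0 then exp (- inverse x) * inverse x ^ k else 0)"

lemma exp_bump_tendsto_0: "(exp_bump k \<longlongrightarrow> 0) (at 0)"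
proof (rule filterlim_split_at)
  have "((\<lambda>x::real. inverse x ^ k / exp (inverse x)) \<longlongrightarrow> 0) (at_right 0)"
    using filterlim_compose[OF tendsto_power_div_exp_0 filterlim_inverse_at_top_right] .
  then show "(exp_bump k \<longlongrightarrow> 0) (at_right 0)"
    by (rule Lim_transform_eventually)
      (auto simp: eventually_at_filter exp_bump_def exp_minus field_simps)
  show "(exp_bump k \<longlongrightarrow> 0) (at_left 0)"
    by (rule Lim_transform_eventually[OF tendsto_const])
      (auto simp: eventually_at_filter exp_bump_def)
qed

lemma exp_bump_has_field_derivative:
  "(exp_bump k has_field_derivative (exp_bump (k + 2) x - real k * exp_bump (k + 1) x)) (at x)"
proof -
  consider "x > 0" | "x < 0" | "x = 0" by linarith
  then show ?thesis
  proof cases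
    case 1
    have "((\<lambda>x. exp (- inverse x) * inverse x ^ k) has_field_derivative
        (exp_bump (k + 2) x - real k * exp_bump (k + 1) x)) (at x)"
    proof (cases k)
      case (Suc n)
      with 1 show ?thesis
        by (auto intro!: derivative_eq_intros simp: exp_bump_def field_simps power2_eq_square)
          (metis One_nat_def power_eq_if)
    qed (use 1 in \<open>auto intro!: derivative_eq_intros simp: exp_bump_def field_simps power2_eq_square\<close>)
    then show ?thesis
      by (rule has_field_derivative_transform_within_open[where S="{0<..}"])
        (use 1 in \<open>auto simp: exp_bump_def\<close>)
  next
    case 2
    have "((\<lambda>_. 0) has_field_derivative (exp_bump (k + 2) x - real k * exp_bump (k + 1) x)) (at x)"
      using 2 by (auto simp: exp_bump_def)
    then show ?thesis
      by (rule has_field_derivative_transform_within_open[where S="{..<0}"])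
        (use 2 in \<open>auto simp: exp_bump_def\<close>)
  next
    case 3
    \<comment> \<open>Away from 0 the difference quotient of \<open>exp_bump k\<close> at 0 is
      exactly \<open>exp_bump (k + 1)\<close>.\<close>
    have "((\<lambda>y. (exp_bump k y - exp_bump k 0) / (y - 0)) \<longlongrightarrow> 0) (at 0)"
      by (rule Lim_transform_eventually[OF exp_bump_tendsto_0[of "k + 1"]])
        (auto simp: eventually_at_filter exp_bump_def field_simps)
    then show ?thesis
      using 3 by (simp add: has_field_derivative_iff exp_bump_def)
  qed
qed

lemma smooth_on_exp_bump: "smooth_on UNIV (exp_bump k)"
proof -
  have "higher_differentiable_on UNIV (exp_bump k) n" for n
  proof (induction n arbitrary: k)
    case 0
    show ?case
      using exp_bump_has_field_derivative by (auto intro!: DERIV_continuous_on)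
  next
    case (Suc n)
    show ?case
    proof (rule higher_differentiable_on_SucI)
      show "(exp_bump k has_derivative (\<lambda>v. v * exp_bump (k + 2) x + (- real k * v) * exp_bump (k + 1) x)) (at x)" for x
        by (rule has_derivative_eq_rhs[OF exp_bump_has_field_derivative[unfolded has_field_derivative_def]])
          (auto simp: algebra_simps)
      show "higher_differentiable_on UNIV (\<lambda>x. v * exp_bump (k + 2) x + (- real k * v) * exp_bump (k + 1) x) n" for v
        by (intro higher_differentiable_on_add higher_differentiable_on_bounded_linear[OF bounded_linear_mult_right]
            Suc.IH open_UNIV)
    qed simp
  qed
  then show ?thesis by (simp add: smooth_on_def)
qed

lemma exists_smooth_bump:
  fixes x0 :: "'b::euclidean_space"
  assumes "r > 0"
  obtains b :: "'b \<Rightarrow> real" where "smooth_on UNIV b" "b x0 = 1" "\<And>x. x \<notin> ball x0 r \<Longrightarrow> b x = 0"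
proof
  \<comment> \<open>The argument of \<open>exp_bump 0\<close> is positive exactly on the open ball.
    The squared norm, written as an inner product, is smooth at \<open>x0\<close> as well, and the
    factor in front normalizes the value at \<open>x0\<close> to 1.\<close>
  let ?b = "\<lambda>x. exp (inverse (r\<^sup>2)) * exp_bump 0 (r\<^sup>2 - (x - x0) \<bullet> (x - x0))"
  have sub: "smooth_on UNIV (\<lambda>x. x - x0)"
    by (intro smooth_on_diff smooth_on_id smooth_on_const) auto
  have "smooth_on UNIV (\<lambda>x. r\<^sup>2 - (x - x0) \<bullet> (x - x0))"
    by (intro smooth_on_diff smooth_on_const smooth_on_bilinear[OF bounded_bilinear_inner] sub) auto
  then have "smooth_on UNIV (\<lambda>x. exp_bump 0 (r\<^sup>2 - (x - x0) \<bullet> (x - x0)))"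
    by (rule smooth_on_compose[OF open_UNIV open_UNIV subset_UNIV _ smooth_on_exp_bump])
  then show "smooth_on UNIV ?b"
    by (intro smooth_on_bounded_linear[OF bounded_linear_mult_right]) auto
  show "?b x0 = 1" using assms by (simp add: exp_bump_def exp_minus)
  show "?b x = 0" if "x \<notin> ball x0 r" for x
  proof -
    have "r \<le> norm (x - x0)" using that by (simp add: dist_norm norm_minus_commute)
    then have "r\<^sup>2 \<le> (x - x0) \<bullet> (x - x0)"
      using assms by (simp add: power2_norm_eq_inner[symmetric] power_mono)
    then show ?thesis by (simp add: exp_bump_def)
  qed
qed

section \<open>Integrals along segments and Hadamard's lemma\<close>

lemma segment_in_ball:
  fixes x0 :: "'b::real_normed_vector"
  assumes "x \<in> ball x0 R" "t \<in> cbox 0 (1::real)"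
  shows "x0 + t *\<^sub>R (x - x0) \<in> ball x0 R"
proof -
  have "\<bar>t\<bar> * norm (x - x0) \<le> 1 * norm (x - x0)"
    using assms(2) by (intro mult_right_mono) (auto simp: cbox_interval)
  then show ?thesis using assms(1) by (simp add: dist_norm norm_minus_commute)
qed

lemma continuous_on_segment:
  fixes x0 :: "'b::real_normed_vector" and F :: "'b \<Rightarrow> real"
  assumes "continuous_on (ball x0 R) F"
  shows "continuous_on (ball x0 R \<times> cbox 0 1) (\<lambda>(x, t). t ^ k * F (x0 + t *\<^sub>R (x - x0)))"
proof -
  have "(\<lambda>p. x0 + snd p *\<^sub>R (fst p - x0)) ` (ball x0 R \<times> cbox 0 1) \<subseteq> ball x0 R"
    using segment_in_ball[of _ x0 R] by (fastforce simp del: mem_ball mem_box_real)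
  then show ?thesis
    unfolding split_beta by (intro continuous_intros continuous_on_compose2[OF assms])
qed

lemma integrable_on_segment:
  fixes x0 :: "'b::real_normed_vector" and F :: "'b \<Rightarrow> real"
  assumes "continuous_on (ball x0 R) F" "x \<in> ball x0 R"
  shows "(\<lambda>t. t ^ k * F (x0 + t *\<^sub>R (x - x0))) integrable_on cbox 0 1"
proof (rule integrable_continuous)
  have "continuous_on (cbox 0 1) (\<lambda>t. case (x, t) of (x, t) \<Rightarrow> t ^ k * F (x0 + t *\<^sub>R (x - x0)))"
    by (rule continuous_on_compose2[OF continuous_on_segment[OF assms(1)]])
      (use assms(2) in \<open>auto intro!: continuous_intros\<close>)
  then show "continuous_on (cbox 0 1) (\<lambda>t. t ^ k * F (x0 + t *\<^sub>R (x - x0)))" by simp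
qed

text \<open>Differentiating under the integral sign replaces F by a directional derivative, and the
  chain rule contributes one more factor t. The weight \<open>t ^ k\<close> makes the family of
  these integrals closed under differentiation; Hadamard's lemma is the case k = 0.\<close>

lemma higher_differentiable_on_segment_integral:
  fixes F :: "'b::euclidean_space \<Rightarrow> real"
  assumes "smooth_on (ball x0 R) F"
  shows "higher_differentiable_on (ball x0 R)
    (\<lambda>x. integral (cbox 0 1) (\<lambda>t. t ^ k * F (x0 + t *\<^sub>R (x - x0)))) n"
  using assms
proof (induction n arbitrary: k F)
  case 0
  show ?case
    using integral_continuous_on_param[OF continuous_on_segment[OF smooth_on_continuous[OF 0]]] by simp
next
  case (Suc n)
  let ?F' = "\<lambda>x. frechet_derivative F (at x)"
  let ?seg = "\<lambda>x t. x0 + t *\<^sub>R (x - x0)"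
  note F'_smooth = smooth_on_frechet_derivative[OF Suc.prems]
  \<comment> \<open>\<open>leibniz_rule\<close> takes the partial derivative as a bounded linear map
    varying continuously. \<open>Blinfun\<close> represents it where the derivative is known to be
    bounded linear, that is, for x in the ball and t in the unit interval.\<close>
  define fx where "fx x t = Blinfun (\<lambda>v. t ^ Suc k * ?F' (?seg x t) v)" for x and t :: real
  have F': "(F has_derivative ?F' (?seg x t)) (at (?seg x t))"
    if "x \<in> ball x0 R" "t \<in> cbox 0 1" for x t
    using smooth_on_has_derivative[OF Suc.prems segment_in_ball[OF that]] .
  have fx: "blinfun_apply (fx x t) = (\<lambda>v. t ^ Suc k * ?F' (?seg x t) v)"
    if "x \<in> ball x0 R" "t \<in> cbox 0 1" for x t
    unfolding fx_def
    using bounded_linear_Blinfun_apply[OF bounded_linear_const_mult[OF has_derivative_bounded_linear[OF F'[OF that]]]] .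
  have cont: "continuous_on (ball x0 R \<times> cbox 0 1) (\<lambda>(x, t). fx x t)"
  proof (rule continuous_on_blinfun_componentwise)
    fix i :: 'b
    have "continuous_on (ball x0 R \<times> cbox 0 1) (\<lambda>(x, t). t ^ Suc k * ?F' (?seg x t) i)"
      by (rule continuous_on_segment[OF smooth_on_continuous[OF F'_smooth]])
    then show "continuous_on (ball x0 R \<times> cbox 0 1) (\<lambda>p. blinfun_apply (case p of (x, t) \<Rightarrow> fx x t) i)"
      by (rule continuous_on_eq) (auto simp: fx)
  qed
  show ?case
  proof (rule higher_differentiable_on_SucI)
    fix x assume x: "x \<in> ball x0 R"
    have "((\<lambda>x. integral (cbox 0 1) (\<lambda>t. t ^ k * F (?seg x t))) has_derivative
        blinfun_apply (integral (cbox 0 1) (fx x))) (at x within ball x0 R)"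
    proof (rule leibniz_rule[OF _ _ cont x convex_ball])
      fix y t assume yt: "y \<in> ball x0 R" "t \<in> cbox (0::real) 1"
      have "((\<lambda>y. ?seg y t) has_derivative (\<lambda>v. t *\<^sub>R v)) (at y)"
        by (auto intro!: derivative_eq_intros)
      from has_derivative_compose[OF this F'[OF yt]]
      have "((\<lambda>y. F (?seg y t)) has_derivative (\<lambda>v. ?F' (?seg y t) (t *\<^sub>R v))) (at y)" .
      then have "((\<lambda>y. t ^ k * F (?seg y t)) has_derivative (\<lambda>v. t ^ k * ?F' (?seg y t) (t *\<^sub>R v))) (at y)"
        by (rule has_derivative_mult_right)
      moreover have "t ^ k * ?F' (?seg y t) (t *\<^sub>R v) = t ^ Suc k * ?F' (?seg y t) v" for v
        using linear_scale[OF has_derivative_linear[OF F'[OF yt]], of t v] by simp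
      ultimately show "((\<lambda>y. t ^ k * F (?seg y t)) has_derivative blinfun_apply (fx y t)) (at y within ball x0 R)"
        using fx[OF yt] by (simp add: has_derivative_at_withinI)
    next
      fix y assume y: "y \<in> ball x0 R"
      show "(\<lambda>t. t ^ k * F (?seg y t)) integrable_on cbox 0 1"
        by (rule integrable_on_segment[OF smooth_on_continuous[OF Suc.prems] y])
    qed
    then have "((\<lambda>x. integral (cbox 0 1) (\<lambda>t. t ^ k * F (?seg x t))) has_derivative
        blinfun_apply (integral (cbox 0 1) (fx x))) (at x)"
      by (simp only: at_within_open[OF x open_ball])
    moreover have "blinfun_apply (integral (cbox 0 1) (fx x))
        = (\<lambda>v. integral (cbox 0 1) (\<lambda>t. t ^ Suc k * ?F' (?seg x t) v))"
    proof
      fix v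
      have "fx x integrable_on cbox 0 1"
        by (rule integrable_continuous, rule continuous_on_compose2[OF cont, of _ "\<lambda>t. (x, t)", simplified])
          (use x in \<open>auto intro!: continuous_intros\<close>)
      from integral_linear[OF this bounded_linear_apply_blinfun, of v]
      have "blinfun_apply (integral (cbox 0 1) (fx x)) v = integral (cbox 0 1) (\<lambda>t. blinfun_apply (fx x t) v)"
        by (simp add: o_def)
      also have "\<dots> = integral (cbox 0 1) (\<lambda>t. t ^ Suc k * ?F' (?seg x t) v)"
        using x by (intro integral_cong) (simp add: fx)
      finally show "blinfun_apply (integral (cbox 0 1) (fx x)) v
        = integral (cbox 0 1) (\<lambda>t. t ^ Suc k * ?F' (?seg x t) v)" .
    qed
    ultimately show "((\<lambda>x. integral (cbox 0 1) (\<lambda>t. t ^ k * F (?seg x t))) has_derivative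
        (\<lambda>v. integral (cbox 0 1) (\<lambda>t. t ^ Suc k * ?F' (?seg x t) v))) (at x)"
      by (rule has_derivative_eq_rhs)
  next
    show "higher_differentiable_on (ball x0 R)
        (\<lambda>x. integral (cbox 0 1) (\<lambda>t. t ^ Suc k * ?F' (?seg x t) v)) n" for v
      by (rule Suc.IH[OF F'_smooth])
  qed simp
qed

text \<open>The fundamental theorem of calculus along the segment from \<open>x0\<close> to x
  expresses F(x) - F(x0) as the integral of the derivative in direction x - x0; expanding this
  direction in coordinates gives the factors. A ball contains all these segments.\<close>

lemma hadamard:
  fixes F :: "real ^ 'm \<Rightarrow> real"
  assumes F: "smooth_on (ball x0 R) F"
  obtains g where "\<And>i. smooth_on (ball x0 R) (g i)"
    "\<And>x. x \<in> ball x0 R \<Longrightarrow> F x = F x0 + (\<Sum>i\<in>UNIV. (x $ i - x0 $ i) * g i x)"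
proof
  let ?F' = "\<lambda>x. frechet_derivative F (at x)"
  let ?seg = "\<lambda>x t. x0 + t *\<^sub>R (x - x0)"
  \<comment> \<open>The average of the i-th partial derivative over the segment; the factor
    \<open>t ^ 0\<close> matches the weighted integrals above.\<close>
  let ?g = "\<lambda>i x. integral (cbox 0 1) (\<lambda>t. t ^ 0 * ?F' (?seg x t) (axis i 1))"
  note F'_smooth = smooth_on_frechet_derivative[OF F]
  show "smooth_on (ball x0 R) (?g i)" for i
    unfolding smooth_on_def
    using higher_differentiable_on_segment_integral[OF F'_smooth] by blast
  show "F x = F x0 + (\<Sum>i\<in>UNIV. (x $ i - x0 $ i) * ?g i x)" if x: "x \<in> ball x0 R" for x
  proof -
    have F': "(F has_derivative ?F' (?seg x t)) (at (?seg x t))" if "t \<in> cbox 0 1" for t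
      using smooth_on_has_derivative[OF F segment_in_ball[OF x that]] .
    have expand: "?F' (?seg x t) (x - x0) = (\<Sum>i\<in>UNIV. (x $ i - x0 $ i) * ?F' (?seg x t) (axis i 1))"
      if "t \<in> cbox 0 1" for t
    proof -
      interpret bounded_linear "?F' (?seg x t)"
        using F'[OF that] by (rule has_derivative_bounded_linear)
      have "?F' (?seg x t) (\<Sum>i\<in>UNIV. ((x - x0) $ i) *\<^sub>R axis i 1)
          = (\<Sum>i\<in>UNIV. (x $ i - x0 $ i) * ?F' (?seg x t) (axis i 1))"
        by (simp add: sum scaleR)
      then show ?thesis
        using basis_expansion[of "x - x0"] by (simp add: scalar_mult_eq_scaleR)
    qed
    have "((\<lambda>t. F (?seg x t)) has_vector_derivative ?F' (?seg x t) (x - x0)) (at t within {0..1})"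
      if "t \<in> {0..1}" for t
    proof -
      have t: "t \<in> cbox 0 1" using that by (simp add: cbox_interval)
      have "((\<lambda>t. ?seg x t) has_derivative (\<lambda>s. s *\<^sub>R (x - x0))) (at t within {0..1})"
        by (auto intro!: derivative_eq_intros)
      from has_derivative_compose[OF this F'[OF t]]
      show ?thesis
        using linear_scale[OF has_derivative_linear[OF F'[OF t]]]
        by (simp add: has_vector_derivative_def)
    qed
    then have "((\<lambda>t. ?F' (?seg x t) (x - x0)) has_integral F x - F x0) {0..1}"
      using fundamental_theorem_of_calculus[of 0 1 "\<lambda>t. F (?seg x t)"] by simp
    then have "F x - F x0 = integral (cbox 0 1) (\<lambda>t. ?F' (?seg x t) (x - x0))"
      by (simp add: cbox_interval integral_unique)
    also have "\<dots> = integral (cbox 0 1) (\<lambda>t. \<Sum>i\<in>UNIV. (x $ i - x0 $ i) * ?F' (?seg x t) (axis i 1))"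
      by (rule integral_cong) (rule expand)
    also have "\<dots> = (\<Sum>i\<in>UNIV. integral (cbox 0 1) (\<lambda>t. (x $ i - x0 $ i) * ?F' (?seg x t) (axis i 1)))"
    proof (rule integral_sum)
      fix i
      have "(\<lambda>t. t ^ 0 * ?F' (?seg x t) (axis i 1)) integrable_on cbox 0 1"
        by (rule integrable_on_segment[OF smooth_on_continuous[OF F'_smooth] x])
      then show "(\<lambda>t. (x $ i - x0 $ i) * ?F' (?seg x t) (axis i 1)) integrable_on cbox 0 1"
        by (drule_tac c = "x $ i - x0 $ i" in integrable_cmul) simp
    qed simp
    finally show ?thesis by simp
  qed
qed


section \<open>Smooth functions and tangent vectors\<close>

locale smooth_mfd =
  fixes A :: "('a::{t2_space,second_countable_topology}, 'm::finite) chart set"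
  assumes smooth_manifold: "smooth_manifold A"
begin

abbreviation "C \<equiv> smooth_functions A"
abbreviation "T \<equiv> tangent_space A"
abbreviation "VF \<equiv> vector_fields A"

text \<open>\<open>is_chart\<close> provides some inverse of the coordinate map, whereas
  compatibility and smooth functions are phrased with \<open>inv_into U \<phi>\<close>. Since \<phi>
  is injective on U, the two agree on the image.\<close>

lemma
  assumes "(U, \<phi>) \<in> A"
  shows chart_open: "open U"
    and chart_image_open: "open (\<phi> ` U)"
    and chart_homeomorphism: "homeomorphism U (\<phi> ` U) \<phi> (inv_into U \<phi>)"
proof -
  have c: "is_chart (U, \<phi>)" using smooth_manifold assms by (auto simp: smooth_manifold_def)
  then show "open U" "open (\<phi> ` U)" by (auto simp: is_chart_def)
  obtain \<psi> where \<psi>: "homeomorphism U (\<phi> ` U) \<phi> \<psi>" using c by (auto simp: is_chart_def)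
  have inj: "inj_on \<phi> U" using \<psi> by (metis homeomorphism_def inj_on_inverseI)
  then show "homeomorphism U (\<phi> ` U) \<phi> (inv_into U \<phi>)"
    by (intro homeomorphism_cong[OF \<psi>]) (use \<psi> in \<open>auto simp: homeomorphism_def\<close>)
qed

lemma
  assumes "(U, \<phi>) \<in> A"
  shows chart_inv: "q \<in> U \<Longrightarrow> inv_into U \<phi> (\<phi> q) = q"
    and chart_inv_mem: "x \<in> \<phi> ` U \<Longrightarrow> inv_into U \<phi> x \<in> U"
    and chart_inv_right: "x \<in> \<phi> ` U \<Longrightarrow> \<phi> (inv_into U \<phi> x) = x"
    and chart_inv_continuous: "continuous_on (\<phi> ` U) (inv_into U \<phi>)"
  using chart_homeomorphism[OF assms] by (auto simp: homeomorphism_def)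

lemma chart_at: obtains U \<phi> where "(U, \<phi>) \<in> A" "p \<in> U"
proof -
  have "p \<in> (\<Union>(U, \<phi>)\<in>A. U)" using smooth_manifold by (simp add: smooth_manifold_def)
  then show ?thesis using that by auto
qed

lemma smooth_functions_chart:
  "f \<in> C \<Longrightarrow> (U, \<phi>) \<in> A \<Longrightarrow> smooth_on (\<phi> ` U) (\<lambda>x. f (inv_into U \<phi> x))"
  by (auto simp: smooth_functions_def o_def)

lemma smooth_functionsI:
  "(\<And>U \<phi>. (U, \<phi>) \<in> A \<Longrightarrow> smooth_on (\<phi> ` U) (\<lambda>x. f (inv_into U \<phi> x))) \<Longrightarrow> f \<in> C"
  by (auto simp: smooth_functions_def o_def)

lemma smooth_const [intro, simp]: "(\<lambda>_. c) \<in> C"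
  by (rule smooth_functionsI) (simp add: smooth_on_const chart_image_open)

lemma smooth_add [intro]: "f \<in> C \<Longrightarrow> g \<in> C \<Longrightarrow> (\<lambda>q. f q + g q) \<in> C"
  by (rule smooth_functionsI) (intro smooth_on_add chart_image_open smooth_functions_chart)

lemma smooth_mult [intro]: "f \<in> C \<Longrightarrow> g \<in> C \<Longrightarrow> (\<lambda>q. f q * g q) \<in> C"
  by (rule smooth_functionsI) (intro smooth_on_mult chart_image_open smooth_functions_chart)

lemma smooth_scale [intro]: "f \<in> C \<Longrightarrow> (\<lambda>q. c * f q) \<in> C"
  using smooth_mult[OF smooth_const] by simp

lemma smooth_diff [intro]: "f \<in> C \<Longrightarrow> g \<in> C \<Longrightarrow> (\<lambda>q. f q - g q) \<in> C"
  using smooth_add[OF _ smooth_scale[of g "-1"]] by simp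

lemma smooth_sum [intro]: "(\<And>i. i \<in> I \<Longrightarrow> f i \<in> C) \<Longrightarrow> (\<lambda>q. \<Sum>i\<in>I. f i q) \<in> C"
  by (induction I rule: infinite_finite_induct) auto

lemma smooth_prod [intro]: "(\<And>i. i \<in> I \<Longrightarrow> f i \<in> C) \<Longrightarrow> (\<lambda>q. \<Prod>i\<in>I. f i q) \<in> C"
  by (induction I rule: infinite_finite_induct) auto

lemma smooth_det:
  "(\<And>i j. (\<lambda>q. M q $ i $ j) \<in> C) \<Longrightarrow> (\<lambda>q. det (M q :: real ^ 'n ^ 'n)) \<in> C"
  unfolding det_def by (intro smooth_sum smooth_mult smooth_const smooth_prod)

text \<open>The form in which Cramer's rule delivers coefficients: near p the function
  \<open>a\<close> is h / d. The denominator may vanish elsewhere, so d and h are chosen for each p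
  and smoothness is collected locally.\<close>

lemma smooth_quotient:
  assumes "\<And>p. \<exists>d\<in>C. \<exists>h\<in>C. d p \<noteq> 0 \<and> (\<forall>q. d q * a q = h q)"
  shows "a \<in> C"
proof (rule smooth_functionsI)
  fix U \<phi> assume c: "(U, \<phi>) \<in> A"
  let ?i = "inv_into U \<phi>"
  show "smooth_on (\<phi> ` U) (\<lambda>x. a (?i x))"
  proof (rule smooth_on_local)
    fix x assume x: "x \<in> \<phi> ` U"
    obtain d h where dh: "d \<in> C" "h \<in> C" "d (?i x) \<noteq> 0" "\<And>q. d q * a q = h q"
      using assms by blast
    let ?W = "\<phi> ` U \<inter> (\<lambda>x. d (?i x)) -` (- {0})"
    have W: "open ?W"
      by (intro continuous_open_preimage chart_image_open c smooth_on_continuous smooth_functions_chart dh) auto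
    have "smooth_on ?W (\<lambda>x. h (?i x) * inverse (d (?i x)))"
      by (intro smooth_on_mult smooth_on_inverse W smooth_on_subset[OF smooth_functions_chart[OF dh(1) c]]
          smooth_on_subset[OF smooth_functions_chart[OF dh(2) c]]) auto
    moreover have "h (?i x) * inverse (d (?i x)) = a (?i x)" if "x \<in> ?W" for x
      using that dh(4)[of "?i x", symmetric] by simp
    ultimately have "smooth_on ?W (\<lambda>x. a (?i x))"
      using smooth_on_cong[OF W, of "\<lambda>x. h (?i x) * inverse (d (?i x))" "\<lambda>x. a (?i x)"] by simp
    then show "\<exists>W. open W \<and> x \<in> W \<and> smooth_on W (\<lambda>x. a (?i x))"
      using W x dh(3) by blast
  qed
qed

text \<open>The Hausdorff property enters here: it makes the compact support closed in the manifold.\<close>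

lemma smooth_extend_chart:
  assumes c: "(U, \<phi>) \<in> A" and F: "smooth_on (\<phi> ` U) F"
    and K: "compact K" "K \<subseteq> \<phi> ` U" "\<And>x. x \<in> \<phi> ` U \<Longrightarrow> x \<notin> K \<Longrightarrow> F x = 0"
  shows "(\<lambda>q. if q \<in> U then F (\<phi> q) else 0) \<in> C"
    (is "?f \<in> C")
proof (rule smooth_functionsI)
  fix V \<xi> assume d: "(V, \<xi>) \<in> A"
  let ?i = "inv_into V \<xi>"
  let ?K = "inv_into U \<phi> ` K"
  have clK: "closed ?K"
    using compact_continuous_image[OF continuous_on_subset[OF chart_inv_continuous[OF c] K(2)] K(1)]
    by (rule compact_imp_closed)
  have op: "open (\<xi> ` V \<inter> ?i -` W)" if "open W" for W
    using chart_inv_continuous[OF d] chart_image_open[OF d] that by (rule continuous_open_preimage)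
  show "smooth_on (\<xi> ` V) (\<lambda>x. ?f (?i x))"
  proof (rule smooth_on_local)
    fix x assume x: "x \<in> \<xi> ` V"
    show "\<exists>W. open W \<and> x \<in> W \<and> smooth_on W (\<lambda>x. ?f (?i x))"
    proof (cases "?i x \<in> U")
      case True
      let ?W = "\<xi> ` V \<inter> ?i -` U"
      have "smooth_on (\<xi> ` (V \<inter> U)) (\<lambda>x. \<phi> (?i x))"
        using smooth_manifold c d by (auto simp: smooth_manifold_def smoothly_compatible_def o_def)
      moreover have "?W \<subseteq> \<xi> ` (V \<inter> U)"
      proof
        fix z assume z: "z \<in> ?W"
        show "z \<in> \<xi> ` (V \<inter> U)"
          by (rule image_eqI[of _ _ "?i z"]) (use z chart_inv_right[OF d, of z] chart_inv_mem[OF d, of z] in auto)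
      qed
      ultimately have s: "smooth_on ?W (\<lambda>x. \<phi> (?i x))" by (rule smooth_on_subset)
      have "smooth_on ?W (\<lambda>x. F (\<phi> (?i x)))"
        by (rule smooth_on_compose[OF op[OF chart_open[OF c]] chart_image_open[OF c] _ s F]) auto
      then have "smooth_on ?W (\<lambda>x. ?f (?i x))"
        by (subst smooth_on_cong[OF op[OF chart_open[OF c]], of _ "\<lambda>x. F (\<phi> (?i x))"]) auto
      then show ?thesis using x True op[OF chart_open[OF c]] by blast
    next
      case False
      let ?W = "\<xi> ` V \<inter> ?i -` (- ?K)"
      have W: "open ?W" using op clK by blast
      have "?f (?i y) = 0" if y: "y \<in> ?W" for y
      proof (cases "?i y \<in> U")
        case True
        have "\<phi> (?i y) \<notin> K"
          using y chart_inv[OF c True] by (auto simp: image_iff)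
        then show ?thesis using True K(3) by auto
      qed simp
      then have "smooth_on ?W (\<lambda>x. ?f (?i x))"
        by (subst smooth_on_cong[OF W, of _ "\<lambda>_. 0"]) (auto intro: smooth_on_const[OF W])
      moreover have "x \<in> ?W"
      proof -
        have "?i x \<notin> ?K"
        proof
          assume "?i x \<in> ?K"
          then obtain z where "z \<in> K" "?i x = inv_into U \<phi> z" by blast
          then show False using False K(2) chart_inv_mem[OF c, of z] by auto
        qed
        then show ?thesis using x by simp
      qed
      ultimately show ?thesis using W by blast
    qed
  qed
qed

section \<open>Tangent vectors and vector fields as derivations\<close>

lemma
  assumes "v \<in> T p"
  shows tangent_add: "f \<in> C \<Longrightarrow> g \<in> C \<Longrightarrow> v (\<lambda>q. f q + g q) = v f + v g"
    and tangent_scale: "f \<in> C \<Longrightarrow> v (\<lambda>q. c * f q) = c * v f"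
    and tangent_mult: "f \<in> C \<Longrightarrow> g \<in> C \<Longrightarrow> v (\<lambda>q. f q * g q) = f p * v g + v f * g p"
    and tangent_off: "f \<notin> C \<Longrightarrow> v f = 0"
  using assms by (auto simp: tangent_space_def plus_fun_def times_fun_def)

lemma tangent_zero: "v \<in> T p \<Longrightarrow> v (\<lambda>_. 0) = 0"
  using tangent_scale[of v p "\<lambda>_. 0" 0] by simp

lemma tangent_const: assumes "v \<in> T p" shows "v (\<lambda>_. c) = 0"
proof -
  have "v (\<lambda>_. 1) = 0" using tangent_mult[OF assms, of "\<lambda>_. 1" "\<lambda>_. 1"] by simp
  then show ?thesis using tangent_scale[OF assms, of "\<lambda>_. 1" c] by simp
qed

lemma tangent_sum:
  assumes v: "v \<in> T p"
  shows "(\<And>i. i \<in> I \<Longrightarrow> f i \<in> C) \<Longrightarrow> v (\<lambda>q. \<Sum>i\<in>I. f i q) = (\<Sum>i\<in>I. v (f i))"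
proof (induction I rule: infinite_finite_induct)
  case (insert x F)
  then show ?case using tangent_add[OF v, of "f x" "\<lambda>q. \<Sum>i\<in>F. f i q"] by (simp add: smooth_sum)
qed (use tangent_zero[OF v] in auto)

lemma tangent_spaceI:
  assumes "\<And>f g. f \<in> C \<Longrightarrow> g \<in> C \<Longrightarrow> v (\<lambda>q. f q + g q) = v f + v g"
    and "\<And>f c. f \<in> C \<Longrightarrow> v (\<lambda>q. c * f q) = c * v f"
    and "\<And>f g. f \<in> C \<Longrightarrow> g \<in> C \<Longrightarrow> v (\<lambda>q. f q * g q) = f p * v g + v f * g p"
    and "\<And>f. f \<notin> C \<Longrightarrow> v f = 0"
  shows "v \<in> T p"
  using assms by (auto simp: tangent_space_def plus_fun_def times_fun_def)

lemma tangent_space_zero [intro, simp]: "(\<lambda>_. 0) \<in> T p"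
  by (rule tangent_spaceI) auto

lemma tangent_space_plus [intro]: "v \<in> T p \<Longrightarrow> w \<in> T p \<Longrightarrow> (\<lambda>f. v f + w f) \<in> T p"
  by (rule tangent_spaceI)
    (auto simp: tangent_add tangent_scale tangent_mult tangent_off algebra_simps)

lemma tangent_space_scale [intro]: "v \<in> T p \<Longrightarrow> (\<lambda>f. c * v f) \<in> T p"
  by (rule tangent_spaceI)
    (auto simp: tangent_add tangent_scale tangent_mult tangent_off algebra_simps)

lemma tangent_space_sum [intro]: "(\<And>i. i \<in> I \<Longrightarrow> v i \<in> T p) \<Longrightarrow> (\<lambda>f. \<Sum>i\<in>I. v i f) \<in> T p"
  by (induction I rule: infinite_finite_induct) auto

lemma
  shows VF_tangent [simp, intro]: "V \<in> VF \<Longrightarrow> V p \<in> T p"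
    and VF_smooth [intro]: "V \<in> VF \<Longrightarrow> f \<in> C \<Longrightarrow> (\<lambda>p. V p f) \<in> C"
  by (auto simp: vector_fields_def)

text \<open>With \<open>x\<^sub>0 = \<phi> p\<close> and a bump function \<open>b\<close> at \<open>x\<^sub>0\<close>, Hadamard's lemma gives
  \<open>b\<^sup>2 f = f(p) b\<^sup>2 + (\<Sum>i. y\<^sub>i e\<^sub>i)\<close> for every \<open>f\<close>, where \<open>y\<^sub>i = b (x\<^sub>i - x\<^sub>0\<^sub>i)\<close> vanishes at \<open>p\<close>.\<close>

lemma tangent_determined:
  "\<exists>y :: 'm \<Rightarrow> 'a \<Rightarrow> real. (\<forall>i. y i \<in> C) \<and> (\<forall>v\<in>T p. (\<forall>i. v (y i) = 0) \<longrightarrow> (\<forall>f. v f = 0))"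
proof -
  obtain U \<phi> where c: "(U, \<phi>) \<in> A" and p: "p \<in> U" by (rule chart_at)
  define x0 where "x0 = \<phi> p"
  have "x0 \<in> \<phi> ` U" using p by (simp add: x0_def)
  then obtain R where R: "R > 0" "ball x0 R \<subseteq> \<phi> ` U"
    using chart_image_open[OF c] by (auto simp: open_contains_ball)
  \<comment> \<open>With half the radius, the bump vanishes outside the compact ball
    \<open>cball x0 (R/2)\<close>, which lies in the image of the chart, while Hadamard's expansion
    holds on the larger ball of radius R.\<close>
  obtain b :: "real ^ 'm \<Rightarrow> real" where b: "smooth_on UNIV b" "b x0 = 1" "\<And>x. x \<notin> ball x0 (R/2) \<Longrightarrow> b x = 0"
    using exists_smooth_bump[of "R/2" x0] R(1) by auto
  have bU: "smooth_on (\<phi> ` U) b" using b(1) by (rule smooth_on_subset) simp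
  define E where "E G = (\<lambda>q. if q \<in> U then b (\<phi> q) * G (\<phi> q) else 0)" for G :: "real ^ 'm \<Rightarrow> real"
  have E: "E G \<in> C" if "smooth_on (\<phi> ` U) (\<lambda>x. b x * G x)" for G
    unfolding E_def
  proof (rule smooth_extend_chart[OF c that])
    show "cball x0 (R/2) \<subseteq> \<phi> ` U" using R by (auto simp: subset_iff)
    show "b x * G x = 0" if "x \<notin> cball x0 (R/2)" for x using that b(3)[of x] by auto
  qed simp
  note op = chart_image_open[OF c]
  define y where "y i = E (\<lambda>x. x $ i - x0 $ i)" for i
  have y: "y i \<in> C" for i
    unfolding y_def
    by (intro E smooth_on_mult[OF op bU] smooth_on_diff[OF op] smooth_on_const[OF op]
        smooth_on_bounded_linear[OF bounded_linear_vec_nth op] smooth_on_id[OF op])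
  have yp: "y i p = 0" for i by (simp add: y_def E_def x0_def)
  define \<beta> where "\<beta> = E (\<lambda>_. 1)"
  have \<beta>: "\<beta> \<in> C" "\<beta> p = 1"
    unfolding \<beta>_def by (rule E) (use bU p b(2) in \<open>auto simp: E_def x0_def\<close>)
  have "v f = 0" if v: "v \<in> T p" and v0: "\<And>i. v (y i) = 0" for v f
  proof (cases "f \<in> C")
    case f: True
    have F: "smooth_on (\<phi> ` U) (\<lambda>x. f (inv_into U \<phi> x))" by (rule smooth_functions_chart[OF f c])
    obtain g where g: "\<And>i. smooth_on (ball x0 R) (g i)"
      "\<And>x. x \<in> ball x0 R \<Longrightarrow> f (inv_into U \<phi> x) = f (inv_into U \<phi> x0) + (\<Sum>i\<in>UNIV. (x $ i - x0 $ i) * g i x)"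
      using hadamard[OF smooth_on_subset[OF F R(2)]] by metis
    define e where "e i = E (g i)" for i
    \<comment> \<open>Hadamard's lemma controls \<open>g i\<close> on the ball of radius R alone.
      The product with b is smooth there, and it is zero on the complement of the smaller closed
      ball; these two open sets cover everything.\<close>
    have e: "e i \<in> C" for i
      unfolding e_def
    proof (rule E, rule smooth_on_local)
      fix x assume "x \<in> \<phi> ` U"
      show "\<exists>W. open W \<and> x \<in> W \<and> smooth_on W (\<lambda>x. b x * g i x)"
      proof (cases "x \<in> ball x0 R")
        case True
        have "smooth_on (ball x0 R) (\<lambda>x. b x * g i x)"
          by (intro smooth_on_mult g open_ball smooth_on_subset[OF b(1)]) simp
        then show ?thesis using True by blast
      next
        case False
        have W: "open (- cball x0 (R/2))" by (rule open_Compl[OF closed_cball])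
        have "smooth_on (- cball x0 (R/2)) (\<lambda>x. b x * g i x)"
          by (subst smooth_on_cong[OF W, of _ "\<lambda>_. 0"]) (use b(3) in \<open>auto intro: smooth_on_const[OF W]\<close>)
        moreover have "x \<in> - cball x0 (R/2)" using False R(1) by auto
        ultimately show ?thesis using W by blast
      qed
    qed
    have "(\<lambda>q. (\<beta> q * \<beta> q) * f q) = (\<lambda>q. f p * (\<beta> q * \<beta> q) + (\<Sum>i\<in>UNIV. y i q * e i q))"
    proof
      fix q
      show "(\<beta> q * \<beta> q) * f q = f p * (\<beta> q * \<beta> q) + (\<Sum>i\<in>UNIV. y i q * e i q)"
      proof (cases "q \<in> U \<and> \<phi> q \<in> ball x0 R")
        case True
        have "f q = f p + (\<Sum>i\<in>UNIV. (\<phi> q $ i - x0 $ i) * g i (\<phi> q))"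
          using g(2)[of "\<phi> q"] True chart_inv[OF c] p by (simp add: x0_def)
        then show ?thesis
          using True by (simp add: \<beta>_def y_def e_def E_def sum_distrib_left algebra_simps)
      next
        case False
        then have "\<beta> q = 0" "\<And>i. y i q = 0"
          using b(3)[of "\<phi> q"] R(1) by (auto simp: \<beta>_def y_def E_def)
        then show ?thesis by simp
      qed
    qed
    \<comment> \<open>Since \<beta> is 1 at p, the left side is \<open>v f\<close> plus
      \<open>f p\<close> times the value of v on the square of \<beta>. The right side has the same
      second term, and its remaining terms vanish because both \<open>y i p\<close> and
      \<open>v (y i)\<close> are 0. Hence \<open>v f = 0\<close>.\<close>
    then have "v (\<lambda>q. (\<beta> q * \<beta> q) * f q) = v (\<lambda>q. f p * (\<beta> q * \<beta> q) + (\<Sum>i\<in>UNIV. y i q * e i q))"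
      by simp
    moreover have "v (\<lambda>q. (\<beta> q * \<beta> q) * f q) = v f + v (\<lambda>q. \<beta> q * \<beta> q) * f p"
      using tangent_mult[OF v smooth_mult[OF \<beta>(1) \<beta>(1)] f] \<beta>(2) by simp
    moreover have "v (\<lambda>q. f p * (\<beta> q * \<beta> q) + (\<Sum>i\<in>UNIV. y i q * e i q))
        = f p * v (\<lambda>q. \<beta> q * \<beta> q) + (\<Sum>i\<in>UNIV. v (\<lambda>q. y i q * e i q))"
      by (simp add: tangent_add[OF v] tangent_scale[OF v] tangent_sum[OF v] smooth_sum smooth_mult smooth_scale \<beta> y e)
    moreover have "v (\<lambda>q. y i q * e i q) = 0" for i
      using tangent_mult[OF v y e] yp v0 by simp
    ultimately show ?thesis by simp
  qed (use v tangent_off in auto)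
  then show ?thesis using y by blast
qed

end

section \<open>The frame spans with smooth coefficients\<close>

locale framed_mfd =
  fixes A :: "('a::{t2_space,second_countable_topology}, 'm::finite) chart set"
    and X :: "'m \<Rightarrow> 'a vector_field"
  assumes parallelizable: "parallelizable_manifold A X"
begin

sublocale smooth_mfd A
  using parallelizable by unfold_locales (simp add: parallelizable_manifold_def)

lemma frame_VF [simp, intro]: "X j \<in> VF"
  using parallelizable by (simp add: parallelizable_manifold_def)

lemma frame_independent: "(\<And>f. (\<Sum>j\<in>UNIV. c j * X j p f) = 0) \<Longrightarrow> c j = 0"
  using parallelizable unfolding parallelizable_manifold_def by blast

text \<open>A vector c in the kernel gives a combination of the frame that kills all
  \<open>y i\<close>, hence is the zero derivation, so c = 0 by independence of the frame. The
  matrix is square because the frame has as many members as there are coordinates.\<close>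

lemma frame_matrix:
  "\<exists>y. (\<forall>i. y i \<in> C) \<and> det ((\<chi> i j. X j p (y i)) :: real ^ 'm ^ 'm) \<noteq> 0 \<and>
    (\<forall>v\<in>T p. (\<forall>i. v (y i) = 0) \<longrightarrow> (\<forall>f. v f = 0))"
proof -
  obtain y :: "'m \<Rightarrow> 'a \<Rightarrow> real" where y': "\<forall>i. y i \<in> C"
    and det': "\<forall>v\<in>T p. (\<forall>i. v (y i) = 0) \<longrightarrow> (\<forall>f. v f = 0)"
    using tangent_determined[of p] by (elim exE conjE)
  note y = y'[rule_format] and det = det'[rule_format]
  let ?B = "(\<chi> i j. X j p (y i)) :: real ^ 'm ^ 'm"
  have "c = 0" if c: "?B *v c = 0" for c
  proof -
    have "(\<Sum>j\<in>UNIV. c $ j * X j p f) = 0" for f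
    proof (rule det[of "\<lambda>f. \<Sum>j\<in>UNIV. c $ j * X j p f"])
      show "(\<lambda>f. \<Sum>j\<in>UNIV. c $ j * X j p f) \<in> T p"
        by (intro tangent_space_sum tangent_space_scale VF_tangent frame_VF)
      show "(\<Sum>j\<in>UNIV. c $ j * X j p (y i)) = 0" for i
        using c by (simp add: vec_eq_iff matrix_vector_mult_def mult.commute)
    qed
    then have "c $ j = 0" for j by (rule frame_independent)
    then show ?thesis by (simp add: vec_eq_iff)
  qed
  then have "invertible ?B"
    by (metis invertible_left_inverse matrix_left_invertible_ker)
  then have "det ?B \<noteq> 0" by (simp add: invertible_det_nz)
  then show ?thesis using y' det' by (intro exI[of _ y] conjI)
qed

text \<open>Solve the linear system that makes the combination agree with v on the functions
  \<open>y i\<close>; the difference then kills all \<open>y i\<close> and is therefore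
  zero.\<close>

lemma tangent_spanned:
  assumes v: "v \<in> T p"
  shows "\<exists>c. \<forall>f. v f = (\<Sum>j\<in>UNIV. c j * X j p f)"
proof -
  obtain y where y': "\<forall>i. y i \<in> C" and nz: "det ((\<chi> i j. X j p (y i)) :: real ^ 'm ^ 'm) \<noteq> 0"
    and det': "\<forall>v\<in>T p. (\<forall>i. v (y i) = 0) \<longrightarrow> (\<forall>f. v f = 0)"
    using frame_matrix[of p] by (elim exE conjE)
  note y = y'[rule_format] and det = det'[rule_format]
  let ?B = "(\<chi> i j. X j p (y i)) :: real ^ 'm ^ 'm"
  have "invertible ?B" using nz invertible_det_nz by blast
  then obtain B' where "?B ** B' = mat 1" by (auto simp: invertible_def)
  then have c: "?B *v (B' *v (\<chi> i. v (y i))) = (\<chi> i. v (y i))"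
    by (simp add: matrix_vector_mul_assoc)
  define c where "c = B' *v (\<chi> i. v (y i))"
  have "v f + (-1) * (\<Sum>j\<in>UNIV. c $ j * X j p f) = 0" for f
  proof (rule det[of "\<lambda>f. v f + (-1) * (\<Sum>j\<in>UNIV. c $ j * X j p f)"])
    show "(\<lambda>f. v f + (-1) * (\<Sum>j\<in>UNIV. c $ j * X j p f)) \<in> T p"
      using v by (intro tangent_space_plus tangent_space_scale tangent_space_sum) auto
    show "v (y i) + (-1) * (\<Sum>j\<in>UNIV. c $ j * X j p (y i)) = 0" for i
      using c[folded c_def] by (simp add: vec_eq_iff matrix_vector_mult_def mult.commute)
  qed
  then have "\<forall>f. v f = (\<Sum>j\<in>UNIV. c $ j * X j p f)" by simp
  then show ?thesis by blast
qed

definition coeff :: "'a \<Rightarrow> 'a tangent \<Rightarrow> 'm \<Rightarrow> real" where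
  "coeff p v = (SOME c. \<forall>f. v f = (\<Sum>j\<in>UNIV. c j * X j p f))"

lemma coeff_expand: "v \<in> T p \<Longrightarrow> v f = (\<Sum>j\<in>UNIV. coeff p v j * X j p f)"
  using someI_ex[OF tangent_spanned] unfolding coeff_def by blast

lemma coeff_unique:
  assumes "\<And>f. v f = (\<Sum>j\<in>UNIV. c j * X j p f)"
  shows "coeff p v = c"
proof -
  have "\<forall>f. v f = (\<Sum>j\<in>UNIV. coeff p v j * X j p f)"
    unfolding coeff_def by (rule someI[of "\<lambda>c. \<forall>f. v f = (\<Sum>j\<in>UNIV. c j * X j p f)" c]) (use assms in blast)
  then have "(\<Sum>j\<in>UNIV. (coeff p v j - c j) * X j p f) = 0" for f
    using assms[of f] by (simp add: left_diff_distrib sum_subtractf)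
  then have "coeff p v j - c j = 0" for j by (rule frame_independent)
  then show ?thesis by auto
qed

lemma coeff_add: "v \<in> T p \<Longrightarrow> w \<in> T p \<Longrightarrow> coeff p (\<lambda>f. v f + w f) j = coeff p v j + coeff p w j"
  by (subst coeff_unique[where c="\<lambda>j. coeff p v j + coeff p w j"])
    (auto simp: coeff_expand[of v] coeff_expand[of w] sum.distrib[symmetric] distrib_right
      simp del: sum.distrib)

lemma coeff_scale: "v \<in> T p \<Longrightarrow> coeff p (\<lambda>f. c * v f) j = c * coeff p v j"
  by (subst coeff_unique[where c="\<lambda>j. c * coeff p v j"])
    (auto simp: coeff_expand[of v] sum_distrib_left mult.assoc)

lemma coeff_zero [simp]: "coeff p (\<lambda>_. 0) j = 0"
  by (subst coeff_unique[where c="\<lambda>_. 0"]) auto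

lemma coeff_frame: "coeff p (X i p) j = (if i = j then 1 else 0)"
  by (subst coeff_unique[where c="\<lambda>j. if i = j then 1 else 0"])
    (auto simp: if_distrib[where f="\<lambda>x. x * _"] sum.delta cong: if_cong)

text \<open>The functions \<open>y i\<close> are adapted to p, but the linear system for the
  coefficients of \<open>V q\<close> holds at every point q. Cramer's rule in multiplied-out form is
  thus a global identity between smooth functions whose determinant factor is nonzero at p.\<close>

lemma coeff_smooth:
  assumes V: "V \<in> VF"
  shows "(\<lambda>p. coeff p (V p) k) \<in> C"
proof (rule smooth_quotient)
  fix p
  obtain y where y': "\<forall>i. y i \<in> C" and nz: "det ((\<chi> i j. X j p (y i)) :: real ^ 'm ^ 'm) \<noteq> 0"
    using frame_matrix[of p] by (elim exE conjE)
  note y = y'[rule_format]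
  let ?B = "\<lambda>q. (\<chi> i j. X j q (y i)) :: real ^ 'm ^ 'm"
  let ?H = "\<lambda>q. (\<chi> i j. if j = k then V q (y i) else X j q (y i)) :: real ^ 'm ^ 'm"
  have "det (?B q) * coeff q (V q) k = det (?H q)" for q
  proof -
    let ?c = "(\<chi> j. coeff q (V q) j) :: real ^ 'm"
    have "(?B q *v ?c) $ i = V q (y i)" for i
      using coeff_expand[of "V q" q "y i"] V by (simp add: matrix_vector_mult_def mult.commute)
    then show ?thesis
      using cramer_lemma[of k "?B q" ?c] by (simp add: mult.commute cong: if_cong)
  qed
  moreover have "(\<lambda>q. det (?B q)) \<in> C"
    by (rule smooth_det) (use y in \<open>auto intro: VF_smooth\<close>)
  moreover have "(\<lambda>q. det (?H q)) \<in> C"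
    by (rule smooth_det, case_tac "j = k") (use y V in \<open>auto intro: VF_smooth\<close>)
  ultimately show "\<exists>d\<in>C. \<exists>h\<in>C. d p \<noteq> 0 \<and> (\<forall>q. d q * coeff q (V q) k = h q)"
    using nz by (intro bexI[of _ "\<lambda>q. det (?B q)"] bexI[of _ "\<lambda>q. det (?H q)"]) auto
qed

end


section \<open>The shuffle product\<close>

text \<open>The formula of \<open>wedge\<close> at a single point, for arbitrary functions on lists.
  At this generality the inductions below can pass freely from a function to its hooks.\<close>

definition shuffle_prod :: "('t list \<Rightarrow> real) \<Rightarrow> ('t list \<Rightarrow> real) \<Rightarrow> 't list \<Rightarrow> real" where
  "shuffle_prod a b vs = (\<Sum>S\<in>Pow {..<length vs}.
     (-1) ^ card {(i, j). i \<in> S \<and> j \<in> {..<length vs} - S \<and> j < i} *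
     a (nths vs S) * b (nths vs (- S)))"

definition hook :: "'t \<Rightarrow> ('t list \<Rightarrow> real) \<Rightarrow> 't list \<Rightarrow> real" where
  "hook v a = (\<lambda>vs. a (v # vs))"

text \<open>The grading automorphism. It is the sign that arises when an odd operation passes a
  factor of arbitrary, possibly mixed, degree.\<close>

definition invol :: "('t list \<Rightarrow> real) \<Rightarrow> 't list \<Rightarrow> real" where
  "invol a = (\<lambda>vs. (-1) ^ length vs * a vs)"

definition scalar :: "real \<Rightarrow> 't list \<Rightarrow> real" where
  "scalar c = (\<lambda>vs. if vs = [] then c else 0)"

definition has_parity :: "nat \<Rightarrow> ('t list \<Rightarrow> real) \<Rightarrow> bool" where
  "has_parity k a \<longleftrightarrow> (\<forall>vs. odd (length vs + k) \<longrightarrow> a vs = 0)"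

lemma wedge_eq: "wedge \<alpha> \<beta> p = shuffle_prod (\<alpha> p) (\<beta> p)"
  by (simp add: wedge_def shuffle_prod_def fun_eq_iff)

lemma shuffle_prod_Nil [simp]: "shuffle_prod a b [] = a [] * b []"
  by (simp add: shuffle_prod_def)

lemma shuffle_prod_add_left: "shuffle_prod (\<lambda>vs. a vs + a' vs) b vs = shuffle_prod a b vs + shuffle_prod a' b vs"
  by (simp add: shuffle_prod_def sum.distrib algebra_simps)

lemma shuffle_prod_add_right: "shuffle_prod a (\<lambda>vs. b vs + b' vs) vs = shuffle_prod a b vs + shuffle_prod a b' vs"
  by (simp add: shuffle_prod_def sum.distrib algebra_simps)

lemma shuffle_prod_scale_left: "shuffle_prod (\<lambda>vs. c * a vs) b vs = c * shuffle_prod a b vs"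
  by (simp add: shuffle_prod_def sum_distrib_left algebra_simps)

lemma shuffle_prod_scale_right: "shuffle_prod a (\<lambda>vs. c * b vs) vs = c * shuffle_prod a b vs"
  by (simp add: shuffle_prod_def sum_distrib_left algebra_simps)

lemma shuffle_prod_minus_left: "shuffle_prod (\<lambda>vs. - a vs) b vs = - shuffle_prod a b vs"
  using shuffle_prod_scale_left[of "-1"] by simp

lemma shuffle_prod_minus_right: "shuffle_prod a (\<lambda>vs. - b vs) vs = - shuffle_prod a b vs"
  using shuffle_prod_scale_right[of a "-1"] by simp

lemma shuffle_prod_zero_left [simp]: "shuffle_prod (\<lambda>_. 0) b vs = 0"
  by (simp add: shuffle_prod_def)

lemma shuffle_prod_zero_right [simp]: "shuffle_prod a (\<lambda>_. 0) vs = 0"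
  by (simp add: shuffle_prod_def)

lemmas shuffle_prod_linear = shuffle_prod_add_left shuffle_prod_add_right shuffle_prod_scale_left
  shuffle_prod_scale_right shuffle_prod_minus_left shuffle_prod_minus_right

text \<open>Position 0 goes to the first factor and has no position below it, so it takes part in no
  inversion.\<close>

lemma inversions_insert_0:
  "card {(i, j). i \<in> insert 0 (Suc ` S) \<and> j \<in> {..<Suc n} - insert 0 (Suc ` S) \<and> j < i}
     = card {(i, j). i \<in> S \<and> j \<in> {..<n} - S \<and> j < i}"
proof -
  have "{(i, j). i \<in> insert 0 (Suc ` S) \<and> j \<in> {..<Suc n} - insert 0 (Suc ` S) \<and> j < i}
      = map_prod Suc Suc ` {(i, j). i \<in> S \<and> j \<in> {..<n} - S \<and> j < i}" (is "?L = ?R")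
  proof
    show "?L \<subseteq> ?R"
    proof
      fix x assume x: "x \<in> ?L"
      then obtain i j where ij: "x = (i, j)" "i \<in> insert 0 (Suc ` S)" "j < Suc n" "j \<notin> insert 0 (Suc ` S)" "j < i"
        by auto
      then obtain i' j' where "i = Suc i'" "j = Suc j'" by (metis insertI1 not0_implies_Suc not_less_zero)
      with ij show "x \<in> ?R" by (auto intro!: image_eqI[of _ _ "(i', j')"])
    qed
  qed auto
  then show ?thesis by (simp add: card_image inj_on_def)
qed

text \<open>Position 0 goes to the second factor and forms an inversion with each position fed to
  the first one. The resulting sign is what \<open>invol\<close> supplies in the recursion.\<close>

lemma inversions_Suc:
  assumes "S \<subseteq> {..<n}"
  shows "card {(i, j). i \<in> Suc ` S \<and> j \<in> {..<Suc n} - Suc ` S \<and> j < i}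
     = card S + card {(i, j). i \<in> S \<and> j \<in> {..<n} - S \<and> j < i}"
proof -
  let ?I = "{(i, j). i \<in> S \<and> j \<in> {..<n} - S \<and> j < i}"
  have fin: "finite S" using assms finite_subset by blast
  have finI: "finite ?I" by (rule finite_subset[of _ "{..<n} \<times> {..<n}"]) (use assms in auto)
  have "{(i, j). i \<in> Suc ` S \<and> j \<in> {..<Suc n} - Suc ` S \<and> j < i}
      = (\<lambda>i. (Suc i, 0)) ` S \<union> map_prod Suc Suc ` ?I" (is "?L = ?R")
  proof
    show "?L \<subseteq> ?R"
    proof
      fix x assume "x \<in> ?L"
      then obtain i j where ij: "x = (Suc i, j)" "i \<in> S" "j < Suc n" "j \<notin> Suc ` S" "j < Suc i"
        by auto
      show "x \<in> ?R"
      proof (cases j)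
        case (Suc j')
        with ij show ?thesis by (auto intro!: image_eqI[of _ _ "(i, j')"])
      qed (use ij in auto)
    qed
  qed auto
  moreover have "card ((\<lambda>i. (Suc i, 0)) ` S \<union> map_prod Suc Suc ` ?I)
      = card ((\<lambda>i. (Suc i, 0::nat)) ` S) + card (map_prod Suc Suc ` ?I)"
    by (rule card_Un_disjoint) (use fin finI in auto)
  ultimately show ?thesis by (simp add: card_image inj_on_def)
qed

text \<open>Inserting a vector is an antiderivation. All further properties of the shuffle product follow
  from this recursion by induction on the list of vectors.\<close>

lemma shuffle_prod_Cons:
  "shuffle_prod a b (v # vs) = shuffle_prod (hook v a) b vs + shuffle_prod (invol a) (hook v b) vs"
proof -
  let ?n = "length vs"
  let ?inv = "\<lambda>n S. card {(i, j). i \<in> S \<and> j \<in> {..<n} - S \<and> j < i}"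
  let ?t = "\<lambda>S. (-1) ^ ?inv (Suc ?n) S * a (nths (v # vs) S) * b (nths (v # vs) (- S))"
  \<comment> \<open>The position sets are split by whether they contain 0, that is, by whether v is
    fed to b or to a.\<close>
  have P: "Pow {..<Suc ?n} = image Suc ` Pow {..<?n} \<union> (insert 0 \<circ> image Suc) ` Pow {..<?n}"
    unfolding lessThan_Suc_eq_insert_0 Pow_insert image_comp[symmetric]
    using image_Pow_surj[of Suc "{..<?n}" "Suc ` {..<?n}"] by auto
  have inj: "inj_on (image Suc) (Pow {..<?n})" by (auto simp: inj_on_def)
  have inj0: "inj_on (insert 0 \<circ> image Suc) (Pow {..<?n})"
    by (rule inj_onI) (metis comp_apply image_iff inj_image_eq_iff inj_Suc insert_ident nat.distinct(1))
  have "shuffle_prod a b (v # vs) = (\<Sum>S\<in>Pow {..<Suc ?n}. ?t S)"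
    by (simp add: shuffle_prod_def)
  also have "\<dots> = (\<Sum>S\<in>image Suc ` Pow {..<?n}. ?t S) + (\<Sum>S\<in>(insert 0 \<circ> image Suc) ` Pow {..<?n}. ?t S)"
    unfolding P by (rule sum.union_disjoint) auto
  also have "(\<Sum>S\<in>image Suc ` Pow {..<?n}. ?t S) = (\<Sum>S\<in>Pow {..<?n}. ?t (Suc ` S))"
    by (simp add: sum.reindex[OF inj])
  also have "\<dots> = shuffle_prod (invol a) (hook v b) vs"
    unfolding shuffle_prod_def
  proof (rule sum.cong[OF refl])
    fix S assume S: "S \<in> Pow {..<?n}"
    have 1: "{j. Suc j \<in> Suc ` S} = S" "{j. Suc j \<in> - (Suc ` S)} = - S" by auto
    have n: "nths (v # vs) (Suc ` S) = nths vs S" "nths (v # vs) (- (Suc ` S)) = v # nths vs (- S)"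
      unfolding nths_Cons 1 by auto
    have "{i. i < ?n \<and> i \<in> S} = S" using S by auto
    then have l: "length (nths vs S) = card S" by (simp add: length_nths)
    have i: "?inv (Suc ?n) (Suc ` S) = card S + ?inv ?n S" using S by (intro inversions_Suc) auto
    show "?t (Suc ` S) = (-1) ^ ?inv ?n S * invol a (nths vs S) * hook v b (nths vs (- S))"
      unfolding n i by (simp add: invol_def hook_def l power_add)
  qed
  also have "(\<Sum>S\<in>(insert 0 \<circ> image Suc) ` Pow {..<?n}. ?t S) = (\<Sum>S\<in>Pow {..<?n}. ?t (insert 0 (Suc ` S)))"
    unfolding sum.reindex[OF inj0] by (simp only: o_def)
  also have "\<dots> = shuffle_prod (hook v a) b vs"
    unfolding shuffle_prod_def
  proof (rule sum.cong[OF refl])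
    fix S assume S: "S \<in> Pow {..<?n}"
    have 1: "{j. Suc j \<in> insert 0 (Suc ` S)} = S" "{j. Suc j \<in> - insert 0 (Suc ` S)} = - S" by auto
    have n: "nths (v # vs) (insert 0 (Suc ` S)) = v # nths vs S"
      "nths (v # vs) (- insert 0 (Suc ` S)) = nths vs (- S)"
      unfolding nths_Cons 1 by auto
    show "?t (insert 0 (Suc ` S)) = (-1) ^ ?inv ?n S * hook v a (nths vs S) * b (nths vs (- S))"
      unfolding n inversions_insert_0 by (simp add: hook_def)
  qed
  finally show ?thesis by simp
qed

lemma hook_shuffle_prod:
  "hook v (shuffle_prod a b) = (\<lambda>vs. shuffle_prod (hook v a) b vs + shuffle_prod (invol a) (hook v b) vs)"
  by (rule ext) (simp only: hook_def[of v "shuffle_prod a b"] shuffle_prod_Cons)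

lemma hook_invol: "hook v (invol a) = (\<lambda>vs. - invol (hook v a) vs)"
  by (simp add: hook_def invol_def)

lemma invol_invol [simp]: "invol (invol a) = a"
  by (simp add: invol_def fun_eq_iff mult.assoc[symmetric] power_add[symmetric])

lemma invol_shuffle_prod: "invol (shuffle_prod a b) = shuffle_prod (invol a) (invol b)"
proof
  show "invol (shuffle_prod a b) vs = shuffle_prod (invol a) (invol b) vs" for vs
  proof (induction vs arbitrary: a b)
    case (Cons v vs)
    have "invol (shuffle_prod a b) (v # vs)
        = - (invol (shuffle_prod (hook v a) b) vs + invol (shuffle_prod (invol a) (hook v b)) vs)"
      by (simp add: invol_def[of "shuffle_prod _ _"] shuffle_prod_Cons algebra_simps)
    then show ?case
      by (simp add: Cons shuffle_prod_Cons hook_invol shuffle_prod_linear)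
  qed (simp add: invol_def)
qed

text \<open>Inserting a vector gives on both sides the three terms in which it is fed to a, b or c;
  multiplicativity of \<open>invol\<close> makes the signs agree.\<close>

lemma shuffle_prod_assoc: "shuffle_prod (shuffle_prod a b) c = shuffle_prod a (shuffle_prod b c)"
proof
  show "shuffle_prod (shuffle_prod a b) c vs = shuffle_prod a (shuffle_prod b c) vs" for vs
    by (induction vs arbitrary: a b c)
      (simp_all add: shuffle_prod_Cons hook_shuffle_prod invol_shuffle_prod shuffle_prod_linear)
qed

lemma invol_has_parity: "has_parity k a \<Longrightarrow> invol a = (\<lambda>vs. (-1) ^ k * a vs)"
proof
  fix vs assume a: "has_parity k a"
  show "invol a vs = (-1) ^ k * a vs"
  proof (cases "odd (length vs + k)")
    case True
    then show ?thesis using a by (simp add: has_parity_def invol_def)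
  next
    case False
    then show ?thesis by (auto simp: invol_def uminus_power_if)
  qed
qed

lemma has_parity_hook: "has_parity k a \<Longrightarrow> has_parity (Suc k) (hook v a)"
  by (simp add: has_parity_def hook_def)

lemma shuffle_prod_has_parity:
  "has_parity k a \<Longrightarrow> has_parity l b \<Longrightarrow> has_parity (k + l) (shuffle_prod a b)"
proof -
  have "shuffle_prod a b vs = 0"
    if "has_parity k a" "has_parity l b" "odd (length vs + (k + l))" for vs k l and a b :: "'a list \<Rightarrow> real"
    using that
  proof (induction vs arbitrary: a b k l)
    case Nil
    then show ?case by (auto simp: has_parity_def)
  next
    case (Cons v vs)
    have "shuffle_prod (hook v a) b vs = 0"
      by (rule Cons.IH[OF has_parity_hook[OF Cons.prems(1)] Cons.prems(2)]) (use Cons.prems(3) in simp)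
    moreover have "shuffle_prod a (hook v b) vs = 0"
      by (rule Cons.IH[OF Cons.prems(1) has_parity_hook[OF Cons.prems(2)]]) (use Cons.prems(3) in simp)
    ultimately show ?case
      by (simp add: shuffle_prod_Cons invol_has_parity[OF Cons.prems(1)] shuffle_prod_linear)
  qed
  then show "has_parity k a \<Longrightarrow> has_parity l b \<Longrightarrow> ?thesis" by (simp add: has_parity_def)
qed

text \<open>A hook raises the parity of one factor by one, so the induction hypothesis yields the
  exponents (k + 1) l and k (l + 1). The additional l and k are compensated by the signs in the two
  recursions. On the empty list both sides are 0 as soon as one parity is odd.\<close>

lemma shuffle_prod_commute:
  "has_parity k a \<Longrightarrow> has_parity l b \<Longrightarrow> shuffle_prod a b vs = (-1) ^ (k * l) * shuffle_prod b a vs"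
proof (induction vs arbitrary: a b k l)
  case Nil
  show ?case
  proof (cases "odd k \<or> odd l")
    case True
    then show ?thesis using Nil by (auto simp: has_parity_def)
  qed simp
next
  case (Cons v vs)
  have "shuffle_prod (hook v a) b vs = (-1) ^ (k * l + l) * shuffle_prod b (hook v a) vs"
    using Cons.IH[OF has_parity_hook[OF Cons.prems(1)] Cons.prems(2)] by (simp add: add.commute)
  moreover have "shuffle_prod a (hook v b) vs = (-1) ^ (k * l + k) * shuffle_prod (hook v b) a vs"
    using Cons.IH[OF Cons.prems(1) has_parity_hook[OF Cons.prems(2)]] by (simp add: add.commute)
  moreover have "shuffle_prod a b (v # vs) = shuffle_prod (hook v a) b vs + (-1) ^ k * shuffle_prod a (hook v b) vs"
    by (simp add: shuffle_prod_Cons invol_has_parity[OF Cons.prems(1)] shuffle_prod_linear)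
  moreover have "shuffle_prod b a (v # vs) = shuffle_prod (hook v b) a vs + (-1) ^ l * shuffle_prod b (hook v a) vs"
    by (simp add: shuffle_prod_Cons invol_has_parity[OF Cons.prems(2)] shuffle_prod_linear)
  ultimately show ?case
    by (cases "even k"; cases "even l") simp_all
qed

lemma hook_scalar [simp]: "hook v (scalar c) = (\<lambda>_. 0)"
  by (simp add: hook_def scalar_def)

lemma invol_scalar [simp]: "invol (scalar c) = scalar c"
  by (auto simp: invol_def scalar_def)

lemma shuffle_prod_scalar: "shuffle_prod (scalar c) b = (\<lambda>vs. c * b vs)"
proof
  show "shuffle_prod (scalar c) b vs = c * b vs" for vs
    by (induction vs arbitrary: b) (auto simp: shuffle_prod_Cons, auto simp: scalar_def hook_def)
qed


lemma shuffle_prod_scalar_right: "shuffle_prod a (scalar c) = (\<lambda>vs. c * a vs)"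
proof
  show "shuffle_prod a (scalar c) vs = c * a vs" for vs
    by (induction vs arbitrary: a) (auto simp: shuffle_prod_Cons, auto simp: scalar_def hook_def)
qed


section \<open>Alternating forms\<close>

context smooth_mfd
begin

text \<open>The clauses of \<open>diff_forms\<close> that concern one point;
  \<open>diff_forms_iff\<close> separates them from smoothness along vector fields.\<close>

definition alternating :: "'a \<Rightarrow> ('a tangent list \<Rightarrow> real) \<Rightarrow> bool" where
  "alternating p a \<longleftrightarrow>
     (\<forall>vs. \<not> set vs \<subseteq> T p \<longrightarrow> a vs = 0) \<and>
     (\<forall>us ws v w. set us \<union> set ws \<union> {v, w} \<subseteq> T p \<longrightarrow>
        a (us @ (v + w) # ws) = a (us @ v # ws) + a (us @ w # ws)) \<and>
     (\<forall>us ws v c. set us \<union> set ws \<union> {v} \<subseteq> T p \<longrightarrow>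
        a (us @ (\<lambda>f. c * v f) # ws) = c * a (us @ v # ws)) \<and>
     (\<forall>vs. \<not> distinct vs \<longrightarrow> a vs = 0)"

lemma
  assumes "alternating p a"
  shows alternating_off: "\<not> set vs \<subseteq> T p \<Longrightarrow> a vs = 0"
    and alternating_add: "set us \<subseteq> T p \<Longrightarrow> set ws \<subseteq> T p \<Longrightarrow> v \<in> T p \<Longrightarrow> w \<in> T p \<Longrightarrow>
        a (us @ (v + w) # ws) = a (us @ v # ws) + a (us @ w # ws)"
    and alternating_scale: "set us \<subseteq> T p \<Longrightarrow> set ws \<subseteq> T p \<Longrightarrow> v \<in> T p \<Longrightarrow>
        a (us @ (\<lambda>f. c * v f) # ws) = c * a (us @ v # ws)"
    and alternating_distinct: "\<not> distinct vs \<Longrightarrow> a vs = 0"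
  using assms unfolding alternating_def by auto

lemma tangent_plus: "v \<in> T p \<Longrightarrow> w \<in> T p \<Longrightarrow> v + w \<in> T p"
  using tangent_space_plus by (simp add: plus_fun_def)

text \<open>With additivity, vanishing on adjacent equal vectors gives antisymmetry under adjacent swaps.\<close>

lemma alternatingI:
  assumes off: "\<And>vs. \<not> set vs \<subseteq> T p \<Longrightarrow> a vs = 0"
    and add: "\<And>us ws v w. set us \<subseteq> T p \<Longrightarrow> set ws \<subseteq> T p \<Longrightarrow> v \<in> T p \<Longrightarrow> w \<in> T p \<Longrightarrow>
        a (us @ (v + w) # ws) = a (us @ v # ws) + a (us @ w # ws)"
    and scale: "\<And>us ws v c. set us \<subseteq> T p \<Longrightarrow> set ws \<subseteq> T p \<Longrightarrow> v \<in> T p \<Longrightarrow>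
        a (us @ (\<lambda>f. c * v f) # ws) = c * a (us @ v # ws)"
    and adj: "\<And>us ws v. set us \<subseteq> T p \<Longrightarrow> set ws \<subseteq> T p \<Longrightarrow> v \<in> T p \<Longrightarrow> a (us @ v # v # ws) = 0"
  shows "alternating p a"
proof -
  have swap: "a (us @ v # w # ws) = - a (us @ w # v # ws)"
    if h: "set us \<subseteq> T p" "set ws \<subseteq> T p" "v \<in> T p" "w \<in> T p" for us ws v w
  proof -
    have "0 = a (us @ (v + w) # (v + w) # ws)"
      using adj h tangent_plus by simp
    also have "\<dots> = a (us @ v # (v + w) # ws) + a (us @ w # (v + w) # ws)"
      using add[of us "(v + w) # ws" v w] h tangent_plus by simp
    also have "a (us @ v # (v + w) # ws) = a (us @ v # v # ws) + a (us @ v # w # ws)"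
      using add[of "us @ [v]" ws v w] h by simp
    also have "a (us @ w # (v + w) # ws) = a (us @ w # v # ws) + a (us @ w # w # ws)"
      using add[of "us @ [w]" ws v w] h by simp
    finally show ?thesis using adj h by simp
  qed
  have rep: "a (xs @ y # ys @ y # zs) = 0" if "set (xs @ y # ys @ y # zs) \<subseteq> T p" for xs y ys zs
    using that
  proof (induction ys arbitrary: xs)
    case Nil
    then show ?case using adj by simp
  next
    case (Cons z ys)
    have "a (xs @ y # (z # ys) @ y # zs) = - a (xs @ z # y # ys @ y # zs)"
      using swap[of xs "ys @ y # zs" y z] Cons.prems by simp
    also have "\<dots> = 0" using Cons.IH[of "xs @ [z]"] Cons.prems by simp
    finally show ?case .
  qed
  have "a vs = 0" if nd: "\<not> distinct vs" for vs
  proof (cases "set vs \<subseteq> T p")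
    case True
    obtain xs ys zs y where "vs = xs @ [y] @ ys @ [y] @ zs"
      using not_distinct_decomp[OF nd] by blast
    then show ?thesis using rep[of xs y ys zs] True by simp
  qed (use off in auto)
  then show ?thesis unfolding alternating_def using off add scale by auto
qed

lemma hook_alternating: assumes "alternating p a" "v \<in> T p" shows "alternating p (hook v a)"
  unfolding alternating_def hook_def
proof (intro conjI allI impI)
  fix us ws u w
  assume "set us \<union> set ws \<union> {u, w} \<subseteq> T p"
  then show "a (v # us @ (u + w) # ws) = a (v # us @ u # ws) + a (v # us @ w # ws)"
    using alternating_add[OF assms(1), of "v # us" ws u w] assms(2) by simp
next
  fix us ws u and c :: real
  assume "set us \<union> set ws \<union> {u} \<subseteq> T p"
  then show "a (v # us @ (\<lambda>f. c * u f) # ws) = c * a (v # us @ u # ws)"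
    using alternating_scale[OF assms(1), of "v # us" ws u] assms(2) by simp
qed (use assms alternating_off alternating_distinct in auto)

lemma hook_add:
  assumes a: "alternating p a" and vw: "v \<in> T p" "w \<in> T p"
  shows "hook (v + w) a = (\<lambda>vs. hook v a vs + hook w a vs)"
proof
  show "hook (v + w) a vs = hook v a vs + hook w a vs" for vs
  proof (cases "set vs \<subseteq> T p")
    case True
    then show ?thesis using alternating_add[OF a, of "[]" vs v w] vw by (simp add: hook_def)
  qed (simp add: hook_def alternating_off[OF a])
qed

lemma hook_scale:
  assumes a: "alternating p a" and v: "v \<in> T p"
  shows "hook (\<lambda>f. c * v f) a = (\<lambda>vs. c * hook v a vs)"
proof
  show "hook (\<lambda>f. c * v f) a vs = c * hook v a vs" for vs
  proof (cases "set vs \<subseteq> T p")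
    case True
    then show ?thesis using alternating_scale[OF a, of "[]" vs v] v by (simp add: hook_def)
  qed (simp add: hook_def alternating_off[OF a])
qed

lemma hook_sum:
  assumes a: "alternating p a" and v: "\<And>i. i \<in> I \<Longrightarrow> v i \<in> T p"
  shows "hook (\<lambda>f. \<Sum>i\<in>I. c i * v i f) a vs = (\<Sum>i\<in>I. c i * hook (v i) a vs)"
proof -
  have z: "hook (\<lambda>_. 0) a vs = 0" using hook_scale[OF a tangent_space_zero, of 0] by simp
  show ?thesis using v
  proof (induction I rule: infinite_finite_induct)
    case (insert i I)
    have "(\<lambda>f. \<Sum>i\<in>insert i I. c i * v i f) = (\<lambda>f. c i * v i f) + (\<lambda>f. \<Sum>i\<in>I. c i * v i f)"
      using insert by (simp add: plus_fun_def)
    moreover have "hook ((\<lambda>f. c i * v i f) + (\<lambda>f. \<Sum>i\<in>I. c i * v i f)) a vs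
        = hook (\<lambda>f. c i * v i f) a vs + hook (\<lambda>f. \<Sum>i\<in>I. c i * v i f) a vs"
      using insert.prems by (subst hook_add[OF a]) (auto intro!: tangent_space_sum tangent_space_scale)
    ultimately show ?case
      using insert hook_scale[OF a, of "v i"] by simp
  qed (simp_all add: z)
qed

lemma hook_off:
  assumes "alternating p a" "v \<notin> T p" shows "hook v a = (\<lambda>_. 0)"
  using alternating_off[OF assms(1)] assms(2) by (auto simp: hook_def)

lemma hook_hook_same: "alternating p a \<Longrightarrow> hook v (hook v a) = (\<lambda>_. 0)"
  using alternating_distinct[of p a] by (auto simp: hook_def)

lemma hook_commute:
  assumes a: "alternating p a" and vw: "v \<in> T p" "w \<in> T p"
  shows "hook v (hook w a) vs = - hook w (hook v a) vs"
proof -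
  have 0: "a (u # u # vs) = 0" for u using alternating_distinct[OF a] by simp
  have "a ((v + w) # (v + w) # vs) = a (v # (v + w) # vs) + a (w # (v + w) # vs)"
    using fun_cong[OF hook_add[OF a vw]] by (simp only: hook_def)
  moreover have "a (u # (v + w) # vs) = a (u # v # vs) + a (u # w # vs)" if "u \<in> T p" for u
    using fun_cong[OF hook_add[OF hook_alternating[OF a that] vw]] by (simp only: hook_def)
  ultimately have "a (v # w # vs) + a (w # v # vs) = 0"
    using vw by (simp only: 0)
  then show ?thesis by (simp add: hook_def)
qed

lemma alternating_plus: "alternating p a \<Longrightarrow> alternating p b \<Longrightarrow> alternating p (\<lambda>vs. a vs + b vs)"
  unfolding alternating_def by (auto simp: distrib_left)

lemma alternating_times: "alternating p a \<Longrightarrow> alternating p (\<lambda>vs. c * a vs)"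
  unfolding alternating_def by (auto simp: distrib_left)

lemma alternating_zero: "alternating p (\<lambda>_. 0)"
  unfolding alternating_def by auto

text \<open>The defining conditions compare values on lists of equal length only, so a weight
  depending on the degree preserves them. This serves both \<open>invol\<close> and the extraction
  of components of a given degree.\<close>

lemma alternating_length: "alternating p a \<Longrightarrow> alternating p (\<lambda>vs. g (length vs) * a vs)"
  unfolding alternating_def by (auto simp: distrib_left)

lemma alternating_invol: "alternating p a \<Longrightarrow> alternating p (invol a)"
  unfolding invol_def by (rule alternating_length)

lemma alternating_scalar: "alternating p (scalar c)"
  unfolding alternating_def scalar_def by auto

text \<open>Vectors in front of the slot in question are stripped off one by one, which replaces a
  factor by its hook or by its \<open>invol\<close>; both stay alternating. For two equal vectors at
  the head, the terms with both in one factor vanish, and the two mixed terms cancel because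
  \<open>hook\<close> anticommutes with \<open>invol\<close>.\<close>

lemma alternating_shuffle_prod:
  assumes "alternating p a" "alternating p b"
  shows "alternating p (shuffle_prod a b)"
proof (rule alternatingI)
  show "shuffle_prod a b vs = 0" if "\<not> set vs \<subseteq> T p" for vs
    using that assms
  proof (induction vs arbitrary: a b)
    case (Cons v vs)
    show ?case
    proof (cases "v \<in> T p")
      case True
      then show ?thesis
        using Cons hook_alternating alternating_invol by (simp add: shuffle_prod_Cons)
    next
      case False
      then show ?thesis using Cons.prems hook_off by (simp add: shuffle_prod_Cons)
    qed
  qed simp
next
  show "shuffle_prod a b (us @ (v + w) # ws) = shuffle_prod a b (us @ v # ws) + shuffle_prod a b (us @ w # ws)"
    if h: "set us \<subseteq> T p" "set ws \<subseteq> T p" "v \<in> T p" "w \<in> T p" for us ws v w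
    using h(1) assms
  proof (induction us arbitrary: a b)
    case Nil
    then show ?case
      using h by (simp only: append_Nil shuffle_prod_Cons hook_add) (simp add: shuffle_prod_linear)
  next
    case (Cons u us)
    then show ?case by (simp add: shuffle_prod_Cons hook_alternating alternating_invol)
  qed
next
  show "shuffle_prod a b (us @ (\<lambda>f. c * v f) # ws) = c * shuffle_prod a b (us @ v # ws)"
    if h: "set us \<subseteq> T p" "set ws \<subseteq> T p" "v \<in> T p" for us ws v c
    using h(1) assms
  proof (induction us arbitrary: a b)
    case Nil
    then show ?case
      using h hook_scale by (simp add: shuffle_prod_Cons shuffle_prod_linear distrib_left)
  next
    case (Cons u us)
    then show ?case by (simp add: shuffle_prod_Cons hook_alternating alternating_invol distrib_left)
  qed
next
  show "shuffle_prod a b (us @ v # v # ws) = 0"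
    if h: "set us \<subseteq> T p" "set ws \<subseteq> T p" "v \<in> T p" for us ws v
    using h(1) assms
  proof (induction us arbitrary: a b)
    case Nil
    then show ?case
      using hook_hook_same by (simp add: shuffle_prod_Cons hook_invol shuffle_prod_linear)
  next
    case (Cons u us)
    then show ?case by (simp add: shuffle_prod_Cons hook_alternating alternating_invol)
  qed
qed

end


section \<open>Differential forms and their derivations\<close>

text \<open>As simplification rules these two equations also turn the unapplied \<open>0\<close> and \<open>+\<close> into
  abstractions, which hides sums of forms and of operators from all other rules.\<close>

declare plus_fun_apply [simp del] zero_fun_apply [simp del]

lemma sum_fun_apply: "(\<Sum>i\<in>I. f i) x = (\<Sum>i\<in>I. f i x)"
  for f :: "'i \<Rightarrow> 'b \<Rightarrow> 'c::comm_monoid_add"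
  by (induction I rule: infinite_finite_induct) (auto simp: plus_fun_apply zero_fun_apply)

lemmas fun_apply_simps = plus_fun_apply zero_fun_apply sum_fun_apply

definition function_form :: "('a \<Rightarrow> real) \<Rightarrow> 'a form" where
  "function_form f = (\<lambda>p. scalar (f p))"

text \<open>Interior product without the default value that \<open>interior_product\<close> takes
  off \<open>diff_forms\<close>, so that its algebraic rules are plain equations.\<close>

definition contract :: "'a vector_field \<Rightarrow> 'a form \<Rightarrow> 'a form" where
  "contract V \<omega> = (\<lambda>p. hook (V p) (\<omega> p))"

definition invol_form :: "'a form \<Rightarrow> 'a form" where
  "invol_form \<omega> = (\<lambda>p. invol (\<omega> p))"

definition fscale_form :: "('a \<Rightarrow> real) \<Rightarrow> 'a form \<Rightarrow> 'a form" where
  "fscale_form f \<omega> = (\<lambda>p vs. f p * \<omega> p vs)"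

lemma scale_form_eq: "scale_form c = fscale_form (\<lambda>_. c)"
  by (simp add: fun_apply_simps fun_eq_iff scale_form_def fscale_form_def)

lemma wedge_add_left: "wedge (\<alpha> + \<alpha>') \<beta> = wedge \<alpha> \<beta> + wedge \<alpha>' \<beta>"
  by (simp add: fun_apply_simps fun_eq_iff wedge_eq plus_fun_def shuffle_prod_linear)

lemma wedge_add_right: "wedge \<alpha> (\<beta> + \<beta>') = wedge \<alpha> \<beta> + wedge \<alpha> \<beta>'"
  by (simp add: fun_apply_simps fun_eq_iff wedge_eq plus_fun_def shuffle_prod_linear)

lemma wedge_fscale_left: "wedge (fscale_form c \<alpha>) \<beta> = fscale_form c (wedge \<alpha> \<beta>)"
  by (simp add: fun_apply_simps fun_eq_iff wedge_eq fscale_form_def shuffle_prod_linear)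

lemma wedge_fscale_right: "wedge \<alpha> (fscale_form c \<beta>) = fscale_form c (wedge \<alpha> \<beta>)"
  by (simp add: fun_apply_simps fun_eq_iff wedge_eq fscale_form_def shuffle_prod_linear)

lemma wedge_scale_left: "wedge (scale_form c \<alpha>) \<beta> = scale_form c (wedge \<alpha> \<beta>)"
  by (simp add: scale_form_eq wedge_fscale_left)

lemma wedge_scale_right: "wedge \<alpha> (scale_form c \<beta>) = scale_form c (wedge \<alpha> \<beta>)"
  by (simp add: scale_form_eq wedge_fscale_right)

lemma wedge_zero [simp]: "wedge 0 \<beta> = 0" "wedge \<alpha> 0 = 0"
  by (simp_all add: fun_apply_simps fun_eq_iff wedge_eq zero_fun_def)

lemma scale_form_add: "scale_form c (\<alpha> + \<beta>) = scale_form c \<alpha> + scale_form c \<beta>"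
  by (simp add: fun_apply_simps fun_eq_iff scale_form_def distrib_left)

lemma scale_form_scale: "scale_form c (scale_form d \<alpha>) = scale_form (c * d) \<alpha>"
  by (simp add: fun_apply_simps fun_eq_iff scale_form_def)

lemma scale_form_one [simp]: "scale_form 1 \<alpha> = \<alpha>"
  by (simp add: fun_apply_simps fun_eq_iff scale_form_def)

lemma scale_form_zero [simp]: "scale_form c 0 = 0"
  by (simp add: fun_apply_simps fun_eq_iff scale_form_def)

lemma wedge_assoc: "wedge (wedge \<alpha> \<beta>) \<gamma> = wedge \<alpha> (wedge \<beta> \<gamma>)"
  by (simp add: fun_apply_simps fun_eq_iff wedge_eq shuffle_prod_assoc)

lemma wedge_function_form: "wedge (function_form f) \<beta> = fscale_form f \<beta>"
  by (simp add: fun_apply_simps fun_eq_iff wedge_eq function_form_def shuffle_prod_scalar fscale_form_def)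

lemma wedge_function_form_right: "wedge \<alpha> (function_form f) = fscale_form f \<alpha>"
  by (simp add: fun_apply_simps fun_eq_iff wedge_eq function_form_def shuffle_prod_scalar_right fscale_form_def)

lemma wedge_one_left: "wedge (function_form (\<lambda>_. 1)) \<beta> = \<beta>"
  by (simp add: wedge_function_form fscale_form_def)

lemma contract_wedge:
  "contract V (wedge \<alpha> \<beta>) = wedge (contract V \<alpha>) \<beta> + wedge (invol_form \<alpha>) (contract V \<beta>)"
  by (simp add: fun_apply_simps fun_eq_iff contract_def wedge_eq hook_shuffle_prod invol_form_def)

lemma contract_add: "contract V (\<alpha> + \<beta>) = contract V \<alpha> + contract V \<beta>"
  by (simp add: fun_apply_simps fun_eq_iff contract_def hook_def)

lemma contract_fscale: "contract V (fscale_form f \<alpha>) = fscale_form f (contract V \<alpha>)"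
  by (simp add: fun_apply_simps fun_eq_iff contract_def hook_def fscale_form_def)

lemma contract_scale: "contract V (scale_form c \<alpha>) = scale_form c (contract V \<alpha>)"
  by (simp add: scale_form_eq contract_fscale)

lemma contract_zero [simp]: "contract V 0 = 0"
  by (simp add: fun_apply_simps fun_eq_iff contract_def hook_def)

lemma contract_function_form [simp]: "contract V (function_form f) = 0"
  by (simp add: fun_apply_simps fun_eq_iff contract_def function_form_def)

lemma contract_invol_form: "contract V (invol_form \<alpha>) = scale_form (-1) (invol_form (contract V \<alpha>))"
  by (simp add: fun_apply_simps fun_eq_iff contract_def invol_form_def hook_invol scale_form_def)

context smooth_mfd
begin

abbreviation "\<Omega> \<equiv> diff_forms A"
abbreviation "H \<equiv> homogeneous_forms A"
abbreviation "Der \<equiv> derivations A"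
abbreviation "HDer \<equiv> homogeneous_derivations A"

lemma diff_forms_iff:
  "\<omega> \<in> \<Omega> \<longleftrightarrow> (\<forall>p. alternating p (\<omega> p)) \<and>
     (\<forall>Vs. set Vs \<subseteq> VF \<longrightarrow> (\<lambda>p. \<omega> p (map (\<lambda>V. V p) Vs)) \<in> C)"
  unfolding diff_forms_def alternating_def by (simp add: all_conj_distrib)

lemma
  assumes "\<omega> \<in> \<Omega>"
  shows form_alternating: "alternating p (\<omega> p)"
    and form_smooth: "set Vs \<subseteq> VF \<Longrightarrow> (\<lambda>p. \<omega> p (map (\<lambda>V. V p) Vs)) \<in> C"
  using assms by (auto simp: diff_forms_iff)

lemma form_smooth_Nil: "\<omega> \<in> \<Omega> \<Longrightarrow> (\<lambda>p. \<omega> p []) \<in> C"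
  using form_smooth[of \<omega> "[]"] by simp

lemma form_add [intro]: "\<alpha> \<in> \<Omega> \<Longrightarrow> \<beta> \<in> \<Omega> \<Longrightarrow> \<alpha> + \<beta> \<in> \<Omega>"
  by (auto simp: diff_forms_iff plus_fun_def alternating_plus)

lemma form_fscale [intro]: "f \<in> C \<Longrightarrow> \<alpha> \<in> \<Omega> \<Longrightarrow> fscale_form f \<alpha> \<in> \<Omega>"
  by (auto simp: diff_forms_iff fscale_form_def alternating_times)

lemma form_scale [intro]: "\<alpha> \<in> \<Omega> \<Longrightarrow> scale_form c \<alpha> \<in> \<Omega>"
  by (simp add: scale_form_eq form_fscale)

lemma form_zero [simp, intro]: "0 \<in> \<Omega>"
  by (simp add: diff_forms_iff zero_fun_def alternating_zero)

lemma form_sum [intro]: "(\<And>i. i \<in> I \<Longrightarrow> \<alpha> i \<in> \<Omega>) \<Longrightarrow> (\<Sum>i\<in>I. \<alpha> i) \<in> \<Omega>"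
  by (induction I rule: infinite_finite_induct) auto

lemma form_contract [intro]: "V \<in> VF \<Longrightarrow> \<alpha> \<in> \<Omega> \<Longrightarrow> contract V \<alpha> \<in> \<Omega>"
  unfolding diff_forms_iff[of "contract V \<alpha>"]
  using form_smooth[of \<alpha> "V # Vs" for Vs] by (auto simp: contract_def hook_alternating form_alternating) (simp add: hook_def)

lemma form_invol [intro]: "\<alpha> \<in> \<Omega> \<Longrightarrow> invol_form \<alpha> \<in> \<Omega>"
  unfolding diff_forms_iff invol_form_def by (auto intro!: alternating_invol) (auto simp: invol_def)

lemma form_function [intro]: "f \<in> C \<Longrightarrow> function_form f \<in> \<Omega>"
proof -
  assume f: "f \<in> C"
  have "(\<lambda>p. scalar (f p) (map (\<lambda>V. V p) Vs)) \<in> C" for Vs :: "'a vector_field list"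
    using f by (cases Vs) (auto simp: scalar_def)
  then show ?thesis by (simp add: diff_forms_iff function_form_def alternating_scalar)
qed

lemma function_form_iff: "function_form f \<in> \<Omega> \<longleftrightarrow> f \<in> C"
  using form_smooth_Nil[of "function_form f"] form_function by (auto simp: function_form_def scalar_def)

text \<open>Smoothness is shown by contracting one field at a time: each evaluation of a product is
  a sum of evaluations, on a shorter list, of products of other forms.\<close>

lemma form_wedge [intro]: "\<alpha> \<in> \<Omega> \<Longrightarrow> \<beta> \<in> \<Omega> \<Longrightarrow> wedge \<alpha> \<beta> \<in> \<Omega>"
proof -
  assume \<alpha>\<beta>: "\<alpha> \<in> \<Omega>" "\<beta> \<in> \<Omega>"
  have "(\<lambda>p. wedge \<alpha> \<beta> p (map (\<lambda>V. V p) Vs)) \<in> C" if "set Vs \<subseteq> VF" for Vs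
    using that \<alpha>\<beta>
  proof (induction Vs arbitrary: \<alpha> \<beta>)
    case Nil
    then show ?case by (auto simp: wedge_eq form_smooth_Nil)
  next
    case (Cons V Vs)
    have "(\<lambda>p. wedge (contract V \<alpha>) \<beta> p (map (\<lambda>V. V p) Vs) +
        wedge (invol_form \<alpha>) (contract V \<beta>) p (map (\<lambda>V. V p) Vs)) \<in> C"
      using Cons.prems by (intro smooth_add Cons.IH) auto
    then show ?case
      by (simp add: wedge_eq shuffle_prod_Cons contract_def invol_form_def)
  qed
  then show ?thesis
    using \<alpha>\<beta> by (simp add: diff_forms_iff[of "wedge _ _"]) (simp add: wedge_eq alternating_shuffle_prod form_alternating)
qed

section \<open>Parity of forms\<close>

lemma homogeneous_iff: "\<omega> \<in> H k \<longleftrightarrow> \<omega> \<in> \<Omega> \<and> (\<forall>p. has_parity k (\<omega> p))"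
  by (auto simp: homogeneous_forms_def has_parity_def)

lemma homogeneous_form: "\<omega> \<in> H k \<Longrightarrow> \<omega> \<in> \<Omega>"
  by (simp add: homogeneous_iff)

lemma homogeneous_cong: "even (k + l) \<Longrightarrow> H k = H l"
  by (auto simp: homogeneous_forms_def)

lemma homogeneous_add [intro]: "\<alpha> \<in> H k \<Longrightarrow> \<beta> \<in> H k \<Longrightarrow> \<alpha> + \<beta> \<in> H k"
  by (auto simp: homogeneous_iff has_parity_def fun_apply_simps)

lemma homogeneous_scale [intro]: "\<alpha> \<in> H k \<Longrightarrow> scale_form c \<alpha> \<in> H k"
  unfolding homogeneous_iff by (intro conjI form_scale) (auto simp: scale_form_def has_parity_def)

lemma homogeneous_zero [simp, intro]: "0 \<in> H k"
  by (auto simp: homogeneous_iff has_parity_def fun_apply_simps)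

lemma homogeneous_sum [intro]: "(\<And>i. i \<in> I \<Longrightarrow> \<alpha> i \<in> H k) \<Longrightarrow> (\<Sum>i\<in>I. \<alpha> i) \<in> H k"
  by (induction I rule: infinite_finite_induct) auto

lemma homogeneous_wedge [intro]: "\<alpha> \<in> H k \<Longrightarrow> \<beta> \<in> H l \<Longrightarrow> wedge \<alpha> \<beta> \<in> H (k + l)"
  by (auto simp: homogeneous_iff wedge_eq shuffle_prod_has_parity)

lemma homogeneous_contract: "V \<in> VF \<Longrightarrow> \<alpha> \<in> H k \<Longrightarrow> contract V \<alpha> \<in> H (Suc k)"
  unfolding homogeneous_iff by (intro conjI form_contract) (auto simp: contract_def has_parity_hook)

lemma homogeneous_function: "f \<in> C \<Longrightarrow> function_form f \<in> H 0"
  unfolding homogeneous_iff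
  by (intro conjI form_function) (auto simp: has_parity_def function_form_def scalar_def)

lemma homogeneous_invol: "\<alpha> \<in> H k \<Longrightarrow> invol_form \<alpha> = scale_form ((-1) ^ k) \<alpha>"
  by (rule ext) (simp add: homogeneous_iff invol_form_def invol_has_parity scale_form_def)

lemma wedge_commute:
  "\<alpha> \<in> H k \<Longrightarrow> \<beta> \<in> H l \<Longrightarrow> wedge \<alpha> \<beta> = scale_form ((-1) ^ (k * l)) (wedge \<beta> \<alpha>)"
  unfolding fun_eq_iff homogeneous_iff wedge_eq scale_form_def
  using shuffle_prod_commute by blast

text \<open>\<open>invol_form\<close> squares to the identity; half of the sum and half of the
  difference with it are the projections onto the even and the odd part.\<close>

lemma parity_split:
  assumes "\<omega> \<in> \<Omega>"
  obtains \<alpha> \<beta> where "\<alpha> \<in> H 0" "\<beta> \<in> H 1" "\<omega> = \<alpha> + \<beta>"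
proof
  have i: "invol_form \<omega> \<in> \<Omega>" using assms by auto
  show "scale_form (1/2) (\<omega> + invol_form \<omega>) \<in> H 0"
    "scale_form (1/2) (\<omega> + scale_form (-1) (invol_form \<omega>)) \<in> H 1"
    unfolding homogeneous_iff has_parity_def using assms i
    by (intro conjI form_scale form_add; simp add: fun_apply_simps scale_form_def invol_form_def invol_def)+
  show "\<omega> = scale_form (1/2) (\<omega> + invol_form \<omega>) + scale_form (1/2) (\<omega> + scale_form (-1) (invol_form \<omega>))"
    by (simp add: fun_apply_simps fun_eq_iff scale_form_def field_simps)
qed

section \<open>Graded derivations as a module over forms\<close>

lemma HDerI:
  assumes "\<And>\<omega>. \<omega> \<notin> \<Omega> \<Longrightarrow> D \<omega> = 0"
    and "\<And>\<alpha> \<beta>. \<alpha> \<in> \<Omega> \<Longrightarrow> \<beta> \<in> \<Omega> \<Longrightarrow> D (\<alpha> + \<beta>) = D \<alpha> + D \<beta>"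
    and "\<And>c \<alpha>. \<alpha> \<in> \<Omega> \<Longrightarrow> D (scale_form c \<alpha>) = scale_form c (D \<alpha>)"
    and "\<And>l \<alpha>. \<alpha> \<in> H l \<Longrightarrow> D \<alpha> \<in> H (k + l)"
    and "\<And>l \<alpha> \<beta>. \<alpha> \<in> H l \<Longrightarrow> \<beta> \<in> \<Omega> \<Longrightarrow>
      D (wedge \<alpha> \<beta>) = wedge (D \<alpha>) \<beta> + scale_form ((-1) ^ (k * l)) (wedge \<alpha> (D \<beta>))"
  shows "D \<in> HDer k"
  using assms by (simp add: homogeneous_derivations_def)

lemma
  assumes "D \<in> HDer k"
  shows HDer_off: "\<omega> \<notin> \<Omega> \<Longrightarrow> D \<omega> = 0"
    and HDer_add: "\<alpha> \<in> \<Omega> \<Longrightarrow> \<beta> \<in> \<Omega> \<Longrightarrow> D (\<alpha> + \<beta>) = D \<alpha> + D \<beta>"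
    and HDer_scale: "\<alpha> \<in> \<Omega> \<Longrightarrow> D (scale_form c \<alpha>) = scale_form c (D \<alpha>)"
    and HDer_homogeneous: "\<alpha> \<in> H l \<Longrightarrow> D \<alpha> \<in> H (k + l)"
    and HDer_wedge: "\<alpha> \<in> H l \<Longrightarrow> \<beta> \<in> \<Omega> \<Longrightarrow>
      D (wedge \<alpha> \<beta>) = wedge (D \<alpha>) \<beta> + scale_form ((-1) ^ (k * l)) (wedge \<alpha> (D \<beta>))"
  using assms by (simp_all add: homogeneous_derivations_def)

lemma HDer_form: assumes "D \<in> HDer k" shows "D \<omega> \<in> \<Omega>"
proof (cases "\<omega> \<in> \<Omega>")
  case True
  then obtain \<alpha> \<beta> where "\<alpha> \<in> H 0" "\<beta> \<in> H 1" "\<omega> = \<alpha> + \<beta>" by (rule parity_split)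
  then show ?thesis
    using HDer_add[OF assms, of \<alpha> \<beta>] HDer_homogeneous[OF assms, of \<alpha> 0] HDer_homogeneous[OF assms, of \<beta> 1]
    by (simp add: homogeneous_form form_add)
qed (simp add: HDer_off[OF assms])

lemma HDer_zero_arg: "D \<in> HDer k \<Longrightarrow> D 0 = 0"
  using HDer_add[of D k 0 0] by simp

lemma HDer_sum:
  assumes D: "D \<in> HDer k"
  shows "(\<And>i. i \<in> I \<Longrightarrow> \<alpha> i \<in> \<Omega>) \<Longrightarrow> D (\<Sum>i\<in>I. \<alpha> i) = (\<Sum>i\<in>I. D (\<alpha> i))"
  by (induction I rule: infinite_finite_induct)
    (auto simp: HDer_zero_arg[OF D] HDer_add[OF D] form_sum)

text \<open>Degrees are natural numbers standing for classes modulo 2, and computations produce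
  degrees such as \<open>Suc k + 1\<close>; this identifies the corresponding sets of
  derivations.\<close>

lemma HDer_cong:
  assumes kl: "even (k + l)"
  shows "HDer k = HDer l"
proof -
  have "D \<in> HDer l" if D: "D \<in> HDer k" and kl: "even (k + l)" for D k l
  proof (rule HDerI)
    show "D \<alpha> \<in> H (l + n)" if "\<alpha> \<in> H n" for \<alpha> n
      using HDer_homogeneous[OF D that] homogeneous_cong[of "k + n" "l + n"] kl by simp
    show "D (wedge \<alpha> \<beta>) = wedge (D \<alpha>) \<beta> + scale_form ((-1) ^ (l * n)) (wedge \<alpha> (D \<beta>))"
      if "\<alpha> \<in> H n" "\<beta> \<in> \<Omega>" for \<alpha> \<beta> n
    proof -
      have "(-1::real) ^ (l * n) = (-1) ^ (k * n)" using kl by (auto simp: minus_one_power_iff)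
      then show ?thesis using HDer_wedge[OF D that] by simp
    qed
  qed (use HDer_off[OF D] HDer_add[OF D] HDer_scale[OF D] in auto)
  from this[of _ k l] this[of _ l k] kl show ?thesis by (auto simp: add.commute)
qed

lemma HDer_zero [simp, intro]: "0 \<in> HDer k"
  by (rule HDerI) (simp_all add: zero_fun_apply[where 'b="'a form"])

lemma HDer_plus [intro]:
  assumes D: "D \<in> HDer k" and E: "E \<in> HDer k" shows "D + E \<in> HDer k"
proof (rule HDerI)
  show "(D + E) (wedge \<alpha> \<beta>) = wedge ((D + E) \<alpha>) \<beta> + scale_form ((-1) ^ (k * l)) (wedge \<alpha> ((D + E) \<beta>))"
    if "\<alpha> \<in> H l" "\<beta> \<in> \<Omega>" for l \<alpha> \<beta>
    using HDer_wedge[OF D that] HDer_wedge[OF E that]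
    by (simp add: plus_fun_apply[of D E] add_ac wedge_add_left wedge_add_right scale_form_add)
  show "(D + E) \<alpha> \<in> H (k + l)" if "\<alpha> \<in> H l" for l \<alpha>
    using HDer_homogeneous[OF D that] HDer_homogeneous[OF E that] by (simp add: plus_fun_apply[of D E] homogeneous_add)
qed (simp_all add: plus_fun_apply[of D E] add_ac HDer_off[OF D] HDer_off[OF E] HDer_add[OF D] HDer_add[OF E] HDer_scale[OF D] HDer_scale[OF E]
      scale_form_add)

lemma HDer_sum_op [intro]: "(\<And>i. i \<in> I \<Longrightarrow> D i \<in> HDer k) \<Longrightarrow> (\<Sum>i\<in>I. D i) \<in> HDer k"
  by (induction I rule: infinite_finite_induct) auto

lemma HDer_form_mult:
  assumes \<alpha>: "\<alpha> \<in> H n" and D: "D \<in> HDer k"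
  shows "form_mult \<alpha> D \<in> HDer (n + k)"
proof (rule HDerI)
  note \<alpha>' = homogeneous_form[OF \<alpha>]
  show "form_mult \<alpha> D \<beta> \<in> H (n + k + l)" if "\<beta> \<in> H l" for l \<beta>
    unfolding form_mult_def using homogeneous_wedge[OF \<alpha> HDer_homogeneous[OF D that]] by (simp add: add.assoc)
  show "form_mult \<alpha> D (wedge \<beta> \<gamma>) = wedge (form_mult \<alpha> D \<beta>) \<gamma>
      + scale_form ((-1) ^ ((n + k) * l)) (wedge \<beta> (form_mult \<alpha> D \<gamma>))"
    if \<beta>: "\<beta> \<in> H l" and \<gamma>: "\<gamma> \<in> \<Omega>" for l \<beta> \<gamma>
  proof -
    \<comment> \<open>Moving \<alpha> past \<beta> costs the exponent n l, which joins the exponent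
      k l of D to give (n + k) l.\<close>
    have "wedge \<alpha> (wedge \<beta> (D \<gamma>)) = scale_form ((-1) ^ (n * l)) (wedge \<beta> (wedge \<alpha> (D \<gamma>)))"
      using wedge_commute[OF \<alpha> \<beta>] by (simp add: wedge_assoc[symmetric] wedge_scale_left)
    then show ?thesis
      using HDer_wedge[OF D \<beta> \<gamma>]
      by (simp add: form_mult_def wedge_add_right wedge_scale_right wedge_assoc scale_form_scale
          power_add[symmetric] algebra_simps)
  qed
qed (auto simp: form_mult_def HDer_off[OF D] HDer_add[OF D] HDer_scale[OF D] wedge_add_right wedge_scale_right)

lemma interior_product_eq: "\<omega> \<in> \<Omega> \<Longrightarrow> interior_product A V \<omega> = contract V \<omega>"
  by (simp add: interior_product_def contract_def hook_def)

lemma HDer_interior_product: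
  assumes V: "V \<in> VF" shows "interior_product A V \<in> HDer 1"
proof (rule HDerI)
  show "interior_product A V \<alpha> \<in> H (1 + l)" if "\<alpha> \<in> H l" for l \<alpha>
    using homogeneous_contract[OF V that] homogeneous_form[OF that] by (simp add: interior_product_eq)
  show "interior_product A V (wedge \<alpha> \<beta>) = wedge (interior_product A V \<alpha>) \<beta>
      + scale_form ((-1) ^ (1 * l)) (wedge \<alpha> (interior_product A V \<beta>))"
    if "\<alpha> \<in> H l" "\<beta> \<in> \<Omega>" for l \<alpha> \<beta>
    using homogeneous_form[OF that(1)] that
    by (simp add: interior_product_eq form_wedge contract_wedge homogeneous_invol wedge_scale_left)
qed (auto simp: interior_product_eq contract_add contract_scale form_add form_scale, simp add: interior_product_def)

lemma
  shows HDer0_Der: "D \<in> HDer 0 \<Longrightarrow> D \<in> Der"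
    and HDer1_Der: "D \<in> HDer 1 \<Longrightarrow> D \<in> Der"
  unfolding derivations_def by (force intro: exI[of _ 0])+

lemma HDer_Der: "D \<in> HDer k \<Longrightarrow> D \<in> Der"
  using HDer_cong[of k 0] HDer_cong[of k 1] HDer0_Der HDer1_Der by (cases "even k") auto

lemma Der_split: assumes "D \<in> Der" obtains D0 D1 where "D = D0 + D1" "D0 \<in> HDer 0" "D1 \<in> HDer 1"
  using assms by (auto simp: derivations_def)

lemma Der_add [intro]: assumes "D \<in> Der" "E \<in> Der" shows "D + E \<in> Der"
proof -
  obtain D0 D1 where D: "D = D0 + D1" "D0 \<in> HDer 0" "D1 \<in> HDer 1" using assms(1) by (rule Der_split)
  obtain E0 E1 where E: "E = E0 + E1" "E0 \<in> HDer 0" "E1 \<in> HDer 1" using assms(2) by (rule Der_split)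
  have "D + E = (D0 + E0) + (D1 + E1)" using D E by (simp add: algebra_simps)
  moreover have "D0 + E0 \<in> HDer 0" "D1 + E1 \<in> HDer 1" using D E by auto
  ultimately show ?thesis by (auto simp: derivations_def)
qed

lemma Der_zero [simp, intro]: "0 \<in> Der"
  by (rule HDer_Der[OF HDer_zero])

lemma Der_sum [intro]: "(\<And>i. i \<in> I \<Longrightarrow> D i \<in> Der) \<Longrightarrow> (\<Sum>i\<in>I. D i) \<in> Der"
  by (induction I rule: infinite_finite_induct) auto

lemma
  assumes "D \<in> Der"
  shows Der_off: "\<omega> \<notin> \<Omega> \<Longrightarrow> D \<omega> = 0"
    and Der_add_arg: "\<alpha> \<in> \<Omega> \<Longrightarrow> \<beta> \<in> \<Omega> \<Longrightarrow> D (\<alpha> + \<beta>) = D \<alpha> + D \<beta>"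
    and Der_scale: "\<alpha> \<in> \<Omega> \<Longrightarrow> D (scale_form c \<alpha>) = scale_form c (D \<alpha>)"
    and Der_form: "D \<omega> \<in> \<Omega>"
proof -
  obtain D0 D1 where D: "D = D0 + D1" and D0: "D0 \<in> HDer 0" and D1: "D1 \<in> HDer 1"
    using assms by (rule Der_split)
  show "\<omega> \<notin> \<Omega> \<Longrightarrow> D \<omega> = 0"
    by (simp add: D plus_fun_apply[of D0 D1] HDer_off[OF D0] HDer_off[OF D1])
  show "\<alpha> \<in> \<Omega> \<Longrightarrow> \<beta> \<in> \<Omega> \<Longrightarrow> D (\<alpha> + \<beta>) = D \<alpha> + D \<beta>"
    by (simp add: D plus_fun_apply[of D0 D1] HDer_add[OF D0] HDer_add[OF D1] add_ac)
  show "\<alpha> \<in> \<Omega> \<Longrightarrow> D (scale_form c \<alpha>) = scale_form c (D \<alpha>)"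
    by (simp add: D plus_fun_apply[of D0 D1] HDer_scale[OF D0] HDer_scale[OF D1] scale_form_add)
  show "D \<omega> \<in> \<Omega>"
    using HDer_form[OF D0] HDer_form[OF D1] by (auto simp: D plus_fun_apply[of D0 D1])
qed

text \<open>For an even first factor the Leibniz sign is 1 for the even and for the odd part of D
  alike, so the rule survives for mixed D. Applied to functions it is the product rule of tangent
  vectors.\<close>

lemma Der_wedge_even:
  assumes "D \<in> Der" "\<alpha> \<in> H 0" "\<beta> \<in> \<Omega>"
  shows "D (wedge \<alpha> \<beta>) = wedge (D \<alpha>) \<beta> + wedge \<alpha> (D \<beta>)"
proof -
  obtain D0 D1 where D: "D = D0 + D1" "D0 \<in> HDer 0" "D1 \<in> HDer 1" using assms(1) by (rule Der_split)
  show ?thesis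
    using HDer_wedge[OF D(2) assms(2,3)] HDer_wedge[OF D(3) assms(2,3)]
    by (simp add: D(1) plus_fun_apply[of D0 D1] wedge_add_left wedge_add_right algebra_simps)
qed

end


section \<open>The Lie derivative\<close>

definition fscale_field :: "('a \<Rightarrow> real) \<Rightarrow> 'a vector_field \<Rightarrow> 'a vector_field" where
  "fscale_field a V = (\<lambda>p f. a p * V p f)"

text \<open>The expression in the definition of \<open>lie_derivative\<close>, as a recursion on the
  fields. The second equation expresses that the commutator of Lie derivative and interior product
  is the interior product with the bracket; \<open>lie_eval_eq\<close> recovers the closed
  formula.\<close>

primrec lie_eval :: "'a vector_field \<Rightarrow> 'a vector_field list \<Rightarrow> 'a form \<Rightarrow> 'a \<Rightarrow> real" where
  "lie_eval Z [] = (\<lambda>\<omega> p. Z p (\<lambda>q. \<omega> q []))"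
| "lie_eval Z (V # Vs) = (\<lambda>\<omega> p. lie_eval Z Vs (contract V \<omega>) p
     - contract (lie_bracket Z V) \<omega> p (map (\<lambda>V. V p) Vs))"

lemma lie_eval_eq:
  "lie_eval Z Vs \<omega> p = Z p (\<lambda>q. \<omega> q (map (\<lambda>V. V q) Vs)) -
     (\<Sum>i<length Vs. \<omega> p (map (\<lambda>V. V p) (Vs[i := lie_bracket Z (Vs ! i)])))"
proof (induction Vs arbitrary: \<omega>)
  case (Cons V Vs)
  show ?case
    unfolding length_Cons sum.lessThan_Suc_shift lie_eval.simps Cons
    by (simp add: contract_def hook_def)
qed simp

context smooth_mfd
begin

lemmas VF_add = tangent_add[OF VF_tangent]
  and VF_scale = tangent_scale[OF VF_tangent]
  and VF_mult = tangent_mult[OF VF_tangent]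
  and VF_off = tangent_off[OF VF_tangent]
  and VF_const = tangent_const[OF VF_tangent]

lemmas VF_calc = VF_add VF_scale VF_mult VF_smooth

lemma VF_zero [simp, intro]: "0 \<in> VF"
proof -
  have "(\<lambda>p f. 0) = (0 :: 'a vector_field)" by (intro ext) (simp only: zero_fun_apply)
  moreover have "(\<lambda>p f. 0) \<in> VF" unfolding vector_fields_def by simp
  ultimately show ?thesis by simp
qed

lemma VF_list: "set Vs \<subseteq> VF \<Longrightarrow> set (map (\<lambda>V. V p) Vs) \<subseteq> T p"
  by auto

lemma VF_plus [intro]: "V \<in> VF \<Longrightarrow> W \<in> VF \<Longrightarrow> V + W \<in> VF"
  unfolding vector_fields_def by (auto simp: fun_apply_simps plus_fun_def intro!: tangent_space_plus)

lemma VF_fscale [intro]: "a \<in> C \<Longrightarrow> V \<in> VF \<Longrightarrow> fscale_field a V \<in> VF"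
  unfolding vector_fields_def by (auto simp: fscale_field_def intro!: tangent_space_scale)

lemma VF_bracket [intro]:
  assumes Z: "Z \<in> VF" and V: "V \<in> VF" shows "lie_bracket Z V \<in> VF"
  unfolding vector_fields_def
proof (intro CollectI conjI allI ballI)
  note simps = VF_calc[OF Z] VF_calc[OF V] smooth_mult smooth_scale
  show "lie_bracket Z V p \<in> T p" for p
    unfolding lie_bracket_def
  proof (rule tangent_spaceI)
    \<comment> \<open>For non-smooth f the inner functions are constantly 0 by the extension
      convention, and derivations kill constants.\<close>
    show "Z p (\<lambda>q. V q f) - V p (\<lambda>q. Z q f) = 0" if "f \<notin> C" for f
      by (simp add: VF_off[OF Z that] VF_off[OF V that] VF_const[OF Z] VF_const[OF V])
  qed (simp_all add: simps, simp_all add: algebra_simps)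
  show "(\<lambda>p. lie_bracket Z V p f) \<in> C" if "f \<in> C" for f
    unfolding lie_bracket_def
    by (rule smooth_diff[OF VF_smooth[OF Z VF_smooth[OF V that]] VF_smooth[OF V VF_smooth[OF Z that]]])
qed

lemma bracket_plus:
  assumes Z: "Z \<in> VF" and V: "V \<in> VF" "W \<in> VF"
  shows "lie_bracket Z (V + W) = lie_bracket Z V + lie_bracket Z W"
proof (intro ext)
  fix p f
  show "lie_bracket Z (V + W) p f = (lie_bracket Z V + lie_bracket Z W) p f"
  proof (cases "f \<in> C")
    case True
    then show ?thesis
      by (simp add: lie_bracket_def fun_apply_simps VF_calc[OF Z] VF_calc[OF V(1)] VF_calc[OF V(2)])
  next
    case False
    then show ?thesis
      by (simp add: lie_bracket_def fun_apply_simps VF_off[OF Z False] VF_off[OF V(1) False] VF_off[OF V(2) False] VF_const[OF Z]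
          VF_const[OF V(1)] VF_const[OF V(2)])
  qed
qed

lemma bracket_fscale:
  assumes Z: "Z \<in> VF" and V: "V \<in> VF" and a: "a \<in> C"
  shows "lie_bracket Z (fscale_field a V) = fscale_field (\<lambda>p. Z p a) V + fscale_field a (lie_bracket Z V)"
proof (intro ext)
  fix p f
  show "lie_bracket Z (fscale_field a V) p f
      = (fscale_field (\<lambda>p. Z p a) V + fscale_field a (lie_bracket Z V)) p f"
  proof (cases "f \<in> C")
    case True
    then show ?thesis
      by (simp add: lie_bracket_def fscale_field_def fun_apply_simps VF_calc[OF Z] VF_calc[OF V] a)
        (simp add: algebra_simps)
  next
    case False
    then show ?thesis
      by (simp add: lie_bracket_def fscale_field_def fun_apply_simps VF_off[OF Z False] VF_off[OF V False] VF_const[OF Z]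
          VF_const[OF V])
  qed
qed

lemma contract_plus:
  "\<omega> \<in> \<Omega> \<Longrightarrow> V \<in> VF \<Longrightarrow> W \<in> VF \<Longrightarrow> contract (V + W) \<omega> = contract V \<omega> + contract W \<omega>"
  by (simp add: contract_def fun_eq_iff fun_apply_simps[where x="_ :: 'a"] hook_add[OF form_alternating])
    (simp add: fun_apply_simps)

lemma contract_fscale_field:
  "\<omega> \<in> \<Omega> \<Longrightarrow> V \<in> VF \<Longrightarrow> contract (fscale_field a V) \<omega> = fscale_form a (contract V \<omega>)"
  by (simp add: contract_def fscale_field_def fscale_form_def hook_scale[OF form_alternating])

section \<open>Tensoriality of the Lie derivative formula\<close>

lemma lie_eval_smooth:
  assumes Z: "Z \<in> VF" and "set Vs \<subseteq> VF" "\<omega> \<in> \<Omega>"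
  shows "(\<lambda>p. lie_eval Z Vs \<omega> p) \<in> C"
  using assms(2,3)
proof (induction Vs arbitrary: \<omega>)
  case Nil
  then show ?case using Z by (simp add: VF_smooth form_smooth_Nil)
next
  case (Cons V Vs)
  then have "(\<lambda>p. lie_eval Z Vs (contract V \<omega>) p - contract (lie_bracket Z V) \<omega> p (map (\<lambda>V. V p) Vs)) \<in> C"
    using Z by (intro smooth_diff form_smooth form_contract VF_bracket Cons.IH) auto
  then show ?case by simp
qed

lemma lie_eval_add:
  assumes Z: "Z \<in> VF" and "set Vs \<subseteq> VF" "\<alpha> \<in> \<Omega>" "\<beta> \<in> \<Omega>"
  shows "lie_eval Z Vs (\<alpha> + \<beta>) p = lie_eval Z Vs \<alpha> p + lie_eval Z Vs \<beta> p"
  using assms(2-)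
proof (induction Vs arbitrary: \<alpha> \<beta>)
  case Nil
  then show ?case by (simp add: VF_add[OF Z] form_smooth_Nil fun_apply_simps)
next
  case (Cons V Vs)
  then show ?case by (simp add: contract_add form_contract) (simp add: fun_apply_simps)
qed

lemma lie_eval_fscale:
  assumes Z: "Z \<in> VF" and "set Vs \<subseteq> VF" "\<omega> \<in> \<Omega>" and a: "a \<in> C"
  shows "lie_eval Z Vs (fscale_form a \<omega>) p = Z p a * \<omega> p (map (\<lambda>V. V p) Vs) + a p * lie_eval Z Vs \<omega> p"
  using assms(2,3)
proof (induction Vs arbitrary: \<omega>)
  case Nil
  then show ?case by (simp add: VF_mult[OF Z] a form_smooth_Nil fscale_form_def)
next
  case (Cons V Vs)
  have "lie_eval Z Vs (fscale_form a (contract V \<omega>)) p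
      = Z p a * contract V \<omega> p (map (\<lambda>V. V p) Vs) + a p * lie_eval Z Vs (contract V \<omega>) p"
    using Cons by (auto intro: form_contract)
  then show ?case
    by (simp add: contract_fscale) (simp add: fscale_form_def contract_def hook_def algebra_simps)
qed

lemma lie_eval_scale:
  "Z \<in> VF \<Longrightarrow> set Vs \<subseteq> VF \<Longrightarrow> \<omega> \<in> \<Omega> \<Longrightarrow> lie_eval Z Vs (scale_form c \<omega>) p = c * lie_eval Z Vs \<omega> p"
  by (simp add: scale_form_eq lie_eval_fscale VF_const)

lemma lie_eval_zero: "Z \<in> VF \<Longrightarrow> set Vs \<subseteq> VF \<Longrightarrow> lie_eval Z Vs 0 p = 0"
  using lie_eval_add[of Z Vs 0 0 p] by simp

lemma lie_eval_slot_add: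
  assumes Z: "Z \<in> VF" and W: "V \<in> VF" "W \<in> VF" "set Ws \<subseteq> VF" and "set Us \<subseteq> VF" "\<omega> \<in> \<Omega>"
  shows "lie_eval Z (Us @ (V + W) # Ws) \<omega> p = lie_eval Z (Us @ V # Ws) \<omega> p + lie_eval Z (Us @ W # Ws) \<omega> p"
  using assms(5-)
proof (induction Us arbitrary: \<omega>)
  case Nil
  have "contract (lie_bracket Z (V + W)) \<omega> = contract (lie_bracket Z V) \<omega> + contract (lie_bracket Z W) \<omega>"
    using Nil Z W by (simp add: bracket_plus contract_plus VF_bracket)
  then show ?case
    using Nil Z W by (simp add: contract_plus lie_eval_add form_contract) (simp add: fun_apply_simps)
next
  case (Cons U Us)
  have "contract (lie_bracket Z U) \<omega> p (map (\<lambda>V. V p) (Us @ (V + W) # Ws))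
      = contract (lie_bracket Z U) \<omega> p (map (\<lambda>V. V p) (Us @ V # Ws))
        + contract (lie_bracket Z U) \<omega> p (map (\<lambda>V. V p) (Us @ W # Ws))"
    using alternating_add[OF form_alternating[of "contract (lie_bracket Z U) \<omega>" p],
        of "map (\<lambda>V. V p) Us" "map (\<lambda>V. V p) Ws" "V p" "W p"] VF_list[of Us p] VF_list[of Ws p] Cons.prems Z W
    by (simp add: form_contract VF_bracket plus_fun_apply[of V W])
  then show ?case using Cons by (simp add: form_contract)
qed

text \<open>The derivative of a occurs twice: from the product rule in the leading term, and from
  the bracket of Z with a V. The two occurrences cancel, so the expression is linear over functions
  in each slot.\<close>

lemma lie_eval_slot_fscale:
  assumes Z: "Z \<in> VF" and V: "V \<in> VF" "set Ws \<subseteq> VF" and a: "a \<in> C" and "set Us \<subseteq> VF" "\<omega> \<in> \<Omega>"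
  shows "lie_eval Z (Us @ fscale_field a V # Ws) \<omega> p = a p * lie_eval Z (Us @ V # Ws) \<omega> p"
  using assms(5-)
proof (induction Us arbitrary: \<omega>)
  case Nil
  have Za: "(\<lambda>p. Z p a) \<in> C" using Z a by (rule VF_smooth)
  have "contract (lie_bracket Z (fscale_field a V)) \<omega>
      = fscale_form (\<lambda>p. Z p a) (contract V \<omega>) + fscale_form a (contract (lie_bracket Z V) \<omega>)"
    using Nil Z V a Za by (simp add: bracket_fscale contract_plus contract_fscale_field VF_bracket VF_fscale)
  then show ?case
    using Nil Z V a
    by (simp add: contract_fscale_field lie_eval_fscale form_contract)
      (simp add: fun_apply_simps fscale_form_def algebra_simps)
next
  case (Cons U Us)
  have "contract (lie_bracket Z U) \<omega> p (map (\<lambda>V. V p) (Us @ fscale_field a V # Ws))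
      = a p * contract (lie_bracket Z U) \<omega> p (map (\<lambda>V. V p) (Us @ V # Ws))"
    using alternating_scale[OF form_alternating[of "contract (lie_bracket Z U) \<omega>" p],
        of "map (\<lambda>V. V p) Us" "map (\<lambda>V. V p) Ws" "V p" "a p"] VF_list[of Us p] VF_list[of Ws p] Cons.prems Z V
    by (simp add: form_contract VF_bracket fscale_field_def)
  then show ?case using Cons by (simp add: form_contract algebra_simps)
qed

text \<open>With the repetition at the head, the double contraction by V is 0, and the two bracket
  terms differ by exchanging V with its bracket, so they cancel by antisymmetry.\<close>

lemma lie_eval_repeat:
  assumes Z: "Z \<in> VF" and V: "V \<in> VF" "set Ws \<subseteq> VF" and "set Us \<subseteq> VF" "\<omega> \<in> \<Omega>"
  shows "lie_eval Z (Us @ V # V # Ws) \<omega> p = 0"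
  using assms(4-)
proof (induction Us arbitrary: \<omega>)
  case Nil
  have "contract V (contract V \<omega>) = 0"
    using Nil by (simp add: contract_def zero_fun_def hook_hook_same[OF form_alternating])
  moreover have "contract (lie_bracket Z V) (contract V \<omega>) p vs = - contract V (contract (lie_bracket Z V) \<omega>) p vs" for vs
    using hook_commute[OF form_alternating[OF Nil(2)] VF_tangent[OF VF_bracket[OF Z V(1)]] VF_tangent[OF V(1)], of p vs]
    by (simp add: contract_def)
  moreover have "contract (lie_bracket Z V) \<omega> p (V p # vs) = contract V (contract (lie_bracket Z V) \<omega>) p vs" for vs
    by (simp add: contract_def hook_def)
  ultimately show ?case using lie_eval_zero[OF Z V(2)] by simp
next
  case (Cons U Us)
  have "contract (lie_bracket Z U) \<omega> p (map (\<lambda>V. V p) (Us @ V # V # Ws)) = 0"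
    using Cons.prems Z by (intro alternating_distinct[OF form_alternating]) (auto intro: form_contract)
  then show ?case using Cons by (simp add: form_contract)
qed

lemma lie_eval_homogeneous:
  assumes Z: "Z \<in> VF" and "set Vs \<subseteq> VF" "\<omega> \<in> H k" "odd (length Vs + k)"
  shows "lie_eval Z Vs \<omega> p = 0"
  using assms(2-)
proof (induction Vs arbitrary: \<omega> k)
  case Nil
  then have "(\<lambda>q. \<omega> q []) = (\<lambda>_. 0)" by (auto simp: homogeneous_iff has_parity_def)
  then show ?case using Z by (simp add: VF_const)
next
  case (Cons V Vs)
  have "lie_eval Z Vs (contract V \<omega>) p = 0"
    using Cons.prems by (intro Cons.IH[of _ "Suc k"] homogeneous_contract) auto
  moreover have "contract (lie_bracket Z V) \<omega> p (map (\<lambda>V. V p) Vs) = 0"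
    using Cons.prems homogeneous_contract[of "lie_bracket Z V" \<omega> k] Z
    by (auto simp: homogeneous_iff has_parity_def VF_bracket)
  ultimately show ?case by simp
qed

lemma lie_eval_invol:
  assumes Z: "Z \<in> VF" and "set Vs \<subseteq> VF" "\<omega> \<in> \<Omega>"
  shows "lie_eval Z Vs (invol_form \<omega>) p = (-1) ^ length Vs * lie_eval Z Vs \<omega> p"
  using assms(2-)
proof (induction Vs arbitrary: \<omega>)
  case Nil
  then show ?case by (simp add: invol_form_def invol_def)
next
  case (Cons V Vs)
  have "lie_eval Z Vs (contract V (invol_form \<omega>)) p = - lie_eval Z Vs (invol_form (contract V \<omega>)) p"
    using Cons.prems Z by (simp add: contract_invol_form lie_eval_scale form_invol form_contract)
  also have "\<dots> = (-1) ^ length (V # Vs) * lie_eval Z Vs (contract V \<omega>) p"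
    using Cons by (simp add: form_contract)
  finally show ?case
    by (simp add: contract_def hook_def invol_form_def invol_def[of "\<omega> _" for \<omega>] algebra_simps)
qed

lemma lie_eval_function_form:
  "Z \<in> VF \<Longrightarrow> set Vs \<subseteq> VF \<Longrightarrow> lie_eval Z Vs (function_form f) p = function_form (\<lambda>p. Z p f) p (map (\<lambda>V. V p) Vs)"
proof (cases Vs)
  case Nil
  then show ?thesis by (simp add: function_form_def scalar_def)
next
  case (Cons V Ws)
  assume "Z \<in> VF" "set Vs \<subseteq> VF"
  then show ?thesis using Cons by (simp add: lie_eval_zero) (simp add: function_form_def scalar_def fun_apply_simps)
qed

end

context framed_mfd
begin

lemma field_expand:
  assumes "V \<in> VF" shows "V = (\<Sum>j\<in>UNIV. fscale_field (\<lambda>p. coeff p (V p) j) (X j))"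
  by (intro ext) (simp add: fun_apply_simps fscale_field_def, rule coeff_expand[OF VF_tangent[OF assms]])

lemma VF_sum [intro]: "(\<And>i. i \<in> I \<Longrightarrow> V i \<in> VF) \<Longrightarrow> (\<Sum>i\<in>I. V i) \<in> VF"
proof (induction I rule: infinite_finite_induct)
  case (insert i I)
  then show ?case by (simp add: VF_plus)
qed simp_all

lemma lie_eval_slot_sum:
  assumes Z: "Z \<in> VF" "set Ws \<subseteq> VF" "set Us \<subseteq> VF" "\<omega> \<in> \<Omega>"
    and V: "\<And>i. i \<in> I \<Longrightarrow> V i \<in> VF"
  shows "lie_eval Z (Us @ (\<Sum>i\<in>I. V i) # Ws) \<omega> p = (\<Sum>i\<in>I. lie_eval Z (Us @ V i # Ws) \<omega> p)"
proof -
  have *: "lie_eval Z (Us @ 0 # Ws) \<omega> p = 0"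
    using lie_eval_slot_add[OF Z(1) VF_zero VF_zero Z(2-4), of p] by simp
  show ?thesis using V
  proof (induction I rule: infinite_finite_induct)
    case (insert i I)
    have "(\<Sum>i\<in>I. V i) \<in> VF" using insert by auto
    then show ?case using insert lie_eval_slot_add[OF Z(1) _ _ Z(2-4), of "V i" "\<Sum>i\<in>I. V i" p] by simp
  qed (simp_all add: *)
qed

text \<open>V is expanded in the global frame, and linearity over functions takes the coefficients
  out of the slot, where they are evaluated at p. The slot thus depends on V only through its value
  at p.\<close>

lemma lie_eval_slot_pointwise:
  assumes Z: "Z \<in> VF" "set Ws \<subseteq> VF" "set Us \<subseteq> VF" "\<omega> \<in> \<Omega>" and V: "V \<in> VF"
  shows "lie_eval Z (Us @ V # Ws) \<omega> p = (\<Sum>j\<in>UNIV. coeff p (V p) j * lie_eval Z (Us @ X j # Ws) \<omega> p)"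
proof -
  have "lie_eval Z (Us @ V # Ws) \<omega> p
      = (\<Sum>j\<in>UNIV. lie_eval Z (Us @ fscale_field (\<lambda>p. coeff p (V p) j) (X j) # Ws) \<omega> p)"
    using V by (subst field_expand[OF V], subst lie_eval_slot_sum[OF Z]) (auto intro: coeff_smooth)
  then show ?thesis
    using Z V by (simp add: lie_eval_slot_fscale coeff_smooth)
qed

lemma lie_eval_cong:
  assumes Z: "Z \<in> VF" "\<omega> \<in> \<Omega>" and "length Vs = length Ws" "set Vs \<subseteq> VF" "set Ws \<subseteq> VF"
    and "map (\<lambda>V. V p) Vs = map (\<lambda>V. V p) Ws" and "set Us \<subseteq> VF"
  shows "lie_eval Z (Us @ Vs) \<omega> p = lie_eval Z (Us @ Ws) \<omega> p"
  using assms(3-)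
proof (induction Vs Ws arbitrary: Us rule: list_induct2)
  case (Cons V Vs W Ws)
  have "lie_eval Z (Us @ V # Vs) \<omega> p = lie_eval Z (Us @ W # Vs) \<omega> p"
    using Cons.prems Z lie_eval_slot_pointwise[of Z Vs Us \<omega>] by simp
  also have "\<dots> = lie_eval Z (Us @ W # Ws) \<omega> p"
    using Cons.IH[of "Us @ [W]"] Cons.prems by simp
  finally show ?case .
qed simp

text \<open>Constant coefficients make the extension a global smooth field that is linear in v, so
  that multilinearity in fields passes to tangent vectors.\<close>

definition extend :: "'a \<Rightarrow> 'a tangent \<Rightarrow> 'a vector_field" where
  "extend p v = (\<Sum>j\<in>UNIV. fscale_field (\<lambda>_. coeff p v j) (X j))"

lemma extend_VF [simp, intro]: "extend p v \<in> VF"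
  unfolding extend_def by auto

lemma extend_at [simp]: "v \<in> T p \<Longrightarrow> extend p v p = v"
  by (intro ext) (simp add: extend_def fun_apply_simps fscale_field_def, rule coeff_expand[symmetric])

lemma extend_list: "set vs \<subseteq> T p \<Longrightarrow> map (\<lambda>V. V p) (map (extend p) vs) = vs"
  by (induction vs) auto

lemma form_eqI:
  assumes "\<alpha> \<in> \<Omega>" "\<beta> \<in> \<Omega>"
    and eq: "\<And>Vs p. set Vs \<subseteq> VF \<Longrightarrow> \<alpha> p (map (\<lambda>V. V p) Vs) = \<beta> p (map (\<lambda>V. V p) Vs)"
  shows "\<alpha> = \<beta>"
proof (intro ext)
  fix p vs
  show "\<alpha> p vs = \<beta> p vs"
  proof (cases "set vs \<subseteq> T p")
    case True
    then show ?thesis using eq[of "map (extend p) vs" p] by (simp only: extend_list[OF True]) auto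
  next
    case False
    then show ?thesis using assms(1,2) by (simp add: alternating_off[OF form_alternating])
  qed
qed

text \<open>An explicit witness for the definite description in \<open>lie_derivative\<close>;
  \<open>lie_form_eval\<close> shows that the chosen extensions do not affect the value.\<close>

definition lie_form :: "'a vector_field \<Rightarrow> 'a form \<Rightarrow> 'a form" where
  "lie_form Z \<omega> = (\<lambda>p vs. if set vs \<subseteq> T p then lie_eval Z (map (extend p) vs) \<omega> p else 0)"

lemma lie_form_eval:
  assumes "Z \<in> VF" "\<omega> \<in> \<Omega>" "set Vs \<subseteq> VF"
  shows "lie_form Z \<omega> p (map (\<lambda>V. V p) Vs) = lie_eval Z Vs \<omega> p"
proof -
  have T: "set (map (\<lambda>V. V p) Vs) \<subseteq> T p" using assms(3) by auto
  show ?thesis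
    using lie_eval_cong[OF assms(1,2), of "map (extend p) (map (\<lambda>V. V p) Vs)" Vs p "[]"] assms(3) extend_list[OF T] T
    by (simp add: lie_form_def image_subset_iff)
qed

text \<open>The extensions change with the base point, so smoothness is read off after
  \<open>lie_form_eval\<close> has replaced them by the given fields. The algebraic laws at a fixed
  p come from the slot rules of \<open>lie_eval\<close>.\<close>

lemma form_lie_form:
  assumes Z: "Z \<in> VF" and \<omega>: "\<omega> \<in> \<Omega>"
  shows "lie_form Z \<omega> \<in> \<Omega>"
  unfolding diff_forms_iff
proof (intro conjI allI impI)
  show "(\<lambda>p. lie_form Z \<omega> p (map (\<lambda>V. V p) Vs)) \<in> C" if "set Vs \<subseteq> VF" for Vs
    using lie_eval_smooth[OF Z that \<omega>] by (simp add: lie_form_eval[OF Z \<omega> that])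
  fix p
  have e: "set (map (extend p) vs) \<subseteq> VF" for vs by auto
  show "alternating p (lie_form Z \<omega> p)"
  proof (rule alternatingI)
    fix us ws v w assume h: "set us \<subseteq> T p" "set ws \<subseteq> T p" "v \<in> T p" "w \<in> T p"
    have "extend p (v + w) = extend p v + extend p w"
      using coeff_add[OF h(3,4)]
      by (intro ext) (simp add: extend_def fscale_field_def fun_apply_simps plus_fun_def sum.distrib algebra_simps)
    then show "lie_form Z \<omega> p (us @ (v + w) # ws) = lie_form Z \<omega> p (us @ v # ws) + lie_form Z \<omega> p (us @ w # ws)"
      using h lie_eval_slot_add[OF Z extend_VF extend_VF e e \<omega>] tangent_plus by (simp add: lie_form_def)
  next
    fix us ws v and c :: real assume h: "set us \<subseteq> T p" "set ws \<subseteq> T p" "v \<in> T p"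
    have "extend p (\<lambda>f. c * v f) = fscale_field (\<lambda>_. c) (extend p v)"
      using coeff_scale[OF h(3)]
      by (intro ext) (simp add: extend_def fscale_field_def fun_apply_simps sum_distrib_left algebra_simps)
    then show "lie_form Z \<omega> p (us @ (\<lambda>f. c * v f) # ws) = c * lie_form Z \<omega> p (us @ v # ws)"
      using h lie_eval_slot_fscale[OF Z extend_VF e smooth_const e \<omega>] tangent_space_scale by (simp add: lie_form_def)
  next
    fix us ws v assume h: "set us \<subseteq> T p" "set ws \<subseteq> T p" "v \<in> T p"
    then show "lie_form Z \<omega> p (us @ v # v # ws) = 0"
      using lie_eval_repeat[OF Z extend_VF e e \<omega>] by (simp add: lie_form_def)
  qed (simp add: lie_form_def)
qed

lemma lie_derivative_eq:
  assumes Z: "Z \<in> VF" and \<omega>: "\<omega> \<in> \<Omega>"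
  shows "lie_derivative A Z \<omega> = lie_form Z \<omega>"
proof -
  have "(THE \<eta>. \<eta> \<in> \<Omega> \<and> (\<forall>Vs p. set Vs \<subseteq> VF \<longrightarrow>
      \<eta> p (map (\<lambda>V. V p) Vs) = Z p (\<lambda>q. \<omega> q (map (\<lambda>V. V q) Vs)) -
        (\<Sum>i<length Vs. \<omega> p (map (\<lambda>V. V p) (Vs[i := lie_bracket Z (Vs ! i)]))))) = lie_form Z \<omega>"
    unfolding lie_eval_eq[symmetric]
    by (rule the_equality)
      (auto simp: form_lie_form[OF Z \<omega>] lie_form_eval[OF Z \<omega>] intro!: form_eqI[OF _ form_lie_form[OF Z \<omega>]])
  then show ?thesis using \<omega> by (simp add: lie_derivative_def)
qed

lemma contract_lie_form:
  assumes Z: "Z \<in> VF" and \<omega>: "\<omega> \<in> \<Omega>" and V: "V \<in> VF"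
  shows "contract V (lie_form Z \<omega>) = lie_form Z (contract V \<omega>) + scale_form (-1) (contract (lie_bracket Z V) \<omega>)"
proof (rule form_eqI)
  show "contract V (lie_form Z \<omega>) p (map (\<lambda>V. V p) Vs)
      = (lie_form Z (contract V \<omega>) + scale_form (-1) (contract (lie_bracket Z V) \<omega>)) p (map (\<lambda>V. V p) Vs)"
    if "set Vs \<subseteq> VF" for Vs p
  proof -
    have "contract V (lie_form Z \<omega>) p (map (\<lambda>V. V p) Vs) = lie_form Z \<omega> p (map (\<lambda>V. V p) (V # Vs))"
      by (simp add: contract_def hook_def)
    also have "\<dots> = lie_eval Z (V # Vs) \<omega> p"
      by (rule lie_form_eval[OF Z \<omega>]) (use that V in auto)
    finally show ?thesis
      using lie_form_eval[OF Z form_contract[OF V \<omega>] that] by (simp add: fun_apply_simps scale_form_def)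
  qed
qed (use assms in \<open>auto intro!: form_contract form_lie_form form_add form_scale\<close>)

lemma lie_form_invol:
  assumes Z: "Z \<in> VF" and \<omega>: "\<omega> \<in> \<Omega>"
  shows "lie_form Z (invol_form \<omega>) = invol_form (lie_form Z \<omega>)"
proof (rule form_eqI)
  show "lie_form Z (invol_form \<omega>) p (map (\<lambda>V. V p) Vs) = invol_form (lie_form Z \<omega>) p (map (\<lambda>V. V p) Vs)"
    if "set Vs \<subseteq> VF" for Vs p
    using that lie_form_eval[OF Z _ that] lie_eval_invol[OF Z that \<omega>] \<omega>
    by (simp add: form_invol invol_form_def[of "lie_form _ _"] invol_def)
qed (use assms in \<open>auto intro!: form_invol form_lie_form\<close>)

text \<open>Contraction with the first field splits the product into two products, to each of which
  the induction hypothesis applies on the remaining fields. \<open>contract_lie_form\<close> then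
  absorbs the bracket terms, and \<open>contract_wedge\<close> reassembles the contraction of the
  right-hand side.\<close>

lemma lie_form_wedge:
  assumes Z: "Z \<in> VF" and "\<alpha> \<in> \<Omega>" "\<beta> \<in> \<Omega>"
  shows "lie_form Z (wedge \<alpha> \<beta>) = wedge (lie_form Z \<alpha>) \<beta> + wedge \<alpha> (lie_form Z \<beta>)"
proof (rule form_eqI)
  have "lie_eval Z Vs (wedge \<alpha> \<beta>) p
      = wedge (lie_form Z \<alpha>) \<beta> p (map (\<lambda>V. V p) Vs) + wedge \<alpha> (lie_form Z \<beta>) p (map (\<lambda>V. V p) Vs)"
    if "set Vs \<subseteq> VF" "\<alpha> \<in> \<Omega>" "\<beta> \<in> \<Omega>" for Vs p \<alpha> \<beta>
    using that
  proof (induction Vs arbitrary: \<alpha> \<beta>)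
    case Nil
    then show ?case
      using Z lie_form_eval[OF Z Nil(2), of "[]" p] lie_form_eval[OF Z Nil(3), of "[]" p]
      by (simp add: wedge_eq VF_mult[OF Z] form_smooth_Nil)
  next
    case (Cons V Vs)
    then have V: "V \<in> VF" "set Vs \<subseteq> VF" and \<alpha>: "\<alpha> \<in> \<Omega>" and \<beta>: "\<beta> \<in> \<Omega>" by auto
    let ?at = "\<lambda>\<omega>. \<omega> p (map (\<lambda>V. V p) Vs)"
    let ?B = "lie_bracket Z V"
    have B: "?B \<in> VF" using Z V by auto
    have W: "?at (wedge (lie_form Z \<gamma>) \<delta> + wedge \<gamma> (lie_form Z \<delta>)) = lie_eval Z Vs (wedge \<gamma> \<delta>) p"
      if "\<gamma> \<in> \<Omega>" "\<delta> \<in> \<Omega>" for \<gamma> \<delta>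
      using Cons.IH[OF V(2) that] by (simp add: fun_apply_simps)
    have head: "\<omega> p (map (\<lambda>V. V p) (V # Vs)) = ?at (contract V \<omega>)" for \<omega> :: "'a form"
      by (simp add: contract_def hook_def)
    have "lie_eval Z (V # Vs) (wedge \<alpha> \<beta>) p
        = lie_eval Z Vs (wedge (contract V \<alpha>) \<beta> + wedge (invol_form \<alpha>) (contract V \<beta>)) p
          - ?at (wedge (contract ?B \<alpha>) \<beta> + wedge (invol_form \<alpha>) (contract ?B \<beta>))"
      by (simp add: contract_wedge)
    also have "lie_eval Z Vs (wedge (contract V \<alpha>) \<beta> + wedge (invol_form \<alpha>) (contract V \<beta>)) p
        = lie_eval Z Vs (wedge (contract V \<alpha>) \<beta>) p + lie_eval Z Vs (wedge (invol_form \<alpha>) (contract V \<beta>)) p"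
      using V \<alpha> \<beta> by (intro lie_eval_add[OF Z]) auto
    also have "\<dots> = ?at (wedge (lie_form Z (contract V \<alpha>)) \<beta> + wedge (contract V \<alpha>) (lie_form Z \<beta>))
        + ?at (wedge (invol_form (lie_form Z \<alpha>)) (contract V \<beta>) + wedge (invol_form \<alpha>) (lie_form Z (contract V \<beta>)))"
      using V \<alpha> \<beta> W[of "contract V \<alpha>" \<beta>] W[of "invol_form \<alpha>" "contract V \<beta>"]
      by (simp add: lie_form_invol[OF Z] form_contract form_invol)
    also have "\<dots> - ?at (wedge (contract ?B \<alpha>) \<beta> + wedge (invol_form \<alpha>) (contract ?B \<beta>))
        = ?at (contract V (wedge (lie_form Z \<alpha>) \<beta>)) + ?at (contract V (wedge \<alpha> (lie_form Z \<beta>)))"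
      unfolding contract_wedge contract_lie_form[OF Z \<alpha> V(1)] contract_lie_form[OF Z \<beta> V(1)]
        wedge_add_left wedge_add_right wedge_scale_left wedge_scale_right
      by (simp add: fun_apply_simps scale_form_def)
    finally show ?case unfolding head .
  qed
  then show "lie_form Z (wedge \<alpha> \<beta>) p (map (\<lambda>V. V p) Vs)
      = (wedge (lie_form Z \<alpha>) \<beta> + wedge \<alpha> (lie_form Z \<beta>)) p (map (\<lambda>V. V p) Vs)"
    if "set Vs \<subseteq> VF" for Vs p
    using that assms by (simp add: lie_form_eval form_wedge fun_apply_simps)
qed (use assms in \<open>auto intro!: form_wedge form_lie_form form_add\<close>)

lemma lie_form_function:
  assumes Z: "Z \<in> VF" and f: "f \<in> C"
  shows "lie_form Z (function_form f) = function_form (\<lambda>p. Z p f)"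
  by (rule form_eqI)
    (use assms in \<open>auto simp: lie_form_eval lie_eval_function_form form_function form_lie_form VF_smooth\<close>)

lemma HDer_lie_derivative:
  assumes Z: "Z \<in> VF" shows "lie_derivative A Z \<in> HDer 0"
proof (rule HDerI)
  show "lie_derivative A Z \<omega> = 0" if "\<omega> \<notin> \<Omega>" for \<omega>
    using that by (simp add: lie_derivative_def)
  show "lie_derivative A Z (\<alpha> + \<beta>) = lie_derivative A Z \<alpha> + lie_derivative A Z \<beta>"
    if "\<alpha> \<in> \<Omega>" "\<beta> \<in> \<Omega>" for \<alpha> \<beta>
    unfolding lie_derivative_eq[OF Z that(1)] lie_derivative_eq[OF Z that(2)] lie_derivative_eq[OF Z form_add[OF that]]
    using that Z
    by (intro form_eqI) (auto simp: lie_form_eval lie_eval_add form_add fun_apply_simps intro!: form_lie_form form_add)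
  show "lie_derivative A Z (scale_form c \<alpha>) = scale_form c (lie_derivative A Z \<alpha>)" if "\<alpha> \<in> \<Omega>" for c \<alpha>
    unfolding lie_derivative_eq[OF Z that] lie_derivative_eq[OF Z form_scale[OF that]]
  proof (rule form_eqI)
    show "lie_form Z (scale_form c \<alpha>) p (map (\<lambda>V. V p) Vs) = scale_form c (lie_form Z \<alpha>) p (map (\<lambda>V. V p) Vs)"
      if "set Vs \<subseteq> VF" for Vs p
      using that \<open>\<alpha> \<in> \<Omega>\<close> Z
      by (simp add: lie_form_eval lie_eval_scale form_scale scale_form_def[of c "lie_form _ _"])
  qed (intro form_lie_form form_scale Z that)+
  show "lie_derivative A Z \<alpha> \<in> H (0 + l)" if "\<alpha> \<in> H l" for l \<alpha>
  proof -
    have "lie_form Z \<alpha> \<in> H l"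
      unfolding homogeneous_iff[of "lie_form Z \<alpha>"]
    proof (intro conjI allI form_lie_form[OF Z homogeneous_form[OF that]])
      show "has_parity l (lie_form Z \<alpha> p)" for p
        using that by (auto simp: has_parity_def lie_form_def intro!: lie_eval_homogeneous[OF Z])
    qed
    then show ?thesis by (simp add: lie_derivative_eq[OF Z homogeneous_form[OF that]])
  qed
  show "lie_derivative A Z (wedge \<alpha> \<beta>) = wedge (lie_derivative A Z \<alpha>) \<beta>
      + scale_form ((-1) ^ (0 * l)) (wedge \<alpha> (lie_derivative A Z \<beta>))" if "\<alpha> \<in> H l" "\<beta> \<in> \<Omega>" for l \<alpha> \<beta>
    using that homogeneous_form[OF that(1)] by (simp add: lie_derivative_eq[OF Z] form_wedge lie_form_wedge[OF Z])
qed

end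


section \<open>The frame of the module of derivations\<close>

lemma form_mult_zero [simp]: "form_mult 0 D = 0" "form_mult \<alpha> 0 = 0"
  for D :: "'a operator" and \<alpha> :: "'a form"
  by (rule ext, simp add: form_mult_def zero_fun_apply[where 'b="'a form"])+

lemma form_mult_one: "form_mult (function_form (\<lambda>_. 1)) D = D"
  by (rule ext) (simp add: form_mult_def wedge_one_left)

lemma form_mult_add_left: "form_mult (\<alpha> + \<beta>) D = form_mult \<alpha> D + form_mult \<beta> D"
  by (rule ext) (simp add: form_mult_def wedge_add_left plus_fun_apply[where 'b="'a form"])

lemma form_mult_add_right: "form_mult \<alpha> (D + E) = form_mult \<alpha> D + form_mult \<alpha> E"
  by (rule ext) (simp add: form_mult_def wedge_add_right plus_fun_apply[where 'b="'a form"])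

lemma form_mult_sum_right: "form_mult \<alpha> (\<Sum>i\<in>I. D i) = (\<Sum>i\<in>I. form_mult \<alpha> (D i))"
  by (induction I rule: infinite_finite_induct) (simp_all add: form_mult_add_right)

lemma form_mult_mult: "form_mult \<alpha> (form_mult \<beta> D) = form_mult (wedge \<alpha> \<beta>) D"
  by (simp add: form_mult_def wedge_assoc)

lemma (in smooth_mfd) Der_form_mult:
  assumes \<alpha>: "\<alpha> \<in> \<Omega>" and D: "D \<in> HDer k" shows "form_mult \<alpha> D \<in> Der"
proof -
  obtain \<beta> \<gamma> where "\<beta> \<in> H 0" "\<gamma> \<in> H 1" "\<alpha> = \<beta> + \<gamma>" using \<alpha> by (rule parity_split)
  then show ?thesis
    using HDer_Der[OF HDer_form_mult[OF _ D]] by (auto simp: form_mult_add_left)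
qed

context framed_mfd
begin

section \<open>The dual coframe and the determination of derivations by their values\<close>

definition coframe :: "'m \<Rightarrow> 'a form" where
  "coframe j = (\<lambda>p vs. case vs of [v] \<Rightarrow> if v \<in> T p then coeff p v j else 0 | _ \<Rightarrow> 0)"

lemma coframe_simps [simp]:
  "coframe j p [] = 0"
  "coframe j p [v] = (if v \<in> T p then coeff p v j else 0)"
  "coframe j p (v # w # vs) = 0"
  by (simp_all add: coframe_def)

lemma coframe_H: "coframe j \<in> H 1"
proof -
  have "alternating p (coframe j p)" for p
  proof (rule alternatingI)
    show "coframe j p vs = 0" if "\<not> set vs \<subseteq> T p" for vs
      using that by (auto simp: coframe_def split: list.splits)
    show "coframe j p (us @ (v + w) # ws) = coframe j p (us @ v # ws) + coframe j p (us @ w # ws)"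
      if "v \<in> T p" "w \<in> T p" for us ws v w
      using that tangent_plus[OF that] coeff_add[OF that, of j]
      by (cases us; cases ws; cases "tl us") (auto simp: plus_fun_def coframe_def split: list.splits)
    show "coframe j p (us @ (\<lambda>f. c * v f) # ws) = c * coframe j p (us @ v # ws)"
      if "v \<in> T p" for us ws v c
      using that tangent_space_scale[OF that] coeff_scale[OF that]
      by (cases us; cases ws; cases "tl us") (auto simp: coframe_def split: list.splits)
    show "coframe j p (us @ v # v # ws) = 0" for us ws v
      by (cases us; cases "tl us") (auto simp: coframe_def split: list.splits)
  qed
  moreover have "(\<lambda>p. coframe j p (map (\<lambda>V. V p) Vs)) \<in> C" if "set Vs \<subseteq> VF" for Vs
  proof (cases "length Vs = 1")
    case True
    then obtain V where "Vs = [V]" by (auto simp: length_Suc_conv)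
    then show ?thesis using that coeff_smooth by simp
  next
    case False
    then have "(\<lambda>p. coframe j p (map (\<lambda>V. V p) Vs)) = (\<lambda>_. 0)"
      by (cases Vs; cases "tl Vs") auto
    then show ?thesis by simp
  qed
  ultimately have "coframe j \<in> \<Omega>" by (simp add: diff_forms_iff)
  then show ?thesis
    by (auto simp: homogeneous_iff has_parity_def coframe_def split: list.splits)
qed

lemma coframe_form: "coframe j \<in> \<Omega>"
  using coframe_H by (rule homogeneous_form)

lemma hook_coframe: "v \<in> T p \<Longrightarrow> hook v (coframe j p) = scalar (coeff p v j)"
  by (auto simp: hook_def scalar_def coframe_def fun_eq_iff split: list.splits)

lemma contract_frame_coframe: "contract (X i) (coframe j) = function_form (\<lambda>_. if i = j then 1 else 0)"
  by (simp add: contract_def function_form_def hook_coframe coeff_frame)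

lemma hook_frame_expand:
  assumes a: "alternating p a" and v: "v \<in> T p"
  shows "hook v a vs = (\<Sum>j\<in>UNIV. coeff p v j * hook (X j p) a vs)"
proof -
  have "v = (\<lambda>f. \<Sum>j\<in>UNIV. coeff p v j * X j p f)" using coeff_expand[OF v] by blast
  then have "hook v a vs = hook (\<lambda>f. \<Sum>j\<in>UNIV. coeff p v j * X j p f) a vs" by simp
  also have "\<dots> = (\<Sum>j\<in>UNIV. coeff p v j * hook (X j p) a vs)" by (rule hook_sum[OF a]) auto
  finally show ?thesis .
qed

text \<open>Euler's identity for the grading by degree; it reduces a form of positive degree to forms of
  lower degree and the coframe.\<close>

lemma euler_pointwise:
  "alternating p a \<Longrightarrow>
    (\<Sum>j\<in>UNIV. shuffle_prod (coframe j p) (hook (X j p) a) vs) = real (length vs) * a vs"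
proof (induction vs arbitrary: a)
  case (Cons v vs)
  show ?case
  proof (cases "v \<in> T p")
    case True
    have "invol (coframe j p) = (\<lambda>vs. - coframe j p vs)" for j
      using invol_has_parity[of 1 "coframe j p"] coframe_H by (simp add: homogeneous_iff)
    moreover have "hook v (hook (X j p) a) = (\<lambda>vs. - hook (X j p) (hook v a) vs)" for j
      using hook_commute[OF Cons.prems True VF_tangent[OF frame_VF]] by blast
    ultimately have "shuffle_prod (coframe j p) (hook (X j p) a) (v # vs)
        = coeff p v j * hook (X j p) a vs + shuffle_prod (coframe j p) (hook (X j p) (hook v a)) vs" for j
      by (simp add: shuffle_prod_Cons hook_coframe[OF True] shuffle_prod_scalar shuffle_prod_linear)
    then have "(\<Sum>j\<in>UNIV. shuffle_prod (coframe j p) (hook (X j p) a) (v # vs))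
        = hook v a vs + real (length vs) * hook v a vs"
      using Cons.IH[OF hook_alternating[OF Cons.prems True]] hook_frame_expand[OF Cons.prems True, of vs, symmetric]
      by (simp add: sum.distrib)
    then show ?thesis by (simp add: hook_def algebra_simps)
  next
    case False
    have "hook v (coframe j p) = (\<lambda>_. 0)" "hook v (hook (X j p) a) = (\<lambda>_. 0)" for j
      using hook_off[OF form_alternating[OF coframe_form] False]
        hook_off[OF hook_alternating[OF Cons.prems VF_tangent[OF frame_VF]] False] by auto
    then show ?thesis
      using alternating_off[OF Cons.prems, of "v # vs"] False by (simp add: shuffle_prod_Cons)
  qed
qed simp

text \<open>Inserting a frame vector with index in J removes that index from J, since a repeated
  insertion gives 0. Taking J to be all indices shows that forms vanish above the dimension.\<close>

lemma alternating_vanishes: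
  assumes "alternating p a" "card J < length vs" "\<And>j. j \<notin> J \<Longrightarrow> hook (X j p) a = (\<lambda>_. 0)"
  shows "a vs = 0"
  using assms
proof (induction vs arbitrary: a J)
  case (Cons v vs)
  note a = Cons.prems(1)
  show ?case
  proof (cases "v \<in> T p")
    case True
    have "hook (X j p) a vs = 0" for j
    proof (cases "j \<in> J")
      case j: True
      show ?thesis
      proof (rule Cons.IH[of _ "J - {j}"])
        show "alternating p (hook (X j p) a)" using a by (rule hook_alternating) simp
        have "card (J - {j}) < card J" using j by (intro psubset_card_mono) auto
        then show "card (J - {j}) < length vs" using Cons.prems(2) by simp
        show "hook (X i p) (hook (X j p) a) = (\<lambda>_. 0)" if "i \<notin> J - {j}" for i
        proof (cases "i = j")
          case True
          then show ?thesis using hook_hook_same[OF a] by simp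
        next
          case False
          then have "hook (X i p) a = (\<lambda>_. 0)" using that Cons.prems(3) by blast
          then show ?thesis
            using hook_commute[OF a, of "X i p" "X j p"] by (simp add: fun_eq_iff hook_def)
        qed
      qed
    qed (use Cons.prems(3) in simp)
    then have "hook v a vs = 0" by (simp add: hook_frame_expand[OF a True])
    then show ?thesis by (simp add: hook_def)
  qed (use alternating_off[OF a] in auto)
qed simp

definition component :: "nat \<Rightarrow> 'a form \<Rightarrow> 'a form" where
  "component n \<omega> = (\<lambda>p vs. if length vs = n then \<omega> p vs else 0)"

lemma component_form: assumes \<omega>: "\<omega> \<in> \<Omega>" shows "component n \<omega> \<in> \<Omega>"
  unfolding diff_forms_iff
proof (intro conjI allI impI)
  show "alternating p (component n \<omega> p)" for p
    using alternating_length[OF form_alternating[OF \<omega>], where g = "\<lambda>k. if k = n then 1 else 0" and p = p]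
    by (simp add: component_def if_distrib[where f="\<lambda>x. x * _"] cong: if_cong)
  show "(\<lambda>p. component n \<omega> p (map (\<lambda>V. V p) Vs)) \<in> C" if "set Vs \<subseteq> VF" for Vs
    using form_smooth[OF \<omega> that] by (cases "length Vs = n") (simp_all add: component_def)
qed

text \<open>The sum is finite because forms vanish above the dimension; this allows additivity of a
  derivation to be applied to it.\<close>

lemma component_sum:
  assumes \<omega>: "\<omega> \<in> \<Omega>" shows "\<omega> = (\<Sum>n\<le>CARD('m). component n \<omega>)"
proof (intro ext)
  fix p vs
  have "(\<Sum>n\<le>CARD('m). component n \<omega> p vs) = (if length vs \<le> CARD('m) then \<omega> p vs else 0)"
    by (simp add: component_def)
  moreover have "\<omega> p vs = 0" if "\<not> length vs \<le> CARD('m)"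
    using alternating_vanishes[OF form_alternating[OF \<omega>], where J = UNIV and vs = vs] that by simp
  ultimately show "\<omega> p vs = (\<Sum>n\<le>CARD('m). component n \<omega>) p vs"
    by (auto simp: sum_fun_apply)
qed

text \<open>Induction on the exact degree. Euler's identity writes a multiple of a form of degree n
  + 1 as a sum of products of the coframe with forms of degree n, and the Leibniz rule evaluates D
  and E on these products.\<close>

lemma HDer_eqI:
  assumes D: "D \<in> HDer k" and E: "E \<in> HDer k"
    and fn: "\<And>f. f \<in> C \<Longrightarrow> D (function_form f) = E (function_form f)"
    and co: "\<And>j. D (coframe j) = E (coframe j)"
  shows "D = E"
proof
  have step: "D \<omega> = E \<omega>" if "\<omega> \<in> \<Omega>" "\<And>p vs. length vs \<noteq> n \<Longrightarrow> \<omega> p vs = 0" for n \<omega>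
    using that
  proof (induction n arbitrary: \<omega>)
    case 0
    have "\<omega> = function_form (\<lambda>p. \<omega> p [])"
      using 0(2) by (auto simp: function_form_def scalar_def fun_eq_iff)
    then show ?case using fn[OF form_smooth_Nil[OF 0(1)]] by simp
  next
    case (Suc n)
    have c: "contract (X j) \<omega> \<in> \<Omega>" for j using Suc.prems(1) by (intro form_contract frame_VF)
    have IH: "D (contract (X j) \<omega>) = E (contract (X j) \<omega>)" for j
      using c by (rule Suc.IH) (simp add: contract_def hook_def Suc.prems(2))
    have eu: "scale_form (Suc n) \<omega> = (\<Sum>j\<in>UNIV. wedge (coframe j) (contract (X j) \<omega>))"
    proof (intro ext)
      fix p vs
      show "scale_form (Suc n) \<omega> p vs = (\<Sum>j\<in>UNIV. wedge (coframe j) (contract (X j) \<omega>)) p vs"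
        using euler_pointwise[OF form_alternating[OF Suc.prems(1)], of p vs] Suc.prems(2)[of vs p]
        by (cases "length vs = Suc n") (simp_all add: sum_fun_apply wedge_eq contract_def scale_form_def)
    qed
    have w: "wedge (coframe j) (contract (X j) \<omega>) \<in> \<Omega>" for j
      using c coframe_form by (rule form_wedge[rotated])
    have "D (scale_form (Suc n) \<omega>) = E (scale_form (Suc n) \<omega>)"
      unfolding eu HDer_sum[OF D w] HDer_sum[OF E w] HDer_wedge[OF D coframe_H c] HDer_wedge[OF E coframe_H c]
      by (simp add: co IH)
    \<comment> \<open>The Euler factor n + 1 is divided out, using that derivations are linear over
      the reals.\<close>
    then have "scale_form (1 / Suc n) (scale_form (Suc n) (D \<omega>)) = scale_form (1 / Suc n) (scale_form (Suc n) (E \<omega>))"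
      using HDer_scale[OF D Suc.prems(1)] HDer_scale[OF E Suc.prems(1)] by simp
    then show ?case by (simp add: scale_form_scale)
  qed
  show "D \<omega> = E \<omega>" for \<omega>
  proof (cases "\<omega> \<in> \<Omega>")
    case True
    have "D (component n \<omega>) = E (component n \<omega>)" for n
      using component_form[OF True] by (rule step[where n=n]) (simp add: component_def)
    then have "D (\<Sum>n\<le>CARD('m). component n \<omega>) = E (\<Sum>n\<le>CARD('m). component n \<omega>)"
      by (simp add: HDer_sum[OF D component_form[OF True]] HDer_sum[OF E component_form[OF True]])
    then show ?thesis using component_sum[OF True] by simp
  qed (simp add: HDer_off[OF D] HDer_off[OF E])
qed

section \<open>Coefficients of a derivation in the frame\<close>

abbreviation "L j \<equiv> lie_derivative A (X j)"
abbreviation "I j \<equiv> interior_product A (X j)"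

lemma L_function: "f \<in> C \<Longrightarrow> L j (function_form f) = function_form (\<lambda>p. X j p f)"
  by (simp add: lie_derivative_eq form_function lie_form_function)

lemma I_function: "f \<in> C \<Longrightarrow> I j (function_form f) = 0"
  by (simp add: interior_product_eq form_function)

lemma I_coframe: "I i (coframe j) = function_form (\<lambda>_. if i = j then 1 else 0)"
  by (simp add: interior_product_eq coframe_form contract_frame_coframe)

lemma L_HDer: "L j \<in> HDer 0"
  by (rule HDer_lie_derivative) simp

lemma I_HDer: "I j \<in> HDer 1"
  by (rule HDer_interior_product) simp

definition frame_comb :: "('m \<Rightarrow> 'a form) \<Rightarrow> ('m \<Rightarrow> 'a form) \<Rightarrow> 'a operator" where
  "frame_comb \<alpha> \<beta> = (\<Sum>j\<in>UNIV. form_mult (\<alpha> j) (L j)) + (\<Sum>j\<in>UNIV. form_mult (\<beta> j) (I j))"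

text \<open>On functions the interior products vanish and \<open>L i\<close> acts as
  \<open>X i\<close>. So for fixed p and vs the coefficients are the frame coordinates of the
  tangent vector sending f to the value of D f on vs.\<close>

definition lie_coeff :: "'a operator \<Rightarrow> 'm \<Rightarrow> 'a form" where
  "lie_coeff D j = (\<lambda>p vs. coeff p (\<lambda>f. D (function_form f) p vs) j)"

text \<open>\<open>I i\<close> sends the coframe to constants 0 or 1, so its coefficient is the
  value of D on the coframe minus the contribution of the Lie derivatives, which in general move the
  coframe.\<close>

definition int_coeff :: "'a operator \<Rightarrow> 'm \<Rightarrow> 'a form" where
  "int_coeff D j = D (coframe j) + scale_form (-1) (\<Sum>i\<in>UNIV. wedge (lie_coeff D i) (L i (coframe j)))"

lemma frame_comb_apply:
  "frame_comb \<alpha> \<beta> \<omega> = (\<Sum>j\<in>UNIV. wedge (\<alpha> j) (L j \<omega>)) + (\<Sum>j\<in>UNIV. wedge (\<beta> j) (I j \<omega>))"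
  by (simp add: frame_comb_def plus_fun_apply[where 'b="'a form"] sum_fun_apply form_mult_def)

lemma frame_comb_add:
  "frame_comb (\<lambda>j. \<alpha> j + \<alpha>' j) (\<lambda>j. \<beta> j + \<beta>' j) = frame_comb \<alpha> \<beta> + frame_comb \<alpha>' \<beta>'"
  by (simp add: frame_comb_def form_mult_add_left sum.distrib add_ac)

lemma form_mult_frame_comb:
  "form_mult \<gamma> (frame_comb \<alpha> \<beta>) = frame_comb (\<lambda>j. wedge \<gamma> (\<alpha> j)) (\<lambda>j. wedge \<gamma> (\<beta> j))"
  by (simp add: frame_comb_def form_mult_add_right form_mult_sum_right form_mult_mult)

lemma frame_comb_HDer:
  assumes "\<And>j. \<alpha> j \<in> H k" "\<And>j. \<beta> j \<in> H (Suc k)"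
  shows "frame_comb \<alpha> \<beta> \<in> HDer k"
proof -
  have "form_mult (\<alpha> j) (L j) \<in> HDer k" for j using HDer_form_mult[OF assms(1) L_HDer] by simp
  moreover have "form_mult (\<beta> j) (I j) \<in> HDer k" for j
    using HDer_form_mult[OF assms(2) I_HDer, of j] HDer_cong[of "Suc k + 1" k] by simp
  ultimately show ?thesis unfolding frame_comb_def by (intro HDer_plus HDer_sum_op)
qed

lemma frame_comb_Der:
  "(\<And>j. \<alpha> j \<in> \<Omega>) \<Longrightarrow> (\<And>j. \<beta> j \<in> \<Omega>) \<Longrightarrow> frame_comb \<alpha> \<beta> \<in> Der"
  unfolding frame_comb_def
  by (intro Der_add Der_sum Der_form_mult[OF _ L_HDer] Der_form_mult[OF _ I_HDer])

text \<open>Multiplying a form by a function multiplies its value at p by the value of the function,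
  so the Leibniz rule becomes the product rule at p for each fixed list vs. The default value of D
  off forms matches that of tangent vectors off smooth functions.\<close>

lemma Der_tangent:
  assumes D: "D \<in> Der" shows "(\<lambda>f. D (function_form f) p vs) \<in> T p"
proof (rule tangent_spaceI)
  fix f g assume f: "f \<in> C" and g: "g \<in> C"
  have "function_form (\<lambda>q. f q + g q) = function_form f + function_form g"
    by (simp add: fun_eq_iff function_form_def scalar_def fun_apply_simps)
  then show "D (function_form (\<lambda>q. f q + g q)) p vs = D (function_form f) p vs + D (function_form g) p vs"
    using Der_add_arg[OF D form_function[OF f] form_function[OF g]] by (simp add: fun_apply_simps)
  have "function_form (\<lambda>q. f q * g q) = wedge (function_form f) (function_form g)"
    unfolding wedge_function_form by (simp add: fun_eq_iff fscale_form_def function_form_def scalar_def)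
  then show "D (function_form (\<lambda>q. f q * g q)) p vs
      = f p * D (function_form g) p vs + D (function_form f) p vs * g p"
    using Der_wedge_even[OF D homogeneous_function[OF f] form_function[OF g]]
    by (simp add: fun_apply_simps wedge_function_form wedge_function_form_right fscale_form_def)
next
  fix f c assume f: "f \<in> C"
  have "function_form (\<lambda>q. c * f q) = scale_form c (function_form f)"
    by (simp add: fun_eq_iff function_form_def scalar_def scale_form_def)
  then show "D (function_form (\<lambda>q. c * f q)) p vs = c * D (function_form f) p vs"
    using Der_scale[OF D form_function[OF f]] by (simp add: scale_form_def)
next
  fix f assume "f \<notin> C"
  then show "D (function_form f) p vs = 0"
    using Der_off[OF D] by (simp add: function_form_iff fun_apply_simps)
qed

lemma Der_const: assumes "D \<in> Der" shows "D (function_form (\<lambda>_. c)) = 0"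
proof (intro ext)
  show "D (function_form (\<lambda>_. c)) p vs = 0 p vs" for p vs
    using tangent_const[OF Der_tangent[OF assms, of p vs], of c] by (simp add: fun_apply_simps)
qed

lemma lie_coeff_form:
  assumes D: "D \<in> Der" shows "lie_coeff D j \<in> \<Omega>"
  unfolding diff_forms_iff
proof (intro conjI allI impI)
  fix p
  note a = form_alternating[OF Der_form[OF D]]
  show "alternating p (lie_coeff D j p)"
    unfolding alternating_def
  proof (intro conjI allI impI)
    show "lie_coeff D j p vs = 0" if "\<not> set vs \<subseteq> T p" for vs
      using alternating_off[OF a that] by (simp add: lie_coeff_def)
    show "lie_coeff D j p vs = 0" if "\<not> distinct vs" for vs
      using alternating_distinct[OF a that] by (simp add: lie_coeff_def)
    show "lie_coeff D j p (us @ (v + w) # ws) = lie_coeff D j p (us @ v # ws) + lie_coeff D j p (us @ w # ws)"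
      if "set us \<union> set ws \<union> {v, w} \<subseteq> T p" for us ws v w
      using that alternating_add[OF a, where us = us and ws = ws and v = v and w = w and p = p]
      by (simp add: lie_coeff_def coeff_add[OF Der_tangent[OF D] Der_tangent[OF D], symmetric])
    show "lie_coeff D j p (us @ (\<lambda>f. c * v f) # ws) = c * lie_coeff D j p (us @ v # ws)"
      if "set us \<union> set ws \<union> {v} \<subseteq> T p" for us ws v c
      using that alternating_scale[OF a, where us = us and ws = ws and v = v and c = c and p = p]
      by (simp add: lie_coeff_def coeff_scale[OF Der_tangent[OF D], symmetric])
  qed
next
  fix Vs assume Vs: "set Vs \<subseteq> VF"
  \<comment> \<open>Evaluated on fixed fields, D acts on functions as a vector field, whose frame
    coefficients are smooth.\<close>
  have "(\<lambda>p f. D (function_form f) p (map (\<lambda>V. V p) Vs)) \<in> VF"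
    unfolding vector_fields_def
    by (intro CollectI conjI allI ballI Der_tangent[OF D] form_smooth[OF Der_form[OF D] Vs])
  from coeff_smooth[OF this] show "(\<lambda>p. lie_coeff D j p (map (\<lambda>V. V p) Vs)) \<in> C"
    by (simp add: lie_coeff_def)
qed

lemma int_coeff_form: assumes D: "D \<in> Der" shows "int_coeff D j \<in> \<Omega>"
  unfolding int_coeff_def
  by (intro form_add form_scale form_sum form_wedge Der_form[OF D] lie_coeff_form[OF D] HDer_form[OF L_HDer])

lemma lie_coeff_H:
  assumes D: "D \<in> HDer k" shows "lie_coeff D j \<in> H k"
  unfolding homogeneous_iff[of "lie_coeff D j"]
proof (intro conjI allI lie_coeff_form[OF HDer_Der[OF D]])
  show "has_parity k (lie_coeff D j p)" for p
    unfolding has_parity_def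
  proof (intro allI impI)
    fix vs :: "'a tangent list" assume odd: "odd (length vs + k)"
    have "D (function_form f) p vs = 0" for f
    proof (cases "f \<in> C")
      case True
      then show ?thesis
        using HDer_homogeneous[OF D homogeneous_function[OF True]] odd
        by (simp add: homogeneous_iff has_parity_def)
    qed (simp add: HDer_off[OF D] function_form_iff fun_apply_simps)
    then show "lie_coeff D j p vs = 0" by (simp add: lie_coeff_def)
  qed
qed

lemma int_coeff_H: assumes D: "D \<in> HDer k" shows "int_coeff D j \<in> H (Suc k)"
proof -
  have "D (coframe j) \<in> H (Suc k)" using HDer_homogeneous[OF D coframe_H] by simp
  moreover have "wedge (lie_coeff D i) (L i (coframe j)) \<in> H (Suc k)" for i
    using homogeneous_wedge[OF lie_coeff_H[OF D] HDer_homogeneous[OF L_HDer coframe_H]] by simp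
  ultimately show ?thesis
    unfolding int_coeff_def by (intro homogeneous_add homogeneous_scale homogeneous_sum)
qed

lemma frame_comb_function:
  "f \<in> C \<Longrightarrow> frame_comb \<alpha> \<beta> (function_form f) p vs = (\<Sum>j\<in>UNIV. \<alpha> j p vs * X j p f)"
  by (simp add: frame_comb_apply L_function I_function wedge_function_form_right)
    (simp add: fun_apply_simps fscale_form_def mult.commute)

lemma frame_comb_coframe:
  "frame_comb \<alpha> \<beta> (coframe k) = (\<Sum>j\<in>UNIV. wedge (\<alpha> j) (L j (coframe k))) + \<beta> k"
proof -
  have "wedge (\<beta> j) (I j (coframe k)) = (if j = k then \<beta> j else 0)" for j
    by (simp add: I_coframe wedge_function_form_right fscale_form_def fun_eq_iff fun_apply_simps)
  then show ?thesis by (simp add: frame_comb_apply)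
qed

text \<open>This is the linear independence half of the basis property. The values on functions give
  \<alpha>, and then those on the coframe give \<beta>. Non-smooth f are treated too, since
  \<open>coeff_unique\<close> compares tangent vectors on all functions.\<close>

lemma frame_comb_unique:
  shows lie_coeff_frame_comb: "lie_coeff (frame_comb \<alpha> \<beta>) j = \<alpha> j"
    and int_coeff_frame_comb: "int_coeff (frame_comb \<alpha> \<beta>) j = \<beta> j"
proof -
  have "frame_comb \<alpha> \<beta> (function_form f) p vs = (\<Sum>j\<in>UNIV. \<alpha> j p vs * X j p f)" for p vs f
  proof (cases "f \<in> C")
    case False
    then have "function_form f \<notin> \<Omega>" by (simp add: function_form_iff)
    then have "frame_comb \<alpha> \<beta> (function_form f) = 0"
      by (simp add: frame_comb_apply HDer_off[OF L_HDer] HDer_off[OF I_HDer])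
    then show ?thesis using VF_off[OF frame_VF False] by (simp add: fun_apply_simps)
  qed (rule frame_comb_function)
  then have *: "lie_coeff (frame_comb \<alpha> \<beta>) j = \<alpha> j" for j
    by (intro ext) (simp add: lie_coeff_def coeff_unique)
  then show "lie_coeff (frame_comb \<alpha> \<beta>) j = \<alpha> j" .
  show "int_coeff (frame_comb \<alpha> \<beta>) j = \<beta> j"
    by (simp add: int_coeff_def * frame_comb_coframe fun_eq_iff)
      (simp add: scale_form_def fun_apply_simps)
qed

lemma lie_coeff_add: "D \<in> Der \<Longrightarrow> E \<in> Der \<Longrightarrow> lie_coeff (D + E) j = lie_coeff D j + lie_coeff E j"
  using coeff_add[OF Der_tangent Der_tangent]
  by (intro ext) (simp add: lie_coeff_def fun_apply_simps)

lemma int_coeff_add: "D \<in> Der \<Longrightarrow> E \<in> Der \<Longrightarrow> int_coeff (D + E) j = int_coeff D j + int_coeff E j"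
  by (simp add: int_coeff_def lie_coeff_add wedge_add_left sum.distrib scale_form_add
      plus_fun_apply[of D E] add_ac)

text \<open>The spanning half of the basis property. In the homogeneous case both sides agree on
  functions and on the coframe by the choice of coefficients, so \<open>HDer_eqI\<close> applies;
  additivity of the coefficients handles mixed parity.\<close>

lemma Der_expand: assumes "D \<in> Der" shows "frame_comb (lie_coeff D) (int_coeff D) = D"
proof -
  have hom: "frame_comb (lie_coeff D) (int_coeff D) = D" if D: "D \<in> HDer k" for D k
  proof (rule HDer_eqI[OF _ D])
    show "frame_comb (lie_coeff D) (int_coeff D) \<in> HDer k"
      by (rule frame_comb_HDer[OF lie_coeff_H[OF D] int_coeff_H[OF D]])
    show "frame_comb (lie_coeff D) (int_coeff D) (function_form f) = D (function_form f)" if "f \<in> C" for f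
    proof (intro ext)
      show "frame_comb (lie_coeff D) (int_coeff D) (function_form f) p vs = D (function_form f) p vs" for p vs
        using coeff_expand[OF Der_tangent[OF HDer_Der[OF D], of p vs], of f]
        by (simp add: frame_comb_function[OF that] lie_coeff_def)
    qed
    show "frame_comb (lie_coeff D) (int_coeff D) (coframe j) = D (coframe j)" for j
      by (simp add: frame_comb_coframe int_coeff_def fun_eq_iff) (simp add: scale_form_def fun_apply_simps)
  qed
  obtain D0 D1 where D: "D = D0 + D1" "D0 \<in> HDer 0" "D1 \<in> HDer 1" using assms by (rule Der_split)
  have "frame_comb (\<lambda>j. lie_coeff D0 j + lie_coeff D1 j) (\<lambda>j. int_coeff D0 j + int_coeff D1 j) = D0 + D1"
    by (simp add: frame_comb_add hom[OF D(2)] hom[OF D(3)])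
  moreover have "lie_coeff (D0 + D1) = (\<lambda>j. lie_coeff D0 j + lie_coeff D1 j)"
    "int_coeff (D0 + D1) = (\<lambda>j. int_coeff D0 j + int_coeff D1 j)"
    using HDer_Der[OF D(2)] HDer_Der[OF D(3)] by (auto simp: lie_coeff_add int_coeff_add)
  ultimately show ?thesis by (simp only: D(1))
qed

lemma
  assumes E: "E \<in> Der"
  shows lie_coeff_form_mult: "lie_coeff (form_mult \<alpha> E) j = wedge \<alpha> (lie_coeff E j)"
    and int_coeff_form_mult: "int_coeff (form_mult \<alpha> E) j = wedge \<alpha> (int_coeff E j)"
proof -
  have "form_mult \<alpha> E = frame_comb (\<lambda>j. wedge \<alpha> (lie_coeff E j)) (\<lambda>j. wedge \<alpha> (int_coeff E j))"
    using form_mult_frame_comb[of \<alpha> "lie_coeff E" "int_coeff E"] by (simp add: Der_expand[OF E])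
  then show "lie_coeff (form_mult \<alpha> E) j = wedge \<alpha> (lie_coeff E j)"
    "int_coeff (form_mult \<alpha> E) j = wedge \<alpha> (int_coeff E j)"
    by (simp_all add: frame_comb_unique)
qed

lemma
  shows L_frame_comb: "frame_comb (\<lambda>j. function_form (\<lambda>_. if j = i then 1 else 0)) (\<lambda>_. 0) = L i"
    and I_frame_comb: "frame_comb (\<lambda>_. 0) (\<lambda>j. function_form (\<lambda>_. if j = i then 1 else 0)) = I i"
proof -
  have z: "function_form (\<lambda>_. 0) = (0 :: 'a form)"
    by (simp add: fun_eq_iff function_form_def scalar_def fun_apply_simps)
  have "form_mult (function_form (\<lambda>_. if j = i then 1 else 0)) D = (if j = i then D else 0)"
    for j and D :: "'a operator"
    by (simp add: form_mult_one z)
  then show "frame_comb (\<lambda>j. function_form (\<lambda>_. if j = i then 1 else 0)) (\<lambda>_. 0) = L i"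
    "frame_comb (\<lambda>_. 0) (\<lambda>j. function_form (\<lambda>_. if j = i then 1 else 0)) = I i"
    by (simp_all add: frame_comb_def)
qed


section \<open>The canonical connection\<close>

definition conn :: "'a operator \<Rightarrow> 'a operator \<Rightarrow> 'a operator" where
  "conn D E = (if D \<in> Der \<and> E \<in> Der
     then frame_comb (\<lambda>j. D (lie_coeff E j)) (\<lambda>j. D (int_coeff E j)) else 0)"

text \<open>The members of the frame have constant coefficients, and derivations kill
  constants.\<close>

lemma conn_frame:
  assumes D: "D \<in> Der" shows "conn D (L i) = 0" "conn D (I i) = 0"
proof -
  have z: "D 0 = 0" using Der_add_arg[OF D form_zero form_zero] by simp
  have "lie_coeff (L i) = (\<lambda>j. function_form (\<lambda>_. if j = i then 1 else 0))" "int_coeff (L i) = (\<lambda>_. 0)"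
    "lie_coeff (I i) = (\<lambda>_. 0)" "int_coeff (I i) = (\<lambda>j. function_form (\<lambda>_. if j = i then 1 else 0))"
    using L_frame_comb[of i, symmetric] I_frame_comb[of i, symmetric] by (auto simp only: frame_comb_unique)
  moreover have "frame_comb (\<lambda>_. 0) (\<lambda>_. 0) = 0" by (simp add: frame_comb_def)
  ultimately show "conn D (L i) = 0" "conn D (I i) = 0"
    by (simp_all add: conn_def Der_const[OF D] z)
qed

lemma conn_graded_connection: "graded_connection A conn"
proof -
  have 1: "conn D E \<in> Der" if "D \<in> Der" "E \<in> Der" for D E
    using that by (simp add: conn_def frame_comb_Der Der_form)
  have 2: "conn (D + D') E = conn D E + conn D' E" if "D \<in> Der" "D' \<in> Der" "E \<in> Der" for D D' E
    using that by (simp add: conn_def Der_add frame_comb_add plus_fun_apply[of D D'])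
  have 3: "conn D (E + E') = conn D E + conn D E'" if "D \<in> Der" "E \<in> Der" "E' \<in> Der" for D E E'
    using that
    by (simp add: conn_def Der_add frame_comb_add lie_coeff_add int_coeff_add Der_add_arg lie_coeff_form int_coeff_form)
  \<comment> \<open>The coefficients of \<open>L j\<close> have parity l and those of the odd
    \<open>I j\<close> have parity l + 1; D shifts both by k.\<close>
  have 4: "conn D E \<in> HDer (k + l)" if "D \<in> HDer k" "E \<in> HDer l" for D E k l
    using that HDer_homogeneous[OF that(1) lie_coeff_H[OF that(2)]]
      HDer_homogeneous[OF that(1) int_coeff_H[OF that(2)]] HDer_Der[OF that(1)] HDer_Der[OF that(2)]
    by (simp add: conn_def frame_comb_HDer)
  have 5: "conn (form_mult \<alpha> D) E = form_mult \<alpha> (conn D E)"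
    if "D \<in> HDer k" "E \<in> HDer l" "\<alpha> \<in> H n" for D E k l n \<alpha>
    using HDer_Der[OF that(1)] HDer_Der[OF that(2)] HDer_Der[OF HDer_form_mult[OF that(3,1)]]
    by (simp add: conn_def form_mult_frame_comb form_mult_def[of \<alpha> D])
  have 6: "conn D (form_mult \<alpha> E)
      = form_mult (D \<alpha>) E + form_mult (scale_form ((-1) ^ (k * n)) \<alpha>) (conn D E)"
    if D: "D \<in> HDer k" and E: "E \<in> HDer l" and \<alpha>: "\<alpha> \<in> H n" for D E k l n \<alpha>
  proof -
    note D' = HDer_Der[OF D] and E' = HDer_Der[OF E]
    \<comment> \<open>With this term also written in the frame, the rule becomes the graded Leibniz
      rule of D on the products of \<alpha> with the coefficients of E.\<close>
    have "form_mult (D \<alpha>) E = frame_comb (\<lambda>j. wedge (D \<alpha>) (lie_coeff E j)) (\<lambda>j. wedge (D \<alpha>) (int_coeff E j))"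
      using form_mult_frame_comb[of "D \<alpha>" "lie_coeff E" "int_coeff E"] by (simp add: Der_expand[OF E'])
    then show ?thesis
      using D' E' HDer_Der[OF HDer_form_mult[OF \<alpha> E]]
      by (simp add: conn_def lie_coeff_form_mult int_coeff_form_mult HDer_wedge[OF D \<alpha>] lie_coeff_form
          int_coeff_form frame_comb_add form_mult_frame_comb wedge_scale_left)
  qed
  show ?thesis
    unfolding graded_connection_def using 1 2 3 4 5 6 by (simp add: conn_def)
qed

text \<open>Expanding E in the frame and applying the Leibniz rule leaves only the terms in which D
  differentiates a coefficient, since N vanishes on the frame. The Leibniz rule is available for
  homogeneous arguments; biadditivity extends the equality to all derivations.\<close>

lemma conn_unique:
  assumes N: "graded_connection A N"
    and flat: "\<And>j D. D \<in> Der \<Longrightarrow> N D (L j) = 0" "\<And>j D. D \<in> Der \<Longrightarrow> N D (I j) = 0"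
  shows "N = conn"
proof (rule ext, rule ext)
  have off: "N D E = 0" if "\<not> (D \<in> Der \<and> E \<in> Der)" for D E
    using N that unfolding graded_connection_def by blast
  have add_left: "N (D + D') E = N D E + N D' E" if "D \<in> Der" "D' \<in> Der" "E \<in> Der" for D D' E
    using N that unfolding graded_connection_def by blast
  have add_right: "N D (E + E') = N D E + N D E'" if "D \<in> Der" "E \<in> Der" "E' \<in> Der" for D E E'
    using N that unfolding graded_connection_def by blast
  have leibniz: "N D (form_mult \<alpha> E) = form_mult (D \<alpha>) E + form_mult (scale_form ((-1) ^ (k * n)) \<alpha>) (N D E)"
    if "D \<in> HDer k" "E \<in> HDer l" "\<alpha> \<in> H n" for D E k l n \<alpha>
    using N that unfolding graded_connection_def by blast
  have zero_right: "N D 0 = 0" if "D \<in> Der" for D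
    using add_right[OF that Der_zero Der_zero] by simp
  have sum_right: "N D (\<Sum>j\<in>J. E j) = (\<Sum>j\<in>J. N D (E j))" if "D \<in> Der" "\<And>j. E j \<in> Der"
    for D J and E :: "'m \<Rightarrow> 'a operator"
    by (induction J rule: infinite_finite_induct) (simp_all add: that zero_right add_right Der_sum)
  have hom: "N D E = conn D E" if D: "D \<in> HDer k" and E: "E \<in> HDer l" for D E k l
  proof -
    note D' = HDer_Der[OF D] and E' = HDer_Der[OF E]
    have LD: "form_mult (lie_coeff E j) (L j) \<in> Der" for j
      by (rule HDer_Der[OF HDer_form_mult[OF lie_coeff_H[OF E] L_HDer]])
    have ID: "form_mult (int_coeff E j) (I j) \<in> Der" for j
      by (rule HDer_Der[OF HDer_form_mult[OF int_coeff_H[OF E] I_HDer]])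
    have "N D (frame_comb (lie_coeff E) (int_coeff E))
        = (\<Sum>j\<in>UNIV. N D (form_mult (lie_coeff E j) (L j))) + (\<Sum>j\<in>UNIV. N D (form_mult (int_coeff E j) (I j)))"
      unfolding frame_comb_def using D' LD ID by (simp add: add_right sum_right Der_sum)
    then show ?thesis
      using leibniz[OF D L_HDer lie_coeff_H[OF E]] leibniz[OF D I_HDer int_coeff_H[OF E]]
      by (simp add: Der_expand[OF E'] flat[OF D'] conn_def D' E') (simp add: frame_comb_def)
  qed
  note c = conn_graded_connection
  have c_off: "conn D E = 0" if "\<not> (D \<in> Der \<and> E \<in> Der)" for D E
    using that unfolding conn_def by auto
  have c_add_left: "conn (D + D') E = conn D E + conn D' E" if "D \<in> Der" "D' \<in> Der" "E \<in> Der" for D D' E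
    using c that unfolding graded_connection_def by blast
  have c_add_right: "conn D (E + E') = conn D E + conn D E'" if "D \<in> Der" "E \<in> Der" "E' \<in> Der" for D E E'
    using c that unfolding graded_connection_def by blast
  fix D E
  show "N D E = conn D E"
  proof (cases "D \<in> Der \<and> E \<in> Der")
    case True
    obtain D0 D1 where D: "D = D0 + D1" "D0 \<in> HDer 0" "D1 \<in> HDer 1" using True by (blast elim: Der_split)
    obtain E0 E1 where E: "E = E0 + E1" "E0 \<in> HDer 0" "E1 \<in> HDer 1" using True by (blast elim: Der_split)
    note Ders = HDer_Der[OF D(2)] HDer_Der[OF D(3)] HDer_Der[OF E(2)] HDer_Der[OF E(3)]
    show ?thesis
      using Ders hom[OF D(2) E(2)] hom[OF D(2) E(3)] hom[OF D(3) E(2)] hom[OF D(3) E(3)]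
      by (simp add: D(1) E(1) add_left add_right c_add_left c_add_right Der_add)
  qed (simp add: off c_off)
qed

end

theorem proposition5p1:
  fixes A :: "('a::{t2_space,second_countable_topology}, 'm::finite) chart set"
    and Xbar :: "'m \<Rightarrow> 'a vector_field"
  assumes "parallelizable_manifold A Xbar"
  shows "\<exists>!N. graded_connection A N \<and>
           (\<forall>j. \<forall>X\<in>derivations A.
              N X (lie_derivative A (Xbar j)) = 0 \<and> N X (interior_product A (Xbar j)) = 0)"
proof -
  interpret framed_mfd A Xbar by unfold_locales (rule assms)
  show ?thesis
  proof (rule ex1I[of _ conn])
    show "graded_connection A conn \<and> (\<forall>j. \<forall>X\<in>Der. conn X (L j) = 0 \<and> conn X (I j) = 0)"
      using conn_graded_connection conn_frame by blast
    show "N = conn" if "graded_connection A N \<and> (\<forall>j. \<forall>X\<in>Der. N X (L j) = 0 \<and> N X (I j) = 0)" for N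
      using that by (intro conn_unique) auto
  qed
qed

end
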